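(* Let $d\ge 1$, $1\le p\le\infty$, $u\in L^p(\mathbb{R}^d)$, let $0\le\sigma<\eta<s\le 1$ and put $\theta=\frac{\eta-\sigma}{s-\sigma}\in(0,1)$, so that $\eta=\theta s+(1-\theta)\sigma$. Set $\varkappa=2^{1/p}$ if $d=1$ and $\varkappa=1$ if $d\ge 2$, and $$N_p(\sigma,\eta,s)=2^{\frac{s-\eta}{s-\sigma}(\eta+1-\sigma)}\Big(\frac{s-\sigma}{\eta-\sigma}\Big)^{\frac{\eta-\sigma}{(s-\sigma)p}}\Big(\frac{s-\sigma}{s-\eta}\Big)^{\frac{s-\eta}{(s-\sigma)p}}.$$ Then $1\le N_p(\sigma,\eta,s)\le 2^{1+\frac1p}$ and the following hold. (I) For the seminorms $[\cdot]_{W^{t,p}}$: $$[u]_{W^{\eta,p}(\mathbb{R}^d)}\le \varkappa N_p(\sigma,\eta,s)\,[u]_{W^{s,p}(\mathbb{R}^d)}^{\theta}\,[u]_{W^{\sigma,p}(\mathbb{R}^d)}^{1-\theta},$$ $$[u]_{W^{\eta,p}(\mathbb{R}^d_+)}\le 4^{1/p}\varkappa N_p(\sigma,\eta,s)\,[u]_{W^{s,p}(\mathbb{R}^d_+)}^{\theta}\,[u]_{W^{\sigma,p}(\mathbb{R}^d_+)}^{1-\theta}.$$ (II) For the Gagliardo seminorms $|\cdot|_{W^{t,p}}$: $$|u|_{W^{\eta,p}(\mathbb{R}^d)}\le \Upsilon_{d,p}(\sigma,\eta,s)\,|u|_{W^{s,p}(\mathbb{R}^d)}^{\theta}\,|u|_{W^{\sigma,p}(\mathbb{R}^d)}^{1-\theta},$$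 $$|u|_{W^{\eta,p}(\mathbb{R}^d_+)}\le 4^{1/p}\Upsilon_{d,p}(\sigma,\eta,s)\,|u|_{W^{s,p}(\mathbb{R}^d_+)}^{\theta}\,|u|_{W^{\sigma,p}(\mathbb{R}^d_+)}^{1-\theta},$$ where $\Upsilon_{d,\infty}(\sigma,\eta,s)=N_\infty(\sigma,\eta,s)$, while for $p<\infty$ $$\Upsilon_{d,p}(\sigma,\eta,s)=\frac{\varkappa N_p(\sigma,\eta,s)}{[\eta(1-\eta)]^{1/p}}\times\begin{cases}\big[(s(1-s))^\theta(\sigma(1-\sigma))^{1-\theta}\big]^{1/p},&\sigma\ne0,\ s\ne1,\\ \big[(K_{d,p}\tfrac{|\mathbb{S}^{d-1}|}{p})^\theta(\sigma(1-\sigma))^{1-\theta}\big]^{1/p},&\sigma\ne0,\ s=1,\\ \big[(s(1-s))^\theta(\tfrac{2|\mathbb{S}^{d-1}|}{p})^{1-\theta}\big]^{1/p},&\sigma=0,\ s\ne1,\\ \big[\tfrac{|\mathbb{S}^{d-1}|}{p}K_{d,p}^\theta2^{1-\theta}\big]^{1/p},&\sigma=0,\ s=1.\end{cases}$$ (III) For the seminorms $[\cdot]^*_{W^{t,p}}$: $$[u]^*_{W^{\eta,p}(\mathbb{R}^d)}\le \Upsilon^*_{d,p}(\sigma,\eta,s)\,\big([u]^*_{W^{s,p}(\mathbb{R}^d)}\big)^{\theta}\big([u]^*_{W^{\sigma,p}(\mathbb{R}^d)}\big)^{1-\theta},$$ $$[u]^*_{W^{\eta,p}(\mathbb{R}^d_+)}\le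 4^{1/p}\Upsilon^*_{d,p}(\sigma,\eta,s)\,\big([u]^*_{W^{s,p}(\mathbb{R}^d_+)}\big)^{\theta}\big([u]^*_{W^{\sigma,p}(\mathbb{R}^d_+)}\big)^{1-\theta},$$ where $\Upsilon^*_{d,\infty}(\sigma,\eta,s)=N_\infty(\sigma,\eta,s)$, while for $p<\infty$ $$\Upsilon^*_{d,p}(\sigma,\eta,s)=\varkappa N_p(\sigma,\eta,s)\Big(\frac{B_{d,p,\eta}}{B_{d,p,s}^{\theta}B_{d,p,\sigma}^{1-\theta}}\Big)^{\frac1p}\le 2^{1+\frac2p}\,\frac{B_{\max}}{B_{\min}},$$ with $B_{\max}=\sup_{t\in[0,1]}B_{d,p,t}$ and $B_{\min}=\inf_{t\in[0,1]}B_{d,p,t}$.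
   Context: Conventions: $1/p=0$ if $p=\infty$. $\mathbb{R}^d_+=\{x\in\mathbb{R}^d: x_d>0\}$; seminorms over $\mathbb{R}^d_+$ are those of the restriction of $u$. $|\mathbb{S}^{d-1}|=2\pi^{d/2}/\Gamma(d/2)$ and $K_{d,p}=\frac{\Gamma(d/2)\Gamma((p+1)/2)}{\Gamma((d+p)/2)\Gamma(1/2)}$. For $\Omega\subset\mathbb{R}^d$ open and $1\le p<\infty$, the Gagliardo seminorm is $|u|^p_{W^{s,p}(\Omega)}=\|u\|^p_{L^p(\Omega)}$ if $s=0$; $=\iint_{\Omega\times\Omega}\frac{|u(x)-u(y)|^p}{|x-y|^{d+sp}}\,dy\,dx$ if $0<s<1$; $=\|\nabla u\|^p_{L^p(\Omega)}$ if $s=1$. The renormalized seminorm is $[u]^p_{W^{s,p}(\Omega)}=\frac{2|\mathbb{S}^{d-1}|}{p}\|u\|^p_{L^p(\Omega)}$ if $s=0$; $=s(1-s)|u|^p_{W^{s,p}(\Omega)}$ if $0<s<1$; $=K_{d,p}\frac{|\mathbb{S}^{d-1}|}{p}\|\nabla u\|^p_{L^p(\Omega)}$ if $s=1$. The seminorms equal $+\infty$ if $u\in L^p(\Omega)\setminus W^{s,p}(\Omega)$. For $p=\infty$: $|u|_{W^{s,\infty}(\Omega)}=[u]_{W^{s,\infty}(\Omega)}=[u]^*_{W^{s,\infty}(\Omega)}$ equals $\|u\|_{L^\infty(\Omega)}$ if $s=0$; $\sup_{x,y\in\Omega,\,x\ne y}\frac{|u(x)-u(y)|}{|x-y|^s}$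 if $0<s<1$; $\|\nabla u\|_{L^\infty(\Omega)}$ if $s=1$. Define, for $s\in(0,1)$, $C_{d,p,s}=\frac{s(1-2s)\pi^{\frac{1-d}{2}}\Gamma(\frac{d+sp}{2})}{\Gamma(\frac{1+sp}{2})\Gamma(p(1-s))\cos(s\pi)}$ (with $\frac{1-2s}{\cos(s\pi)}$ read as its limit $2/\pi$ at $s=1/2$), and $\widetilde C_{d,p,s}=C_{d,p,s}$ if $sp>1$, $\widetilde C_{d,p,s}=C_{d,2,\frac{sp}{2}}$ if $sp\le1$. For $1\le p<\infty$: $[u]^{*p}_{W^{s,p}(\Omega)}=\|u\|^p_{L^p(\Omega)}$ if $s=0$; $=\frac{\widetilde C_{d,p,s}}{2}|u|^p_{W^{s,p}(\Omega)}$ if $0<s<1$; $=\|\nabla u\|^p_{L^p(\Omega)}$ if $s=1$. Set $B_{d,p,s}=\frac{\widetilde C_{d,p,s}}{2s(1-s)}$ for $0<s<1$, $B_{d,p,0}=\frac{p}{2|\mathbb{S}^{d-1}|}$, $B_{d,p,1}=\frac{p}{K_{d,p}|\mathbb{S}^{d-1}|}$, so that $[u]^*_{W^{s,p}(\Omega)}=(B_{d,p,s})^{1/p}[u]_{W^{s,p}(\Omega)}$ for all $s\in[0,1]$. *)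

theory Defs
  imports "HOL-Probability.Probability"
begin

text \<open>
  The exponent \<open>p \<in> [1,\<infinity>]\<close> has type \<^typ>\<open>ennreal\<close>. Norms and seminorms take values in
  \<^typ>\<open>ennreal\<close>, with the value \<open>\<infinity>\<close> outside the corresponding function space.
\<close>

definition rcp :: "ennreal \<Rightarrow> real" where  \<comment> \<open>\<open>1/p\<close>, equal to \<open>0\<close> for \<open>p = \<infinity>\<close>\<close>
  "rcp p = enn2real (inverse p)"

definition epowr :: "ennreal \<Rightarrow> real \<Rightarrow> ennreal" (infixr "epowr" 80) where
  \<comment> \<open>only used for exponents \<open>a > 0\<close>, where \<open>\<infinity> epowr a = \<infinity>\<close> and \<open>0 epowr a = 0\<close>\<close>
  "x epowr a = (if x = \<infinity> then \<infinity> else ennreal (enn2real x powr a))"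


section \<open>Lebesgue norms\<close>

definition Lp_pow :: "'a::euclidean_space set \<Rightarrow> real \<Rightarrow> ('a \<Rightarrow> 'b::real_normed_vector) \<Rightarrow> ennreal" where
  \<comment> \<open>the \<open>p\<close>-th power of the \<open>L\<^sup>p\<close> norm, for real \<open>p\<close>\<close>
  "Lp_pow \<Omega> p f = (\<integral>\<^sup>+x. ennreal (norm (f x) powr p) \<partial>lebesgue_on \<Omega>)"

definition Linf_norm :: "'a::euclidean_space set \<Rightarrow> ('a \<Rightarrow> 'b::real_normed_vector) \<Rightarrow> ennreal" where
  "Linf_norm \<Omega> f = esssup (lebesgue_on \<Omega>) (\<lambda>x. ennreal (norm (f x)))"

definition Lp_norm :: "'a::euclidean_space set \<Rightarrow> ennreal \<Rightarrow> ('a \<Rightarrow> 'b::real_normed_vector) \<Rightarrow> ennreal" where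
  "Lp_norm \<Omega> p f =
     (if p = \<infinity> then Linf_norm \<Omega> f else Lp_pow \<Omega> (enn2real p) f epowr rcp p)"

definition Lp_space :: "'a::euclidean_space set \<Rightarrow> ennreal \<Rightarrow> ('a \<Rightarrow> real) set" where
  "Lp_space \<Omega> p = {f \<in> borel_measurable (lebesgue_on \<Omega>). Lp_norm \<Omega> p f < \<infinity>}"


section \<open>Weak gradients\<close>

definition partial_deriv :: "'a::euclidean_space \<Rightarrow> ('a \<Rightarrow> real) \<Rightarrow> 'a \<Rightarrow> real" where
  "partial_deriv b f x = frechet_derivative f (at x) b"

primrec Ck :: "nat \<Rightarrow> ('a::euclidean_space \<Rightarrow> real) \<Rightarrow> bool" where
  "Ck 0 f \<longleftrightarrow> continuous_on UNIV f"
| "Ck (Suc k) f \<longleftrightarrow> (\<forall>x. f differentiable (at x)) \<and> (\<forall>b\<in>Basis. Ck k (partial_deriv b f))"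

definition test_fun :: "'a::euclidean_space set \<Rightarrow> ('a \<Rightarrow> real) \<Rightarrow> bool" where
  \<comment> \<open>\<open>C\<^sup>\<infinity>\<close> functions with compact support in \<open>\<Omega>\<close>, extended by \<open>0\<close>\<close>
  "test_fun \<Omega> \<phi> \<longleftrightarrow>
     (\<forall>k. Ck k \<phi>) \<and> compact (closure {x. \<phi> x \<noteq> 0}) \<and> closure {x. \<phi> x \<noteq> 0} \<subseteq> \<Omega>"

definition loc_integrable ::
    "'a::euclidean_space set \<Rightarrow> ('a \<Rightarrow> 'b::{banach, second_countable_topology}) \<Rightarrow> bool" where
  "loc_integrable \<Omega> f \<longleftrightarrow> (\<forall>K. compact K \<and> K \<subseteq> \<Omega> \<longrightarrow> set_integrable lebesgue K f)"

definition weak_gradient :: "'a::euclidean_space set \<Rightarrow> ('a \<Rightarrow> real) \<Rightarrow> ('a \<Rightarrow> 'a) \<Rightarrow> bool" where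
  "weak_gradient \<Omega> u g \<longleftrightarrow> loc_integrable \<Omega> u \<and> loc_integrable \<Omega> g \<and>
     (\<forall>\<phi> b. test_fun \<Omega> \<phi> \<and> b \<in> Basis \<longrightarrow>
        (LINT x|lebesgue_on \<Omega>. u x * partial_deriv b \<phi> x)
          = - (LINT x|lebesgue_on \<Omega>. (g x \<bullet> b) * \<phi> x))"

text \<open>
  Weak gradients are unique almost everywhere, so each infimum below is over at most one value;
  it is \<open>\<infinity>\<close> if there is no weak gradient.
\<close>

definition grad_pow :: "'a::euclidean_space set \<Rightarrow> real \<Rightarrow> ('a \<Rightarrow> real) \<Rightarrow> ennreal" where
  "grad_pow \<Omega> p u = (INF g\<in>{g. weak_gradient \<Omega> u g}. Lp_pow \<Omega> p g)"

definition grad_inf :: "'a::euclidean_space set \<Rightarrow> ('a \<Rightarrow> real) \<Rightarrow> ennreal" where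
  "grad_inf \<Omega> u = (INF g\<in>{g. weak_gradient \<Omega> u g}. Linf_norm \<Omega> g)"


section \<open>Constants\<close>

definition sphere_area :: "nat \<Rightarrow> real" where
  "sphere_area d = 2 * pi powr (real d / 2) / Gamma (real d / 2)"

definition K_const :: "nat \<Rightarrow> real \<Rightarrow> real" where
  "K_const d p = Gamma (real d / 2) * Gamma ((p + 1) / 2)
                   / (Gamma ((real d + p) / 2) * Gamma (1 / 2))"

definition cos_ratio :: "real \<Rightarrow> real" where
  \<comment> \<open>\<open>(1 - 2s) / cos (s\<pi>)\<close>, with its limit at \<open>s = 1/2\<close>\<close>
  "cos_ratio s = (if s = 1/2 then 2 / pi else (1 - 2 * s) / cos (s * pi))"

definition C_const :: "nat \<Rightarrow> real \<Rightarrow> real \<Rightarrow> real" where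
  "C_const d p s = s * cos_ratio s * pi powr ((1 - real d) / 2) * Gamma ((real d + s * p) / 2)
                     / (Gamma ((1 + s * p) / 2) * Gamma (p * (1 - s)))"

definition Ct_const :: "nat \<Rightarrow> real \<Rightarrow> real \<Rightarrow> real" where
  "Ct_const d p s = (if s * p > 1 then C_const d p s else C_const d 2 (s * p / 2))"

definition B_const :: "nat \<Rightarrow> real \<Rightarrow> real \<Rightarrow> real" where
  "B_const d p s =
     (if s = 0 then p / (2 * sphere_area d)
      else if s = 1 then p / (K_const d p * sphere_area d)
      else Ct_const d p s / (2 * s * (1 - s)))"

text \<open>
  For \<open>p = 1\<close>, \<open>B_const d p s\<close> is unbounded as \<open>s \<rightarrow> 1\<close>, hence the values in \<^typ>\<open>ennreal\<close>.
\<close>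

definition B_max :: "nat \<Rightarrow> real \<Rightarrow> ennreal" where
  "B_max d p = (SUP t\<in>{0..1}. ennreal (B_const d p t))"

definition B_min :: "nat \<Rightarrow> real \<Rightarrow> ennreal" where
  "B_min d p = (INF t\<in>{0..1}. ennreal (B_const d p t))"


section \<open>Fractional seminorms\<close>

text \<open>
  The \<open>p\<close>-th powers of the three seminorms, for real \<open>p\<close> and \<open>s \<in> [0,1]\<close>.
\<close>

definition gagliardo_pow :: "'a::euclidean_space set \<Rightarrow> real \<Rightarrow> real \<Rightarrow> ('a \<Rightarrow> real) \<Rightarrow> ennreal" where
  "gagliardo_pow \<Omega> s p u =
     (if s = 0 then Lp_pow \<Omega> p u
      else if s = 1 then grad_pow \<Omega> p u
      else (\<integral>\<^sup>+x. \<integral>\<^sup>+y. ennreal (\<bar>u x - u y\<bar> powr p / norm (x - y) powr (real DIM('a) + s * p))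
              \<partial>lebesgue_on \<Omega> \<partial>lebesgue_on \<Omega>))"

definition renorm_pow :: "'a::euclidean_space set \<Rightarrow> real \<Rightarrow> real \<Rightarrow> ('a \<Rightarrow> real) \<Rightarrow> ennreal" where
  "renorm_pow \<Omega> s p u =
     (if s = 0 then ennreal (2 * sphere_area DIM('a) / p) * Lp_pow \<Omega> p u
      else if s = 1 then
        ennreal (K_const DIM('a) p * (sphere_area DIM('a) / p)) * grad_pow \<Omega> p u
      else ennreal (s * (1 - s)) * gagliardo_pow \<Omega> s p u)"

definition star_pow :: "'a::euclidean_space set \<Rightarrow> real \<Rightarrow> real \<Rightarrow> ('a \<Rightarrow> real) \<Rightarrow> ennreal" where
  "star_pow \<Omega> s p u =
     (if s = 0 then Lp_pow \<Omega> p u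
      else if s = 1 then grad_pow \<Omega> p u
      else ennreal (Ct_const DIM('a) p s / 2) * gagliardo_pow \<Omega> s p u)"

text \<open>
  Since \<open>u \<in> L\<^sup>\<infinity>\<close> stands for a class of functions, the Hoelder seminorm is that of the continuous
  representative on the open set \<open>\<Omega>\<close>, and \<open>\<infinity>\<close> if there is none: a representative with a finite
  supremum is continuous on \<open>\<Omega>\<close> and therefore unique there.
\<close>

definition Winf_seminorm :: "'a::euclidean_space set \<Rightarrow> real \<Rightarrow> ('a \<Rightarrow> real) \<Rightarrow> ennreal" where
  "Winf_seminorm \<Omega> s u =
     (if s = 0 then Linf_norm \<Omega> u
      else if s = 1 then grad_inf \<Omega> u
      else (INF v\<in>{v. AE x in lebesgue_on \<Omega>. v x = u x}.
              SUP (x, y)\<in>{(x, y). x \<in> \<Omega> \<and> y \<in> \<Omega> \<and> x \<noteq> y}.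
                ennreal (\<bar>v x - v y\<bar> / norm (x - y) powr s)))"

definition gagliardo :: "'a::euclidean_space set \<Rightarrow> real \<Rightarrow> ennreal \<Rightarrow> ('a \<Rightarrow> real) \<Rightarrow> ennreal" where
  "gagliardo \<Omega> s p u =
     (if p = \<infinity> then Winf_seminorm \<Omega> s u else gagliardo_pow \<Omega> s (enn2real p) u epowr rcp p)"

definition renorm :: "'a::euclidean_space set \<Rightarrow> real \<Rightarrow> ennreal \<Rightarrow> ('a \<Rightarrow> real) \<Rightarrow> ennreal" where
  "renorm \<Omega> s p u =
     (if p = \<infinity> then Winf_seminorm \<Omega> s u else renorm_pow \<Omega> s (enn2real p) u epowr rcp p)"

definition star_seminorm :: "'a::euclidean_space set \<Rightarrow> real \<Rightarrow> ennreal \<Rightarrow> ('a \<Rightarrow> real) \<Rightarrow> ennreal" where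
  "star_seminorm \<Omega> s p u =
     (if p = \<infinity> then Winf_seminorm \<Omega> s u else star_pow \<Omega> s (enn2real p) u epowr rcp p)"


section \<open>Interpolation constants\<close>

definition kappa :: "nat \<Rightarrow> ennreal \<Rightarrow> real" where
  "kappa d p = (if d = 1 then 2 powr rcp p else 1)"

definition N_const :: "ennreal \<Rightarrow> real \<Rightarrow> real \<Rightarrow> real \<Rightarrow> real" where
  "N_const p \<sigma> \<eta> s =
     2 powr ((s - \<eta>) / (s - \<sigma>) * (\<eta> + 1 - \<sigma>))
     * ((s - \<sigma>) / (\<eta> - \<sigma>)) powr ((\<eta> - \<sigma>) / (s - \<sigma>) * rcp p)
     * ((s - \<sigma>) / (s - \<eta>)) powr ((s - \<eta>) / (s - \<sigma>) * rcp p)"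

definition Upsilon :: "nat \<Rightarrow> ennreal \<Rightarrow> real \<Rightarrow> real \<Rightarrow> real \<Rightarrow> real" where
  "Upsilon d p \<sigma> \<eta> s =
     (if p = \<infinity> then N_const p \<sigma> \<eta> s
      else
        let \<theta> = (\<eta> - \<sigma>) / (s - \<sigma>); q = enn2real p; S = sphere_area d; K = K_const d q
        in kappa d p * N_const p \<sigma> \<eta> s / (\<eta> * (1 - \<eta>)) powr rcp p *
          (if \<sigma> \<noteq> 0 \<and> s \<noteq> 1 then
             ((s * (1 - s)) powr \<theta> * (\<sigma> * (1 - \<sigma>)) powr (1 - \<theta>)) powr rcp p
           else if \<sigma> \<noteq> 0 \<and> s = 1 then
             ((K * (S / q)) powr \<theta> * (\<sigma> * (1 - \<sigma>)) powr (1 - \<theta>)) powr rcp p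
           else if \<sigma> = 0 \<and> s \<noteq> 1 then
             ((s * (1 - s)) powr \<theta> * (2 * S / q) powr (1 - \<theta>)) powr rcp p
           else
             (S / q * K powr \<theta> * 2 powr (1 - \<theta>)) powr rcp p))"

definition Upsilon_star :: "nat \<Rightarrow> ennreal \<Rightarrow> real \<Rightarrow> real \<Rightarrow> real \<Rightarrow> real" where
  "Upsilon_star d p \<sigma> \<eta> s =
     (if p = \<infinity> then N_const p \<sigma> \<eta> s
      else
        let \<theta> = (\<eta> - \<sigma>) / (s - \<sigma>); B = B_const d (enn2real p)
        in kappa d p * N_const p \<sigma> \<eta> s
             * (B \<eta> / (B s powr \<theta> * B \<sigma> powr (1 - \<theta>))) powr rcp p)"

definition half_space :: "'a::euclidean_space \<Rightarrow> 'a set" where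
  "half_space e = {x. x \<bullet> e > 0}"

end

theory Submission
  imports Defs
begin

text \<open>
  Let \<open>V h\<close> be the integral of \<open>\<bar>u (x + h) - u x\<bar>\<^sup>p\<close> over the \<open>x\<close> such that \<open>x\<close> and \<open>x + h\<close> lie in \<open>\<Omega>\<close>.
  The Gagliardo seminorm of order \<open>\<eta>\<close> is the integral of \<open>V h / \<bar>h\<bar>\<^bsup>d+\<eta>p\<^esup>\<close>, which is split at
  \<open>\<bar>h\<bar> = R\<close>. For small \<open>h\<close>, the bound \<open>V (2h) \<le> 2\<^sup>p V h\<close> controls the integral by \<open>(2R)\<^bsup>p(s-\<eta>)\<^esup>\<close> times
  the renormalized seminorm of order \<open>s\<close>. For large \<open>h\<close>, averaging
  \<open>V h \<le> 2\<^bsup>p-1\<^esup> (V ((1+t)h) + V (th))\<close> over \<open>t > 0\<close> against the density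
  \<open>\<sigma>p (1+t)\<^bsup>-\<sigma>p-1\<^esup>\<close> controls it by \<open>2\<^sup>p R\<^bsup>-p(\<eta>-\<sigma>)\<^esup>\<close> times the renormalized seminorm of order \<open>\<sigma>\<close>.
  Optimising over \<open>R\<close> gives the constant \<open>N_const\<close>. On a half space one only uses increments
  pointing into it, so the same argument applies there without an extension of \<open>u\<close>.
\<close>

section \<open>Small and large increments\<close>

text \<open>The bounds must not degenerate as \<sigma> tends to 0 or s to 1, so both splitting
  estimates carry the renormalization factors along. For small h, p(1-\<eta>) times one integral is
  compared with p(1-s) times the other; for large h the factors are \<eta>p and \<sigma>p. What
  remains is \<eta> \<le> s and 1-\<eta> \<le> 1-\<sigma>, which produce exactly s(1-s) and
  \<sigma>(1-\<sigma>). The 2 in 2R comes from rounding a ratio of radii up to a power of 2, and 2^p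
  is the triangle constant 2^(p-1) times two summands.

  At the endpoints no increments of u are available on the right. For s = 1 the increment is an
  integral of the weak gradient along a segment, and averaging |g(x).h|^p over directions of h
  yields K times the sphere area. For \<sigma> = 0 the increment is bounded by the norm of u and the
  weight has an explicit tail.

  For p = \<infinity> pointwise bounds off a null set are interpolated and then extended to a
  representative. Since 0 * \<infinity> = 0 in \<open>ennreal\<close>, a vanishing factor next to an
  infinite one needs a separate argument everywhere.\<close>

abbreviation radial_weight :: "real \<Rightarrow> 'a::euclidean_space \<Rightarrow> ennreal" where
  "radial_weight q h \<equiv> ennreal (norm h powr (- real DIM('a) - q))"

lemma nn_integral_lborel_shift:
  fixes f :: "'a::euclidean_space \<Rightarrow> ennreal"
  assumes [measurable]: "f \<in> borel_measurable borel"
  shows "(\<integral>\<^sup>+x. f (x + c) \<partial>lborel) = (\<integral>\<^sup>+x. f x \<partial>lborel)"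
proof -
  have "(\<integral>\<^sup>+x. f x \<partial>lborel) = (\<integral>\<^sup>+x. f x \<partial>distr lborel borel ((+) c))"
    by (simp add: lborel_distr_plus)
  also have "\<dots> = (\<integral>\<^sup>+x. f (x + c) \<partial>lborel)"
    by (subst nn_integral_distr) (auto simp: add.commute)
  finally show ?thesis by simp
qed

lemma nn_integral_lborel_affine:
  fixes f :: "'a::euclidean_space \<Rightarrow> ennreal"
  assumes [measurable]: "f \<in> borel_measurable borel" and "c \<noteq> 0"
  shows "(\<integral>\<^sup>+x. f x \<partial>lborel) = ennreal (\<bar>c\<bar> ^ DIM('a)) * (\<integral>\<^sup>+x. f (c *\<^sub>R x) \<partial>lborel)"
  by (subst lborel_affine[OF \<open>c \<noteq> 0\<close>, of 0])
    (simp add: nn_integral_density nn_integral_distr nn_integral_cmult)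

lemma nn_integral_lborel_uminus:
  fixes f :: "'a::euclidean_space \<Rightarrow> ennreal"
  assumes [measurable]: "f \<in> borel_measurable borel"
  shows "(\<integral>\<^sup>+x. f (- x) \<partial>lborel) = (\<integral>\<^sup>+x. f x \<partial>lborel)"
  using nn_integral_lborel_affine[OF assms, of "-1"] by simp

text \<open>The Jacobian cancels the dimensional part of the weight, so a dilation by c costs
  exactly c^q.\<close>

lemma nn_integral_lborel_dilate_weight:
  fixes f :: "'a::euclidean_space \<Rightarrow> ennreal"
  assumes [measurable]: "f \<in> borel_measurable borel" "S \<in> sets borel" and "c > 0"
  shows "(\<integral>\<^sup>+h. f (c *\<^sub>R h) * radial_weight q h * indicator S (c *\<^sub>R h) \<partial>lborel)
    = ennreal (c powr q) * (\<integral>\<^sup>+h. f h * radial_weight q h * indicator S h \<partial>lborel)"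
proof -
  have *: "norm h powr (- real DIM('a) - q)
      = c powr (real DIM('a) + q) * norm (c *\<^sub>R h) powr (- real DIM('a) - q)" for h :: 'a
    using \<open>c > 0\<close> by (simp add: powr_mult flip: mult.assoc powr_add)
  have "(\<integral>\<^sup>+h. f (c *\<^sub>R h) * radial_weight q h * indicator S (c *\<^sub>R h) \<partial>lborel)
     = (\<integral>\<^sup>+h. ennreal (c powr (real DIM('a) + q)) *
          (f (c *\<^sub>R h) * ennreal (norm (c *\<^sub>R h) powr (- real DIM('a) - q)) * indicator S (c *\<^sub>R h)) \<partial>lborel)"
    by (subst *) (simp add: ennreal_mult ac_simps del: norm_scaleR)
  also have "\<dots> = ennreal (c powr q) * (ennreal (\<bar>c\<bar> ^ DIM('a)) *
      (\<integral>\<^sup>+h. f (c *\<^sub>R h) * ennreal (norm (c *\<^sub>R h) powr (- real DIM('a) - q)) * indicator S (c *\<^sub>R h) \<partial>lborel))"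
    using \<open>c > 0\<close>
    by (subst nn_integral_cmult)
       (auto simp: powr_add powr_realpow ennreal_mult ac_simps simp del: norm_scaleR)
  also have "\<dots> = ennreal (c powr q) * (\<integral>\<^sup>+h. f h * radial_weight q h * indicator S h \<partial>lborel)"
    using \<open>c > 0\<close>
    by (subst nn_integral_lborel_affine[of "\<lambda>h. f h * radial_weight q h * indicator S h" c])
       simp_all
  finally show ?thesis .
qed

lemma nn_integral_powr_Icc:
  fixes x y e :: real
  assumes "0 < x" "x \<le> y" "e \<noteq> 0"
  shows "(\<integral>\<^sup>+t. ennreal (t powr (e - 1)) * indicator {x..y} t \<partial>lborel) = ennreal ((y powr e - x powr e) / e)"
proof (rule nn_integral_has_integral_lebesgue')
  have "((\<lambda>t. t powr (e - 1)) has_integral (y powr e / e - x powr e / e)) {x..y}"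
    using assms
    by (intro fundamental_theorem_of_calculus)
       (auto intro!: derivative_eq_intros simp flip: has_real_derivative_iff_has_vector_derivative)
  then show "((\<lambda>t. t powr (e - 1)) has_integral (y powr e - x powr e) / e) {x..y}"
    by (simp add: diff_divide_distrib)
qed simp

lemma nn_integral_powr_Icc0:
  fixes c a :: real
  assumes "a > 0" "c \<ge> 0"
  shows "(\<integral>\<^sup>+t. ennreal (t powr (a - 1)) * indicator {0..c} t \<partial>lborel) = ennreal (c powr a / a)"
  using has_integral_powr_from_0[of "a - 1" c] assms
  by (intro nn_integral_has_integral_lebesgue') auto

lemma nn_integral_powr_atLeast:
  fixes c a :: real
  assumes "a > 0" "c > 0"
  shows "(\<integral>\<^sup>+t. ennreal (t powr (- a - 1)) * indicator {c..} t \<partial>lborel) = ennreal (c powr (- a) / a)"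
  using has_integral_powr_to_inf[of "- a - 1" c] assms
  by (intro nn_integral_has_integral_lebesgue') auto

text \<open>Writes a negative power as a superposition of indicators of \<open>x \<le> r\<close>.
  After Fubini a weighted integral over a ball becomes an integral of unweighted ones over smaller
  balls.\<close>

lemma powr_layer_cake:
  fixes x R \<delta> :: real
  assumes "0 < \<delta>" "0 < x" "x \<le> R"
  shows "ennreal (x powr (- \<delta>)) = ennreal (R powr (- \<delta>)) +
    (\<integral>\<^sup>+r. ennreal (\<delta> * r powr (- \<delta> - 1)) * indicator {x..R} r \<partial>lborel)"
proof -
  have "(\<integral>\<^sup>+r. ennreal (\<delta> * r powr (- \<delta> - 1)) * indicator {x..R} r \<partial>lborel)
    = ennreal \<delta> * ennreal ((R powr (- \<delta>) - x powr (- \<delta>)) / (- \<delta>))"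
    using assms by (simp add: ennreal_mult mult.assoc nn_integral_cmult nn_integral_powr_Icc)
  also have "\<dots> = ennreal (\<delta> * ((R powr (- \<delta>) - x powr (- \<delta>)) / (- \<delta>)))"
    using assms by (simp only: ennreal_mult' less_imp_le)
  also have "\<delta> * ((R powr (- \<delta>) - x powr (- \<delta>)) / (- \<delta>)) = x powr (- \<delta>) - R powr (- \<delta>)"
    using assms by simp
  finally show ?thesis
    using assms by (simp add: powr_mono2' flip: ennreal_plus)
qed

text \<open>After expansion the claim is \<delta>(1 - 2^(-b)) \<le> (2^\<delta> - 1) b, and \<delta>
  b ln 2 lies between the two sides. It is what reduces the constant for small increments to
  (2R)^\<delta>.\<close>

lemma powr_2_difference_bound:
  fixes b \<delta> :: real
  assumes "0 < b" "0 < \<delta>"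
  shows "b + \<delta> \<le> 2 powr \<delta> * (b + \<delta> * 2 powr (- (b + \<delta>)))"
proof -
  have "1 - 2 powr (- b) \<le> b * ln 2"
    using exp_ge_add_one_self[of "- b * ln 2"] by (simp add: powr_def)
  then have "\<delta> * (1 - 2 powr (- b)) \<le> \<delta> * ln 2 * b"
    using \<open>0 < \<delta>\<close> by (simp add: ac_simps)
  also have "\<delta> * ln 2 \<le> 2 powr \<delta> - 1"
    using exp_ge_add_one_self[of "\<delta> * ln 2"] by (simp add: powr_def del: exp_ge_add_one_self)
  then have "\<delta> * ln 2 * b \<le> (2 powr \<delta> - 1) * b"
    using \<open>0 < b\<close> by (intro mult_right_mono) auto
  finally have "\<delta> * (1 - 2 powr (- b)) \<le> (2 powr \<delta> - 1) * b" .
  moreover have "2 powr \<delta> * (\<delta> * 2 powr (- (b + \<delta>))) = \<delta> * 2 powr (- b)"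
    by (simp add: mult.left_commute[of _ \<delta>] flip: powr_add)
  ultimately show ?thesis
    unfolding distrib_left by (simp only: left_diff_distrib right_diff_distrib)
qed

text \<open>Halving the radius repeatedly turns the doubling condition into a power law between
  arbitrary radii.\<close>

lemma doubling_ball_growth:
  fixes \<Phi> :: "real \<Rightarrow> ennreal"
  assumes mono: "\<And>r r'. r \<le> r' \<Longrightarrow> \<Phi> r \<le> \<Phi> r'"
    and half: "\<And>r. 0 < r \<Longrightarrow> \<Phi> r \<le> ennreal (2 powr a) * \<Phi> (r / 2)"
    and "0 < a" "0 < r" "r \<le> R"
  shows "ennreal ((r / (2 * R)) powr a) * \<Phi> R \<le> \<Phi> r"
proof -
  have iter: "\<Phi> R \<le> ennreal (2 powr (a * real k)) * \<Phi> (R / 2 ^ k)" for k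
  proof (induction k)
    case (Suc k)
    have "\<Phi> (R / 2 ^ k) \<le> ennreal (2 powr a) * \<Phi> (R / 2 ^ k / 2)"
      using assms by (intro half) auto
    then have "\<Phi> R \<le> ennreal (2 powr (a * real k)) * (ennreal (2 powr a) * \<Phi> (R / 2 ^ k / 2))"
      using Suc by (meson mult_left_mono order_trans zero_le)
    then show ?case
      by (simp add: powr_add distrib_left ennreal_mult ac_simps divide_divide_eq_left)
  qed simp
  define x where "x = log 2 (R / r)"
  have "x \<ge> 0" using assms by (simp add: x_def)
  \<comment> \<open>Rounding up guarantees R / 2^k \<le> r but only 2^k \<le> 2R/r; hence the 2 in
    \<open>r / (2 * R)\<close>.\<close>
  define k where "k = nat \<lceil>x\<rceil>"
  have k: "x \<le> real k" "real k \<le> x + 1"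
    using \<open>x \<ge> 0\<close> unfolding k_def by linarith+
  have Rr: "2 powr x = R / r" using assms by (simp add: x_def)
  have "R / r \<le> 2 ^ k"
    using k(1) by (simp flip: Rr powr_realpow)
  then have "R / 2 ^ k \<le> r"
    using assms by (simp add: field_simps)
  then have "\<Phi> R \<le> ennreal (2 powr (a * real k)) * \<Phi> r"
    using iter[of k] mono by (meson mult_left_mono order_trans zero_le)
  also have "2 powr (a * real k) \<le> (2 powr (x + 1)) powr a"
    using k \<open>0 < a\<close> by (simp add: powr_powr mult.commute)
  then have "ennreal (2 powr (a * real k)) * \<Phi> r \<le> ennreal ((2 * R / r) powr a) * \<Phi> r"
    by (intro mult_right_mono ennreal_leI) (simp_all add: powr_add Rr mult.commute)
  finally have *: "\<Phi> R \<le> ennreal ((2 * R / r) powr a) * \<Phi> r" .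
  have "ennreal ((r / (2 * R)) powr a) * \<Phi> R
      \<le> ennreal ((r / (2 * R)) powr a) * (ennreal ((2 * R / r) powr a) * \<Phi> r)"
    using * by (rule mult_left_mono) simp
  also have "\<dots> = \<Phi> r"
    using assms by (simp flip: mult.assoc ennreal_mult powr_mult)
  finally show ?thesis .
qed

text \<open>The weighted mass \<Phi> of V on balls inherits a doubling property with exponent a, so
  it cannot concentrate near the sphere of radius R. Layering the extra factor |h|^(-\<delta>),
  \<delta> = a - b, over balls therefore bounds the right integral below by a multiple of \<Phi>(R).
  In the application a = q(1-\<eta>) and b = q(1-s).\<close>

lemma small_increments_bound:
  fixes V :: "'a::euclidean_space \<Rightarrow> ennreal"
  assumes [measurable]: "V \<in> borel_measurable borel"
    and dbl: "\<And>h. V (2 *\<^sub>R h) \<le> ennreal (2 powr p) * V h"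
    and "0 < b" "b < a" "0 < R"
  shows "ennreal a * (\<integral>\<^sup>+h. V h * radial_weight (p - a) h * indicator {h. norm h \<le> R} h \<partial>lborel)
    \<le> ennreal ((2 * R) powr (a - b) * b) * (\<integral>\<^sup>+h. V h * radial_weight (p - b) h \<partial>lborel)"
proof -
  let ?w = "\<lambda>h::'a. V h * radial_weight (p - a) h"
  define \<Phi> where "\<Phi> r = (\<integral>\<^sup>+h. ?w h * indicator {h. norm h \<le> r} h \<partial>lborel)" for r
  define \<delta> where "\<delta> = a - b"
  let ?F = "\<lambda>h r. ?w h * indicator {h. norm h \<le> R} h * (ennreal (\<delta> * r powr (- \<delta> - 1)) * indicator {norm h..R} r)"
  have "\<delta> > 0" "a > 0" using assms by (auto simp: \<delta>_def)
  have mono: "\<Phi> r \<le> \<Phi> r'" if "r \<le> r'" for r r'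
    unfolding \<Phi>_def using that by (intro nn_integral_mono) (auto split: split_indicator)
  \<comment> \<open>Dilation by 2 carries the ball of radius r/2 onto that of radius r. The weight
    contributes 2^(p-a) and the hypothesis on V contributes 2^p, leaving 2^a.\<close>
  have half: "\<Phi> r \<le> ennreal (2 powr a) * \<Phi> (r / 2)" if "r > 0" for r
  proof -
    have "ennreal (2 powr (p - a)) * \<Phi> r
       = (\<integral>\<^sup>+h. V (2 *\<^sub>R h) * radial_weight (p - a) h * indicator {h. norm h \<le> r} (2 *\<^sub>R h) \<partial>lborel)"
      unfolding \<Phi>_def by (subst nn_integral_lborel_dilate_weight) auto
    also have "\<dots> \<le> (\<integral>\<^sup>+h. ennreal (2 powr p) * (?w h * indicator {h. norm h \<le> r / 2} h) \<partial>lborel)"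
    proof (intro nn_integral_mono)
      fix h :: 'a
      show "V (2 *\<^sub>R h) * radial_weight (p - a) h * indicator {h. norm h \<le> r} (2 *\<^sub>R h)
         \<le> ennreal (2 powr p) * (?w h * indicator {h. norm h \<le> r / 2} h)"
        using mult_right_mono[OF dbl[of h], of "radial_weight (p - a) h"]
        by (auto split: split_indicator simp: mult.assoc)
    qed
    also have "\<dots> = ennreal (2 powr p) * \<Phi> (r / 2)"
      unfolding \<Phi>_def by (subst nn_integral_cmult) auto
    finally have "ennreal (2 powr (a - p)) * (ennreal (2 powr (p - a)) * \<Phi> r)
       \<le> ennreal (2 powr (a - p)) * (ennreal (2 powr p) * \<Phi> (r / 2))"
      by (rule mult_left_mono) simp
    then show ?thesis
      by (simp flip: mult.assoc ennreal_mult powr_add)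
  qed
  have growth: "ennreal ((r / (2 * R)) powr a) * \<Phi> R \<le> \<Phi> r" if "0 < r" "r \<le> R" for r
    by (rule doubling_ball_growth[where \<Phi> = \<Phi>, OF mono half \<open>a > 0\<close> that])
  have layer: "ennreal (norm h powr (- \<delta>)) = ennreal (R powr (- \<delta>)) +
      (\<integral>\<^sup>+r. ennreal (\<delta> * r powr (- \<delta> - 1)) * indicator {norm h..R} r \<partial>lborel)"
    if "h \<noteq> 0" "norm h \<le> R" for h :: 'a
    using that by (intro powr_layer_cake \<open>\<delta> > 0\<close>) auto
  \<comment> \<open>Growth of order r^a against r^(-\<delta>-1) leaves r^(b-1), whose integral up to
    R is R^b / b.\<close>
  have "ennreal (\<delta> * (2 * R) powr (- a)) * ennreal (R powr b / b) * \<Phi> R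
    = (\<integral>\<^sup>+r. ennreal (\<delta> * r powr (- \<delta> - 1)) * (ennreal ((r / (2 * R)) powr a) * \<Phi> R) * indicator {0..R} r \<partial>lborel)"
  proof -
    have "ennreal (\<delta> * r powr (- \<delta> - 1)) * (ennreal ((r / (2 * R)) powr a) * \<Phi> R) * indicator {0..R} r
       = ennreal (\<delta> * (2 * R) powr (- a)) * (ennreal (r powr (b - 1)) * indicator {0..R} r) * \<Phi> R" for r
    proof (cases "0 < r \<and> r \<le> R")
      case True
      have "r powr (b - 1) = r powr a * r powr (- \<delta> - 1)"
        by (simp add: \<delta>_def flip: powr_add)
      then have "\<delta> * r powr (- \<delta> - 1) * (r / (2 * R)) powr a = \<delta> * (2 * R) powr (- a) * r powr (b - 1)"
        using True \<open>0 < R\<close> by (simp add: powr_divide powr_minus field_simps)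
      then have "ennreal (\<delta> * r powr (- \<delta> - 1)) * ennreal ((r / (2 * R)) powr a)
          = ennreal (\<delta> * (2 * R) powr (- a)) * ennreal (r powr (b - 1))"
        using \<open>\<delta> > 0\<close> by (simp only: ennreal_mult[symmetric] mult_nonneg_nonneg powr_ge_zero less_imp_le)
      then show ?thesis
        using True by (simp add: mult.assoc[symmetric])
    next
      case False
      then show ?thesis by (cases "r = 0") (auto split: split_indicator)
    qed
    then show ?thesis
      using \<open>b > 0\<close> \<open>R > 0\<close>
      by (simp add: nn_integral_cmult nn_integral_multc nn_integral_powr_Icc0)
  qed
  also have "\<dots> \<le> (\<integral>\<^sup>+r. ennreal (\<delta> * r powr (- \<delta> - 1)) * \<Phi> r * indicator {0..R} r \<partial>lborel)"
  proof (intro nn_integral_mono)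
    fix r show "ennreal (\<delta> * r powr (- \<delta> - 1)) * (ennreal ((r / (2 * R)) powr a) * \<Phi> R) * indicator {0..R} r
       \<le> ennreal (\<delta> * r powr (- \<delta> - 1)) * \<Phi> r * indicator {0..R} r"
      using mult_left_mono[OF growth[of r], of "ennreal (\<delta> * r powr (- \<delta> - 1))"]
      by (cases "r = 0") (simp_all split: split_indicator)
  qed
  also have "\<dots> = (\<integral>\<^sup>+r. (\<integral>\<^sup>+h. ?F h r \<partial>lborel) \<partial>lborel)"
  proof (intro nn_integral_cong)
    fix r :: real
    have "?F h r
        = ennreal (\<delta> * r powr (- \<delta> - 1)) * indicator {0..R} r * (?w h * indicator {h. norm h \<le> r} h)" for h
    proof (cases "norm h \<le> r \<and> r \<le> R")
      case True
      then have "0 \<le> r" "norm h \<le> R"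
        using norm_ge_zero[of h] by linarith+
      with True show ?thesis
        by (simp add: mult.commute)
    next
      case False
      then show ?thesis
        by (auto simp: indicator_def)
    qed
    then show "ennreal (\<delta> * r powr (- \<delta> - 1)) * \<Phi> r * indicator {0..R} r =
        (\<integral>\<^sup>+h. ?F h r \<partial>lborel)"
      by (simp add: nn_integral_cmult \<Phi>_def mult.assoc mult.left_commute[of _ "indicator {0..R} r"] mult.commute[of _ "indicator {0..R} r"])
  qed
  also have "\<dots> = (\<integral>\<^sup>+h. (\<integral>\<^sup>+r. ?F h r \<partial>lborel) \<partial>lborel)"
    by (rule lborel_pair.Fubini') (simp add: split_beta' indicator_def)
  finally have tail: "ennreal (\<delta> * (2 * R) powr (- a)) * ennreal (R powr b / b) * \<Phi> R
    \<le> (\<integral>\<^sup>+h. (\<integral>\<^sup>+r. ?F h r \<partial>lborel) \<partial>lborel)" .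
  have "ennreal (R powr (- \<delta>) + \<delta> * (2 * R) powr (- a) * (R powr b / b)) * \<Phi> R
    = ennreal (R powr (- \<delta>)) * \<Phi> R + ennreal (\<delta> * (2 * R) powr (- a)) * ennreal (R powr b / b) * \<Phi> R"
    using \<open>\<delta> > 0\<close> \<open>b > 0\<close>
    by (subst ennreal_mult[symmetric]) (auto simp: distrib_right)
  also have "\<dots> \<le> ennreal (R powr (- \<delta>)) * \<Phi> R + (\<integral>\<^sup>+h. (\<integral>\<^sup>+r. ?F h r \<partial>lborel) \<partial>lborel)"
    by (intro add_left_mono tail)
  also have "ennreal (R powr (- \<delta>)) * \<Phi> R = (\<integral>\<^sup>+h. ?w h * indicator {h. norm h \<le> R} h * ennreal (R powr (- \<delta>)) \<partial>lborel)"
    unfolding \<Phi>_def by (subst nn_integral_multc) (auto simp: ac_simps)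
  also have "(\<integral>\<^sup>+h. ?w h * indicator {h. norm h \<le> R} h * ennreal (R powr (- \<delta>)) \<partial>lborel) +
      (\<integral>\<^sup>+h. (\<integral>\<^sup>+r. ?F h r \<partial>lborel) \<partial>lborel)
    = (\<integral>\<^sup>+h. ?w h * indicator {h. norm h \<le> R} h * (ennreal (R powr (- \<delta>)) +
      (\<integral>\<^sup>+r. ennreal (\<delta> * r powr (- \<delta> - 1)) * indicator {norm h..R} r \<partial>lborel)) \<partial>lborel)"
    by (subst nn_integral_add[symmetric])
       (auto simp: nn_integral_cmult distrib_left indicator_def[of "{norm _.._}"] intro!: nn_integral_cong)
  also have "\<dots> \<le> (\<integral>\<^sup>+h. V h * radial_weight (p - b) h \<partial>lborel)"
  proof (intro nn_integral_mono)
    fix h :: 'a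
    have "norm h powr (- real DIM('a) - (p - a)) * norm h powr (- \<delta>) = norm h powr (- real DIM('a) - (p - b))"
      by (simp add: \<delta>_def algebra_simps flip: powr_add)
    then have "radial_weight (p - a) h * ennreal (norm h powr (- \<delta>))
        = radial_weight (p - b) h"
      by (simp flip: ennreal_mult)
    then show "?w h * indicator {h. norm h \<le> R} h * (ennreal (R powr (- \<delta>)) +
      (\<integral>\<^sup>+r. ennreal (\<delta> * r powr (- \<delta> - 1)) * indicator {norm h..R} r \<partial>lborel)) \<le> V h * radial_weight (p - b) h"
      by (cases "h = 0"; cases "norm h \<le> R") (simp_all add: mult.assoc flip: layer)
  qed
  finally have main: "ennreal (R powr (- \<delta>) + \<delta> * (2 * R) powr (- a) * (R powr b / b)) * \<Phi> R
     \<le> (\<integral>\<^sup>+h. V h * radial_weight (p - b) h \<partial>lborel)" .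
  \<comment> \<open>The coefficient of \<Phi>(R) just obtained is at least a / ((2R)^\<delta>
    b).\<close>
  have "a \<le> 2 powr \<delta> * (b + \<delta> * 2 powr (- a))"
    using powr_2_difference_bound[OF \<open>0 < b\<close> \<open>\<delta> > 0\<close>] by (simp add: \<delta>_def)
  also have "\<dots> = (2 * R) powr \<delta> * b * (R powr (- \<delta>) + \<delta> * (2 * R) powr (- a) * (R powr b / b))"
    using \<open>0 < R\<close> \<open>0 < b\<close> by (simp add: powr_mult powr_minus \<delta>_def powr_diff field_simps)
  finally have "ennreal a * \<Phi> R \<le> ennreal ((2 * R) powr \<delta> * b) *
      (ennreal (R powr (- \<delta>) + \<delta> * (2 * R) powr (- a) * (R powr b / b)) * \<Phi> R)"
    using \<open>0 < b\<close> \<open>\<delta> > 0\<close>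
    by (subst mult.assoc[symmetric], subst ennreal_mult[symmetric]) (auto intro!: mult_right_mono ennreal_leI)
  also have "\<dots> \<le> ennreal ((2 * R) powr \<delta> * b) *
      (\<integral>\<^sup>+h. V h * radial_weight (p - b) h \<partial>lborel)"
    by (intro mult_left_mono main) simp
  finally show ?thesis
    by (simp add: \<Phi>_def \<delta>_def)
qed

lemma nn_integral_shifted_powr:
  fixes \<beta> :: real
  assumes "\<beta> > 0"
  shows "(\<integral>\<^sup>+t. ennreal (\<beta> * (1 + t) powr (- \<beta> - 1)) * indicator {0..} t \<partial>lborel) = 1"
proof -
  have "(\<integral>\<^sup>+t. ennreal (\<beta> * (1 + t) powr (- \<beta> - 1)) * indicator {0..} t \<partial>lborel)
    = (\<integral>\<^sup>+t. ennreal (\<beta> * t powr (- \<beta> - 1)) * indicator {1..} t \<partial>lborel)"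
    by (subst (2) nn_integral_lborel_shift[symmetric, of _ 1])
       (auto simp: add.commute indicator_def intro!: nn_integral_cong)
  also have "\<dots> = ennreal \<beta> * ennreal (1 powr (- \<beta>) / \<beta>)"
    using assms by (simp add: ennreal_mult mult.assoc nn_integral_cmult nn_integral_powr_atLeast)
  also have "\<dots> = 1"
    using assms by (simp flip: ennreal_mult)
  finally show ?thesis .
qed

text \<open>
  The density \<open>k\<close> below comes from writing an exponential variable of rate \<open>\<beta>\<close> as the sum of one
  of rate \<open>\<alpha>\<close> and an independent variable that vanishes with probability \<open>\<beta> / \<alpha>\<close> and is otherwise
  exponential of rate \<open>\<beta>\<close>. With \<open>log \<bar>h\<bar>\<close> in the role of the variable of rate \<open>\<alpha>\<close>, the average of
  \<open>V ((1+t)h)\<close> then has exactly the weight of order \<open>\<beta>\<close>, and that of \<open>V (th)\<close> at most this weight.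
\<close>

lemma large_increments_bound:
  fixes V :: "'a::euclidean_space \<Rightarrow> ennreal"
  assumes [measurable]: "V \<in> borel_measurable borel"
    and tri: "\<And>h t. t > 0 \<Longrightarrow> V h \<le> ennreal (2 powr (p - 1)) * (V ((1 + t) *\<^sub>R h) + V (t *\<^sub>R h))"
    and "1 \<le> p" "0 < \<beta>" "\<beta> < \<alpha>" "0 < R"
  shows "ennreal \<alpha> * (\<integral>\<^sup>+h. V h * radial_weight \<alpha> h * indicator {h. R < norm h} h \<partial>lborel)
    \<le> ennreal (2 powr p * R powr (\<beta> - \<alpha>) * \<beta>) * (\<integral>\<^sup>+h. V h * radial_weight \<beta> h \<partial>lborel)"
proof -
  let ?X1 = "\<lambda>t. (\<integral>\<^sup>+h. V ((1 + t) *\<^sub>R h) * radial_weight \<alpha> h * indicator {h. R < norm h} h \<partial>lborel)"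
  let ?X2 = "\<lambda>t. (\<integral>\<^sup>+h. V (t *\<^sub>R h) * radial_weight \<alpha> h * indicator {h. R < norm h} h \<partial>lborel)"
  define w where "w h = V h * radial_weight \<alpha> h" for h
  have w_meas [measurable]: "w \<in> borel_measurable borel" unfolding w_def by measurable
  define X where "X = (\<integral>\<^sup>+h. w h * indicator {h. R < norm h} h \<partial>lborel)"
  define J where "J = (\<integral>\<^sup>+h. V h * radial_weight \<beta> h \<partial>lborel)"
  define J' where "J' = (\<integral>\<^sup>+h. V h * radial_weight \<beta> h * indicator {h. R < norm h} h \<partial>lborel)"
  define k where "k t = ennreal (\<beta> * (1 + t) powr (- \<beta> - 1)) * indicator {0..} t" for t :: real
  have k_meas [measurable]: "k \<in> borel_measurable borel" unfolding k_def by measurable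
  define Y1 where "Y1 = (\<integral>\<^sup>+t. k t * ?X1 t \<partial>lborel)"
  define Y2 where "Y2 = (\<integral>\<^sup>+t. k t * ?X2 t \<partial>lborel)"
  have "X = (\<integral>\<^sup>+t. k t \<partial>lborel) * X"
    using nn_integral_shifted_powr[OF \<open>0 < \<beta>\<close>] by (simp add: k_def)
  also have "\<dots> = (\<integral>\<^sup>+t. k t * X \<partial>lborel)"
    by (simp add: nn_integral_multc)
  also have "\<dots> \<le> (\<integral>\<^sup>+t. ennreal (2 powr (p - 1)) *
       (k t * ?X1 t
      + k t * ?X2 t) \<partial>lborel)"
  proof (rule nn_integral_mono_AE)
    have "X \<le> ennreal (2 powr (p - 1)) *
       (?X1 t
      + ?X2 t)"
      if "t > 0" for t
    proof -
      have "X \<le> (\<integral>\<^sup>+h. ennreal (2 powr (p - 1)) *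
          (V ((1 + t) *\<^sub>R h) * radial_weight \<alpha> h * indicator {h. R < norm h} h
          + V (t *\<^sub>R h) * radial_weight \<alpha> h * indicator {h. R < norm h} h) \<partial>lborel)"
        unfolding X_def w_def
        using mult_right_mono[OF tri[OF that]]
        by (intro nn_integral_mono) (auto split: split_indicator simp: mult.assoc distrib_right)
      then show ?thesis
        by (simp add: nn_integral_cmult nn_integral_add)
    qed
    note * = mult_left_mono[OF this, of _ "k _"]
    \<comment> \<open>At t = 0 the density k equals \<beta>, while the triangle hypothesis covers
      only t > 0; one point is negligible.\<close>
    have "AE t in lborel. t \<noteq> (0::real)"
      by (rule AE_lborel_singleton)
    then show "AE t in lborel. k t * X \<le> ennreal (2 powr (p - 1)) *
       (k t * ?X1 t
      + k t * ?X2 t)"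
    proof eventually_elim
      case (elim t)
      show ?case
      proof (cases "t > 0")
        case True
        then show ?thesis using *[of t t] by (simp add: distrib_left ac_simps)
      next
        case False
        with elim show ?thesis by (simp add: k_def)
      qed
    qed
  qed
  also have "\<dots> = ennreal (2 powr (p - 1)) * (Y1 + Y2)"
    unfolding Y1_def Y2_def by (subst nn_integral_cmult; (subst nn_integral_add)?) measurable
  finally have X: "X \<le> ennreal (2 powr (p - 1)) * (Y1 + Y2)" .

  \<comment> \<open>The integral over 1 + t runs from 1 to |h|/R and gives L - 1 with L =
    (|h|/R)^(\<alpha>-\<beta>). Keeping the summand \<beta> X on the left restores the missing 1, so
    nothing is lost in this half.\<close>
  have Y1: "ennreal (\<alpha> - \<beta>) * Y1 + ennreal \<beta> * X \<le> ennreal (R powr (\<beta> - \<alpha>) * \<beta>) * J'"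
  proof -
    have "Y1 = (\<integral>\<^sup>+t. k t * (ennreal ((1 + t) powr \<alpha>) * (\<integral>\<^sup>+h. w h * indicator {h. R * (1 + t) < norm h} h \<partial>lborel)) \<partial>lborel)"
      unfolding Y1_def
    proof (intro nn_integral_cong)
      fix t :: real
      show "k t * ?X1 t
        = k t * (ennreal ((1 + t) powr \<alpha>) * (\<integral>\<^sup>+h. w h * indicator {h. R * (1 + t) < norm h} h \<partial>lborel))"
      proof (cases "t \<ge> 0")
        case True
        have "indicator {h. R * (1 + t) < norm h} ((1 + t) *\<^sub>R h) = (indicator {h. R < norm h} h :: ennreal)" for h :: 'a
          using True by (auto simp: indicator_def mult.commute)
        then show ?thesis
          using True nn_integral_lborel_dilate_weight[of V "{h. R * (1 + t) < norm h}" "1 + t" \<alpha>]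
          by (simp add: w_def)
      qed (simp add: k_def)
    qed
    also have "\<dots> = (\<integral>\<^sup>+t. (\<integral>\<^sup>+h. w h * (k t * ennreal ((1 + t) powr \<alpha>) * indicator {h. R * (1 + t) < norm h} h) \<partial>lborel) \<partial>lborel)"
      by (intro nn_integral_cong) (simp add: nn_integral_cmult[symmetric] ac_simps)
    also have "\<dots> = (\<integral>\<^sup>+h. (\<integral>\<^sup>+t. w h * (k t * ennreal ((1 + t) powr \<alpha>) * indicator {h. R * (1 + t) < norm h} h) \<partial>lborel) \<partial>lborel)"
      by (rule lborel_pair.Fubini') (simp add: split_beta' indicator_def)
    also have "\<dots> \<le> (\<integral>\<^sup>+h. w h * indicator {h. R < norm h} h * ennreal (\<beta> * (((norm h / R) powr (\<alpha> - \<beta>) - 1) / (\<alpha> - \<beta>))) \<partial>lborel)"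
    proof (intro nn_integral_mono)
      fix h :: 'a
      show "(\<integral>\<^sup>+t. w h * (k t * ennreal ((1 + t) powr \<alpha>) * indicator {h. R * (1 + t) < norm h} h) \<partial>lborel)
        \<le> w h * indicator {h. R < norm h} h * ennreal (\<beta> * (((norm h / R) powr (\<alpha> - \<beta>) - 1) / (\<alpha> - \<beta>)))"
      proof (cases "R < norm h")
        case True
        have "(\<integral>\<^sup>+t. k t * ennreal ((1 + t) powr \<alpha>) * indicator {h. R * (1 + t) < norm h} h \<partial>lborel)
          \<le> (\<integral>\<^sup>+t. ennreal \<beta> * (ennreal ((t + 1) powr (\<alpha> - \<beta> - 1)) * indicator {1..norm h / R} (t + 1)) \<partial>lborel)"
        proof (intro nn_integral_mono)
          fix t :: real
          have "\<beta> * (1 + t) powr (- \<beta> - 1) * (1 + t) powr \<alpha> = \<beta> * (t + 1) powr (\<alpha> - \<beta> - 1)"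
            by (simp add: algebra_simps flip: powr_add)
          then have "ennreal (\<beta> * (1 + t) powr (- \<beta> - 1)) * ennreal ((1 + t) powr \<alpha>) = ennreal \<beta> * ennreal ((t + 1) powr (\<alpha> - \<beta> - 1))"
            using \<open>\<beta> > 0\<close> by (simp flip: ennreal_mult)
          moreover have "1 + t \<le> norm h / R" if "R * (1 + t) < norm h"
            using that \<open>0 < R\<close> by (simp add: field_simps)
          ultimately show "k t * ennreal ((1 + t) powr \<alpha>) * indicator {h. R * (1 + t) < norm h} h
             \<le> ennreal \<beta> * (ennreal ((t + 1) powr (\<alpha> - \<beta> - 1)) * indicator {1..norm h / R} (t + 1))"
            by (auto simp: k_def indicator_def add.commute)
        qed
        also have "\<dots> = ennreal \<beta> * ennreal (((norm h / R) powr (\<alpha> - \<beta>) - 1) / (\<alpha> - \<beta>))"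
          using True assms
            nn_integral_lborel_shift[of "\<lambda>t. ennreal (t powr (\<alpha> - \<beta> - 1)) * indicator {1..norm h / R} t" 1]
          by (simp add: nn_integral_cmult nn_integral_powr_Icc)
        finally show ?thesis
          using True \<open>\<beta> > 0\<close> by (simp add: nn_integral_cmult ennreal_mult'[symmetric] mult_left_mono)
      next
        case False
        have zero: "w h * (k t * ennreal ((1 + t) powr \<alpha>) * indicator {h. R * (1 + t) < norm h} h) = 0" for t
        proof (cases "t \<ge> 0")
          case True
          then have "R \<le> R * (1 + t)" using \<open>R > 0\<close> by simp
          then show ?thesis using False by simp
        qed (simp add: k_def)
        show ?thesis unfolding zero by simp
      qed
    qed
    finally have "ennreal (\<alpha> - \<beta>) * Y1 \<le> ennreal (\<alpha> - \<beta>) * \<dots>"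
      by (rule mult_left_mono) simp
    then have "ennreal (\<alpha> - \<beta>) * Y1 + ennreal \<beta> * X \<le>
        (\<integral>\<^sup>+h. ennreal (\<alpha> - \<beta>) * (w h * indicator {h. R < norm h} h * ennreal (\<beta> * (((norm h / R) powr (\<alpha> - \<beta>) - 1) / (\<alpha> - \<beta>))))
           + ennreal \<beta> * (w h * indicator {h. R < norm h} h) \<partial>lborel)"
      unfolding X_def by (simp add: nn_integral_add nn_integral_cmult add_right_mono)
    also have "\<dots> = (\<integral>\<^sup>+h. ennreal (R powr (\<beta> - \<alpha>) * \<beta>) * (V h * radial_weight \<beta> h * indicator {h. R < norm h} h) \<partial>lborel)"
    proof (intro nn_integral_cong)
      fix h :: 'a
      let ?L = "(norm h / R) powr (\<alpha> - \<beta>)"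
      show "ennreal (\<alpha> - \<beta>) * (w h * indicator {h. R < norm h} h * ennreal (\<beta> * ((?L - 1) / (\<alpha> - \<beta>))))
           + ennreal \<beta> * (w h * indicator {h. R < norm h} h)
        = ennreal (R powr (\<beta> - \<alpha>) * \<beta>) * (V h * radial_weight \<beta> h * indicator {h. R < norm h} h)"
      proof (cases "R < norm h")
        case True
        then have "1 \<le> ?L" using assms by (intro ge_one_powr_ge_zero) auto
        then have "ennreal (\<alpha> - \<beta>) * ennreal (\<beta> * ((?L - 1) / (\<alpha> - \<beta>))) + ennreal \<beta> = ennreal (\<beta> * ?L)"
        proof -
          have "(\<alpha> - \<beta>) * (\<beta> * ((?L - 1) / (\<alpha> - \<beta>))) = \<beta> * (?L - 1)"
            using \<open>\<beta> < \<alpha>\<close> by simp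
          then have "ennreal (\<alpha> - \<beta>) * ennreal (\<beta> * ((?L - 1) / (\<alpha> - \<beta>))) + ennreal \<beta> = ennreal (\<beta> * (?L - 1)) + ennreal \<beta>"
            using \<open>\<beta> < \<alpha>\<close> by (metis diff_ge_0_iff_ge ennreal_mult' less_imp_le)
          also have "\<dots> = ennreal (\<beta> * ?L)"
            using \<open>1 \<le> ?L\<close> \<open>\<beta> > 0\<close> by (subst ennreal_plus[symmetric]) (auto simp: right_diff_distrib)
          finally show ?thesis .
        qed
        from arg_cong[OF this, of "\<lambda>c. c * w h"]
        have "ennreal (\<alpha> - \<beta>) * (w h * ennreal (\<beta> * ((?L - 1) / (\<alpha> - \<beta>)))) + ennreal \<beta> * w h
           = ennreal (\<beta> * ?L) * w h"
          by (simp only: distrib_right distrib_left ac_simps)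
        also have "\<dots> = V h * ennreal (\<beta> * ?L * norm h powr (- real DIM('a) - \<alpha>))"
          using \<open>\<beta> > 0\<close> by (simp add: w_def ennreal_mult ac_simps)
        also have "?L * norm h powr (- real DIM('a) - \<alpha>) = R powr (\<beta> - \<alpha>) * norm h powr (- real DIM('a) - \<beta>)"
          using \<open>0 < R\<close> by (simp add: powr_divide powr_diff powr_minus field_simps)
        then have "\<beta> * ?L * norm h powr (- real DIM('a) - \<alpha>) = R powr (\<beta> - \<alpha>) * \<beta> * norm h powr (- real DIM('a) - \<beta>)"
          by (simp add: ac_simps)
        finally show ?thesis
          using True \<open>\<beta> > 0\<close> by (simp add: ennreal_mult ac_simps)
      qed simp
    qed
    also have "\<dots> = ennreal (R powr (\<beta> - \<alpha>) * \<beta>) * J'"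
      unfolding J'_def by (simp add: nn_integral_cmult)
    finally show ?thesis .
  qed

  \<comment> \<open>Here (1+t)^(-\<beta>-1) is replaced by the larger t^(-\<beta>-1), so the
    t-integral starts at 0 and is exactly L/(\<alpha>-\<beta>). All h contribute, hence J in place
    of J'.\<close>
  have Y2: "ennreal (\<alpha> - \<beta>) * Y2 \<le> ennreal (R powr (\<beta> - \<alpha>) * \<beta>) * J"
  proof -
    have "Y2 = (\<integral>\<^sup>+t. k t * (ennreal (t powr \<alpha>) * (\<integral>\<^sup>+h. w h * indicator {h. R * t < norm h} h \<partial>lborel)) \<partial>lborel)"
      unfolding Y2_def
    proof (intro nn_integral_cong_AE)
      have "k t * ?X2 t
        = k t * (ennreal (t powr \<alpha>) * (\<integral>\<^sup>+h. w h * indicator {h. R * t < norm h} h \<partial>lborel))" if "t \<noteq> 0" for t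
      proof (cases "t > 0")
        case True
        have "indicator {h. R * t < norm h} (t *\<^sub>R h) = (indicator {h. R < norm h} h :: ennreal)" for h :: 'a
          using True by (auto simp: indicator_def mult.commute)
        then show ?thesis
          using True nn_integral_lborel_dilate_weight[of V "{h. R * t < norm h}" t \<alpha>]
          by (simp add: w_def)
      qed (use that in \<open>simp add: k_def\<close>)
      then show "AE t in lborel. k t * ?X2 t
        = k t * (ennreal (t powr \<alpha>) * (\<integral>\<^sup>+h. w h * indicator {h. R * t < norm h} h \<partial>lborel))"
        using AE_lborel_singleton[of 0] by (auto elim: eventually_mono)
    qed
    also have "\<dots> = (\<integral>\<^sup>+t. (\<integral>\<^sup>+h. w h * (k t * ennreal (t powr \<alpha>) * indicator {h. R * t < norm h} h) \<partial>lborel) \<partial>lborel)"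
      by (intro nn_integral_cong) (simp add: nn_integral_cmult[symmetric] ac_simps)
    also have "\<dots> = (\<integral>\<^sup>+h. (\<integral>\<^sup>+t. w h * (k t * ennreal (t powr \<alpha>) * indicator {h. R * t < norm h} h) \<partial>lborel) \<partial>lborel)"
      by (rule lborel_pair.Fubini') (simp add: split_beta' indicator_def)
    also have "\<dots> \<le> (\<integral>\<^sup>+h. w h * ennreal (\<beta> * ((norm h / R) powr (\<alpha> - \<beta>) / (\<alpha> - \<beta>))) \<partial>lborel)"
    proof (intro nn_integral_mono)
      fix h :: 'a
      have "(\<integral>\<^sup>+t. k t * ennreal (t powr \<alpha>) * indicator {h. R * t < norm h} h \<partial>lborel)
        \<le> (\<integral>\<^sup>+t. ennreal \<beta> * (ennreal (t powr (\<alpha> - \<beta> - 1)) * indicator {0..norm h / R} t) \<partial>lborel)"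
      proof (intro nn_integral_mono)
        fix t :: real
        show "k t * ennreal (t powr \<alpha>) * indicator {h. R * t < norm h} h
           \<le> ennreal \<beta> * (ennreal (t powr (\<alpha> - \<beta> - 1)) * indicator {0..norm h / R} t)"
        proof (cases "t > 0 \<and> R * t < norm h")
          case True
          then have "(1 + t) powr (- \<beta> - 1) * t powr \<alpha> \<le> t powr (- \<beta> - 1) * t powr \<alpha>"
            using \<open>\<beta> > 0\<close> by (intro mult_right_mono powr_mono2') auto
          also have "\<dots> = t powr (\<alpha> - \<beta> - 1)"
            by (simp add: algebra_simps flip: powr_add)
          finally have "ennreal (\<beta> * (1 + t) powr (- \<beta> - 1)) * ennreal (t powr \<alpha>) \<le> ennreal \<beta> * ennreal (t powr (\<alpha> - \<beta> - 1))"
            using \<open>\<beta> > 0\<close> by (simp add: mult.assoc flip: ennreal_mult)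
          moreover have "t \<le> norm h / R"
            using True \<open>0 < R\<close> by (simp add: field_simps)
          ultimately show ?thesis
            using True by (simp add: k_def)
        next
          case False
          then show ?thesis by (cases "t = 0") (auto simp: k_def indicator_def)
        qed
      qed
      also have "\<dots> = ennreal \<beta> * ennreal ((norm h / R) powr (\<alpha> - \<beta>) / (\<alpha> - \<beta>))"
        using assms by (simp add: nn_integral_cmult nn_integral_powr_Icc0)
      finally show "(\<integral>\<^sup>+t. w h * (k t * ennreal (t powr \<alpha>) * indicator {h. R * t < norm h} h) \<partial>lborel)
        \<le> w h * ennreal (\<beta> * ((norm h / R) powr (\<alpha> - \<beta>) / (\<alpha> - \<beta>)))"
        using \<open>\<beta> > 0\<close> by (simp add: nn_integral_cmult ennreal_mult'[symmetric] mult_left_mono)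
    qed
    finally have "ennreal (\<alpha> - \<beta>) * Y2 \<le> ennreal (\<alpha> - \<beta>) * \<dots>"
      by (rule mult_left_mono) simp
    also have "\<dots> = (\<integral>\<^sup>+h. ennreal (\<alpha> - \<beta>) * (w h * ennreal (\<beta> * ((norm h / R) powr (\<alpha> - \<beta>) / (\<alpha> - \<beta>)))) \<partial>lborel)"
      by (simp add: nn_integral_cmult)
    also have "\<dots> = (\<integral>\<^sup>+h. ennreal (R powr (\<beta> - \<alpha>) * \<beta>) * (V h * radial_weight \<beta> h) \<partial>lborel)"
    proof (intro nn_integral_cong)
      fix h :: 'a
      let ?L = "(norm h / R) powr (\<alpha> - \<beta>)"
      have "?L * norm h powr (- real DIM('a) - \<alpha>) = R powr (\<beta> - \<alpha>) * norm h powr (- real DIM('a) - \<beta>)"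
        using \<open>0 < R\<close> by (cases "h = 0") (simp_all add: powr_divide powr_diff powr_minus field_simps)
      then have "(\<alpha> - \<beta>) * (\<beta> * (?L / (\<alpha> - \<beta>))) * norm h powr (- real DIM('a) - \<alpha>) = R powr (\<beta> - \<alpha>) * \<beta> * norm h powr (- real DIM('a) - \<beta>)"
        using assms by (simp add: ac_simps)
      then have "ennreal (\<alpha> - \<beta>) * ennreal (\<beta> * (?L / (\<alpha> - \<beta>))) * radial_weight \<alpha> h = ennreal (R powr (\<beta> - \<alpha>) * \<beta>) * radial_weight \<beta> h"
        using assms by (simp flip: ennreal_mult)
      from arg_cong[OF this, of "\<lambda>c. V h * c"]
      show "ennreal (\<alpha> - \<beta>) * (w h * ennreal (\<beta> * (?L / (\<alpha> - \<beta>)))) = ennreal (R powr (\<beta> - \<alpha>) * \<beta>) * (V h * radial_weight \<beta> h)"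
        unfolding w_def by (simp only: ac_simps)
    qed
    also have "\<dots> = ennreal (R powr (\<beta> - \<alpha>) * \<beta>) * J"
      unfolding J_def by (simp add: nn_integral_cmult)
    finally show ?thesis .
  qed

  have "J' \<le> J"
    unfolding J_def J'_def by (intro nn_integral_mono) (auto split: split_indicator)
  have 1: "1 \<le> ennreal (2 powr (p - 1))"
    using \<open>1 \<le> p\<close> by (simp add: ge_one_powr_ge_zero)
  \<comment> \<open>The summand \<beta> X is enlarged by 2^(p-1) \<ge> 1 so that it can join the Y1
    term. The Y1 and Y2 parts then give equal bounds, which turns 2^(p-1) into 2^p.\<close>
  have "ennreal \<alpha> * X = ennreal (\<alpha> - \<beta>) * X + ennreal \<beta> * X"
    using assms by (simp flip: distrib_right ennreal_plus)
  also have "\<dots> \<le> ennreal (\<alpha> - \<beta>) * (ennreal (2 powr (p - 1)) * (Y1 + Y2)) + ennreal (2 powr (p - 1)) * (ennreal \<beta> * X)"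
    using X mult_right_mono[OF 1, of "ennreal \<beta> * X"] by (intro add_mono mult_left_mono) auto
  also have "\<dots> = ennreal (2 powr (p - 1)) * ((ennreal (\<alpha> - \<beta>) * Y1 + ennreal \<beta> * X) + ennreal (\<alpha> - \<beta>) * Y2)"
    by (simp only: distrib_left distrib_right ac_simps)
  also have "\<dots> \<le> ennreal (2 powr (p - 1)) * (ennreal (R powr (\<beta> - \<alpha>) * \<beta>) * J + ennreal (R powr (\<beta> - \<alpha>) * \<beta>) * J)"
    using order_trans[OF Y1 mult_left_mono[OF \<open>J' \<le> J\<close>]] Y2 by (intro mult_left_mono add_mono) auto
  also have "\<dots> = ennreal (2 powr (p - 1)) * (ennreal 2 * (ennreal (R powr (\<beta> - \<alpha>) * \<beta>) * J))"
    by (simp flip: mult_2)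
  also have "\<dots> = ennreal (2 powr p * R powr (\<beta> - \<alpha>) * \<beta>) * J"
  proof -
    have "2 powr (p - 1) * (2 * (R powr (\<beta> - \<alpha>) * \<beta>)) = 2 powr p * R powr (\<beta> - \<alpha>) * \<beta>"
      by (simp add: powr_diff)
    then have "ennreal (2 powr (p - 1)) * (ennreal 2 * ennreal (R powr (\<beta> - \<alpha>) * \<beta>)) = ennreal (2 powr p * R powr (\<beta> - \<alpha>) * \<beta>)"
      using \<open>\<beta> > 0\<close>
      by (metis ennreal_mult less_imp_le mult_nonneg_nonneg powr_ge_zero zero_le_numeral)
    then show ?thesis by (metis mult.assoc)
  qed
  finally show ?thesis
    by (simp add: X_def J_def w_def)
qed

section \<open>Increment integrals and the directions pointing into a set\<close>

lemma powr_add_le: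
  fixes x y p :: real
  assumes "p \<ge> 1" "x \<ge> 0" "y \<ge> 0"
  shows "(x + y) powr p \<le> 2 powr (p - 1) * (x powr p + y powr p)"
proof -
  have 1: "1 \<le> (2::real) powr (p - 1)"
    using assms by (simp add: ge_one_powr_ge_zero)
  consider "x = 0" | "y = 0" | "x > 0" "y > 0" using assms by force
  then show ?thesis
  proof cases
    case 3
    have "((1/2) *\<^sub>R x + (1/2) *\<^sub>R y) powr p \<le> (1/2) * x powr p + (1/2) * y powr p"
      using convex_onD[OF powr_convex[OF \<open>p \<ge> 1\<close>], of "1/2" x y] 3 by simp
    then have "((x + y) / 2) powr p \<le> (x powr p + y powr p) / 2"
      by (simp add: add_divide_distrib)
    then show ?thesis
      using 3 by (simp add: powr_divide powr_diff field_simps)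
  qed (use mult_right_mono[OF 1] in auto)
qed

lemma abs_triangle_powr:
  fixes a b p :: real
  assumes "p \<ge> 1"
  shows "ennreal (\<bar>a + b\<bar> powr p) \<le> ennreal (2 powr (p - 1)) * (ennreal (\<bar>a\<bar> powr p) + ennreal (\<bar>b\<bar> powr p))"
proof -
  have "\<bar>a + b\<bar> powr p \<le> (\<bar>a\<bar> + \<bar>b\<bar>) powr p"
    using assms by (intro powr_mono2) auto
  also have "\<dots> \<le> 2 powr (p - 1) * (\<bar>a\<bar> powr p + \<bar>b\<bar> powr p)"
    using assms by (intro powr_add_le) auto
  finally show ?thesis
    by (simp flip: ennreal_plus ennreal_mult)
qed

definition increment_pow :: "'a::euclidean_space set \<Rightarrow> real \<Rightarrow> ('a \<Rightarrow> real) \<Rightarrow> 'a \<Rightarrow> ennreal" where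
  "increment_pow \<Omega> p u h =
     (\<integral>\<^sup>+x. ennreal (\<bar>u (x + h) - u x\<bar> powr p) * indicator \<Omega> (x + h) * indicator \<Omega> x \<partial>lborel)"

text \<open>The recession cone of \<Omega>. It is everything for the whole space and contains all h
  with h.e \<ge> 0 for the half space, so one of h and -h always belongs to it. Whole rays are
  required because increments are dilated and gradients are integrated along segments.\<close>

definition translation_cone :: "'a::euclidean_space set \<Rightarrow> 'a set" where
  "translation_cone \<Omega> = {h. \<forall>t\<ge>0. \<forall>x\<in>\<Omega>. x + t *\<^sub>R h \<in> \<Omega>}"

lemma translation_coneD: "h \<in> translation_cone \<Omega> \<Longrightarrow> x \<in> \<Omega> \<Longrightarrow> x + h \<in> \<Omega>"
  unfolding translation_cone_def by (auto dest: spec[of _ 1])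

lemma translation_cone_scaleR: "h \<in> translation_cone \<Omega> \<Longrightarrow> t \<ge> 0 \<Longrightarrow> t *\<^sub>R h \<in> translation_cone \<Omega>"
  unfolding translation_cone_def by auto

context
  fixes \<Omega> :: "'a::euclidean_space set" and u :: "'a \<Rightarrow> real" and p :: real
  assumes \<Omega>_borel [measurable]: "\<Omega> \<in> sets borel"
    and u_borel [measurable]: "u \<in> borel_measurable borel"
begin

lemma increment_pow_measurable [measurable]: "increment_pow \<Omega> p u \<in> borel_measurable borel"
  unfolding increment_pow_def[abs_def] by measurable

text \<open>Substituting x + h for x exchanges the two points. This evenness is why only one of h
  and -h has to point into \<Omega>.\<close>

lemma increment_pow_uminus: "increment_pow \<Omega> p u (- h) = increment_pow \<Omega> p u h"
  unfolding increment_pow_def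
  by (subst nn_integral_lborel_shift[symmetric, of _ h])
     (auto intro!: nn_integral_cong simp: abs_minus_commute ac_simps)

lemma increment_pow_cone:
  assumes "h \<in> translation_cone \<Omega>"
  shows "increment_pow \<Omega> p u h = (\<integral>\<^sup>+x. ennreal (\<bar>u (x + h) - u x\<bar> powr p) * indicator \<Omega> x \<partial>lborel)"
  unfolding increment_pow_def using translation_coneD[OF assms]
  by (intro nn_integral_cong) (auto split: split_indicator)

text \<open>A translation by h maps \<Omega> into itself but not onto it, so translation invariance
  survives only as an inequality, in the direction needed.\<close>

lemma increment_pow_cone_shift:
  assumes "h \<in> translation_cone \<Omega>" "k \<in> translation_cone \<Omega>"
  shows "(\<integral>\<^sup>+x. ennreal (\<bar>u (x + h + k) - u (x + h)\<bar> powr p) * indicator \<Omega> x \<partial>lborel) \<le> increment_pow \<Omega> p u k"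
proof -
  have "(\<integral>\<^sup>+x. ennreal (\<bar>u (x + h + k) - u (x + h)\<bar> powr p) * indicator \<Omega> x \<partial>lborel)
    \<le> (\<integral>\<^sup>+x. ennreal (\<bar>u (x + h + k) - u (x + h)\<bar> powr p) * indicator \<Omega> (x + h) \<partial>lborel)"
    using translation_coneD[OF assms(1)] by (intro nn_integral_mono) (auto split: split_indicator)
  also have "\<dots> = (\<integral>\<^sup>+x. ennreal (\<bar>u (x + k) - u x\<bar> powr p) * indicator \<Omega> x \<partial>lborel)"
    by (rule nn_integral_lborel_shift) measurable
  finally show ?thesis
    using assms by (simp add: increment_pow_cone)
qed

text \<open>Both parts use the triangle inequality for x, x + h and x + h + k. The k-increment is
  based at x + h, which lies in \<Omega> because h is in the cone.\<close>

lemma increment_pow_add: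
  assumes "p \<ge> 1" "h \<in> translation_cone \<Omega>" "k \<in> translation_cone \<Omega>" "h + k \<in> translation_cone \<Omega>"
  shows "increment_pow \<Omega> p u (h + k) \<le> ennreal (2 powr (p - 1)) * (increment_pow \<Omega> p u h + increment_pow \<Omega> p u k)"
    and "increment_pow \<Omega> p u h \<le> ennreal (2 powr (p - 1)) * (increment_pow \<Omega> p u (h + k) + increment_pow \<Omega> p u k)"
proof -
  have "increment_pow \<Omega> p u (h + k) \<le> (\<integral>\<^sup>+x. ennreal (2 powr (p - 1)) *
      (ennreal (\<bar>u (x + h) - u x\<bar> powr p) * indicator \<Omega> x + ennreal (\<bar>u (x + h + k) - u (x + h)\<bar> powr p) * indicator \<Omega> x) \<partial>lborel)"
    unfolding increment_pow_cone[OF assms(4)]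
  proof (intro nn_integral_mono)
    fix x show "ennreal (\<bar>u (x + (h + k)) - u x\<bar> powr p) * indicator \<Omega> x \<le> ennreal (2 powr (p - 1)) *
      (ennreal (\<bar>u (x + h) - u x\<bar> powr p) * indicator \<Omega> x + ennreal (\<bar>u (x + h + k) - u (x + h)\<bar> powr p) * indicator \<Omega> x)"
      using abs_triangle_powr[OF assms(1), of "u (x + h) - u x" "u (x + h + k) - u (x + h)"]
      by (simp add: add.assoc split: split_indicator)
  qed
  also have "\<dots> = ennreal (2 powr (p - 1)) * (increment_pow \<Omega> p u h +
      (\<integral>\<^sup>+x. ennreal (\<bar>u (x + h + k) - u (x + h)\<bar> powr p) * indicator \<Omega> x \<partial>lborel))"
    using assms by (simp add: nn_integral_cmult nn_integral_add increment_pow_cone)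
  also have "\<dots> \<le> ennreal (2 powr (p - 1)) * (increment_pow \<Omega> p u h + increment_pow \<Omega> p u k)"
    using assms by (intro mult_left_mono add_left_mono increment_pow_cone_shift) auto
  finally show "increment_pow \<Omega> p u (h + k) \<le> ennreal (2 powr (p - 1)) * (increment_pow \<Omega> p u h + increment_pow \<Omega> p u k)" .
  have "increment_pow \<Omega> p u h \<le> (\<integral>\<^sup>+x. ennreal (2 powr (p - 1)) *
      (ennreal (\<bar>u (x + (h + k)) - u x\<bar> powr p) * indicator \<Omega> x + ennreal (\<bar>u (x + h + k) - u (x + h)\<bar> powr p) * indicator \<Omega> x) \<partial>lborel)"
    unfolding increment_pow_cone[OF assms(2)]
  proof (intro nn_integral_mono)
    fix x show "ennreal (\<bar>u (x + h) - u x\<bar> powr p) * indicator \<Omega> x \<le> ennreal (2 powr (p - 1)) *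
      (ennreal (\<bar>u (x + (h + k)) - u x\<bar> powr p) * indicator \<Omega> x + ennreal (\<bar>u (x + h + k) - u (x + h)\<bar> powr p) * indicator \<Omega> x)"
      using abs_triangle_powr[OF assms(1), of "u (x + (h + k)) - u x" "u (x + h) - u (x + h + k)"]
      by (simp add: add.assoc abs_minus_commute split: split_indicator)
  qed
  also have "\<dots> = ennreal (2 powr (p - 1)) * (increment_pow \<Omega> p u (h + k) +
      (\<integral>\<^sup>+x. ennreal (\<bar>u (x + h + k) - u (x + h)\<bar> powr p) * indicator \<Omega> x \<partial>lborel))"
    using assms by (simp add: nn_integral_cmult nn_integral_add increment_pow_cone)
  also have "\<dots> \<le> ennreal (2 powr (p - 1)) * (increment_pow \<Omega> p u (h + k) + increment_pow \<Omega> p u k)"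
    using assms by (intro mult_left_mono add_left_mono increment_pow_cone_shift) auto
  finally show "increment_pow \<Omega> p u h \<le> ennreal (2 powr (p - 1)) * (increment_pow \<Omega> p u (h + k) + increment_pow \<Omega> p u k)" .
qed

text \<open>Reduces a statement that is even in h to increments pointing into \<Omega>.\<close>

lemma translation_cone_induct:
  assumes "\<And>h. h \<in> translation_cone \<Omega> \<or> - h \<in> translation_cone \<Omega>"
    and "\<And>h. h \<in> translation_cone \<Omega> \<Longrightarrow> P h" and "\<And>h. P (- h) \<Longrightarrow> P h"
  shows "P h"
  using assms by blast

lemma increment_pow_doubling:
  assumes cone: "\<And>h. h \<in> translation_cone \<Omega> \<or> - h \<in> translation_cone \<Omega>" and "p \<ge> 1"
  shows "increment_pow \<Omega> p u (2 *\<^sub>R h) \<le> ennreal (2 powr p) * increment_pow \<Omega> p u h"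
proof (induction h rule: translation_cone_induct[OF cone])
  case (1 h)
  have "increment_pow \<Omega> p u (h + h) \<le> ennreal (2 powr (p - 1)) * (increment_pow \<Omega> p u h + increment_pow \<Omega> p u h)"
    using 1 translation_cone_scaleR[OF 1, of 2] by (intro increment_pow_add \<open>p \<ge> 1\<close>) (auto simp: scaleR_2)
  also have "\<dots> = ennreal (2 powr (p - 1) * 2) * increment_pow \<Omega> p u h"
    by (subst ennreal_mult) (simp_all add: mult.assoc flip: mult_2)
  finally show ?case
    by (simp add: scaleR_2 powr_diff)
next
  case (2 h)
  then show ?case by (simp add: increment_pow_uminus)
qed

lemma increment_pow_dilate:
  assumes cone: "\<And>h. h \<in> translation_cone \<Omega> \<or> - h \<in> translation_cone \<Omega>" and "p \<ge> 1" "t > 0"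
  shows "increment_pow \<Omega> p u h \<le> ennreal (2 powr (p - 1)) *
    (increment_pow \<Omega> p u ((1 + t) *\<^sub>R h) + increment_pow \<Omega> p u (t *\<^sub>R h))"
proof (induction h rule: translation_cone_induct[OF cone])
  case (1 h)
  show ?case
    using increment_pow_add(2)[of h "t *\<^sub>R h"] 1 translation_cone_scaleR[OF 1, of t]
      translation_cone_scaleR[OF 1, of "1 + t"] assms(2,3)
    by (simp add: scaleR_add_left)
next
  case (2 h)
  then show ?case by (simp add: increment_pow_uminus)
qed

text \<open>The substitute for averaging over dilates when \<sigma> = 0. The indicators of x and x +
  h are used one per summand, so h may be arbitrary.\<close>

lemma increment_pow_le_norm:
  assumes "p \<ge> 1"
  shows "increment_pow \<Omega> p u h \<le> ennreal (2 powr p) * (\<integral>\<^sup>+x. ennreal (\<bar>u x\<bar> powr p) * indicator \<Omega> x \<partial>lborel)"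
proof -
  have "increment_pow \<Omega> p u h \<le> (\<integral>\<^sup>+x. ennreal (2 powr (p - 1)) *
      (ennreal (\<bar>u (x + h)\<bar> powr p) * indicator \<Omega> (x + h) + ennreal (\<bar>u x\<bar> powr p) * indicator \<Omega> x) \<partial>lborel)"
    unfolding increment_pow_def
  proof (intro nn_integral_mono)
    fix x show "ennreal (\<bar>u (x + h) - u x\<bar> powr p) * indicator \<Omega> (x + h) * indicator \<Omega> x \<le> ennreal (2 powr (p - 1)) *
      (ennreal (\<bar>u (x + h)\<bar> powr p) * indicator \<Omega> (x + h) + ennreal (\<bar>u x\<bar> powr p) * indicator \<Omega> x)"
      using abs_triangle_powr[OF assms(1), of "u (x + h)" "- u x"]
      by (simp split: split_indicator)
  qed
  also have "\<dots> = ennreal (2 powr (p - 1)) * ((\<integral>\<^sup>+x. ennreal (\<bar>u (x + h)\<bar> powr p) * indicator \<Omega> (x + h) \<partial>lborel) + (\<integral>\<^sup>+x. ennreal (\<bar>u x\<bar> powr p) * indicator \<Omega> x \<partial>lborel))"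
    by (simp add: nn_integral_cmult nn_integral_add)
  also have "(\<integral>\<^sup>+x. ennreal (\<bar>u (x + h)\<bar> powr p) * indicator \<Omega> (x + h) \<partial>lborel) = (\<integral>\<^sup>+x. ennreal (\<bar>u x\<bar> powr p) * indicator \<Omega> x \<partial>lborel)"
    by (rule nn_integral_lborel_shift) measurable
  also have "ennreal (2 powr (p - 1)) * ((\<integral>\<^sup>+x. ennreal (\<bar>u x\<bar> powr p) * indicator \<Omega> x \<partial>lborel) + (\<integral>\<^sup>+x. ennreal (\<bar>u x\<bar> powr p) * indicator \<Omega> x \<partial>lborel))
     = ennreal (2 powr (p - 1) * 2) * (\<integral>\<^sup>+x. ennreal (\<bar>u x\<bar> powr p) * indicator \<Omega> x \<partial>lborel)"
    by (subst ennreal_mult) (simp_all add: mult.assoc flip: mult_2)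
  finally show ?thesis
    by (simp add: powr_diff)
qed

end

lemma nn_integral_lebesgue_on:
  assumes "\<Omega> \<in> sets borel"
  shows "(\<integral>\<^sup>+x. f x \<partial>lebesgue_on \<Omega>) = (\<integral>\<^sup>+x. f x * indicator \<Omega> x \<partial>lborel)"
  using assms by (subst nn_integral_restrict_space) (auto simp: nn_integral_completion)

text \<open>Substitute y = x + h and exchange the integrals. The function u is only Lebesgue
  measurable in the application; the Borel version u' makes the integrand jointly measurable for
  Fubini.\<close>

lemma gagliardo_pow_eq_increment_pow:
  fixes u u' :: "'a::euclidean_space \<Rightarrow> real"
  assumes [measurable]: "\<Omega> \<in> sets borel" "u' \<in> borel_measurable borel"
    and ae: "AE x in lborel. u x = u' x"
    and "t \<noteq> 0" "t \<noteq> 1"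
  shows "gagliardo_pow \<Omega> t p u =
    (\<integral>\<^sup>+h. increment_pow \<Omega> p u' h * radial_weight (t * p) h \<partial>lborel)"
proof -
  let ?w = "\<lambda>h::'a. norm h powr (- real DIM('a) - t * p)"
  have *: "\<bar>a\<bar> powr p / norm (x - y) powr (real DIM('a) + t * p) = \<bar>a\<bar> powr p * ?w (y - x)" for a and x y :: 'a
    by (simp add: norm_minus_commute powr_diff powr_minus powr_add divide_simps)
  have "gagliardo_pow \<Omega> t p u = (\<integral>\<^sup>+x. (\<integral>\<^sup>+y. ennreal (\<bar>u x - u y\<bar> powr p * ?w (y - x)) * indicator \<Omega> y \<partial>lborel) * indicator \<Omega> x \<partial>lborel)"
    using assms unfolding gagliardo_pow_def * by (simp add: nn_integral_lebesgue_on)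
  also have "\<dots> = (\<integral>\<^sup>+x. (\<integral>\<^sup>+y. ennreal (\<bar>u' x - u' y\<bar> powr p * ?w (y - x)) * indicator \<Omega> y \<partial>lborel) * indicator \<Omega> x \<partial>lborel)"
  proof (rule nn_integral_cong_AE)
    show "AE x in lborel. (\<integral>\<^sup>+y. ennreal (\<bar>u x - u y\<bar> powr p * ?w (y - x)) * indicator \<Omega> y \<partial>lborel) * indicator \<Omega> x
       = (\<integral>\<^sup>+y. ennreal (\<bar>u' x - u' y\<bar> powr p * ?w (y - x)) * indicator \<Omega> y \<partial>lborel) * indicator \<Omega> x"
      using ae
    proof eventually_elim
      case (elim x)
      have "(\<integral>\<^sup>+y. ennreal (\<bar>u x - u y\<bar> powr p * ?w (y - x)) * indicator \<Omega> y \<partial>lborel) = (\<integral>\<^sup>+y. ennreal (\<bar>u' x - u' y\<bar> powr p * ?w (y - x)) * indicator \<Omega> y \<partial>lborel)"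
        using ae by (intro nn_integral_cong_AE) (auto elim!: eventually_mono simp: elim)
      then show ?case by simp
    qed
  qed
  also have "\<dots> = (\<integral>\<^sup>+x. (\<integral>\<^sup>+h. ennreal (\<bar>u' (x + h) - u' x\<bar> powr p) * indicator \<Omega> (x + h) * indicator \<Omega> x * ennreal (?w h) \<partial>lborel) \<partial>lborel)"
  proof (intro nn_integral_cong)
    fix x
    have "(\<integral>\<^sup>+y. ennreal (\<bar>u' x - u' y\<bar> powr p * ?w (y - x)) * indicator \<Omega> y \<partial>lborel) * indicator \<Omega> x
      = (\<integral>\<^sup>+y. ennreal (\<bar>u' x - u' y\<bar> powr p * ?w (y - x)) * indicator \<Omega> y * indicator \<Omega> x \<partial>lborel)"
      by (simp add: nn_integral_multc)
    also have "\<dots> = (\<integral>\<^sup>+h. ennreal (\<bar>u' x - u' (h + x)\<bar> powr p * ?w (h + x - x)) * indicator \<Omega> (h + x) * indicator \<Omega> x \<partial>lborel)"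
      by (subst nn_integral_lborel_shift[symmetric, of _ x]) auto
    finally show "(\<integral>\<^sup>+y. ennreal (\<bar>u' x - u' y\<bar> powr p * ?w (y - x)) * indicator \<Omega> y \<partial>lborel) * indicator \<Omega> x
      = (\<integral>\<^sup>+h. ennreal (\<bar>u' (x + h) - u' x\<bar> powr p) * indicator \<Omega> (x + h) * indicator \<Omega> x * ennreal (?w h) \<partial>lborel)"
      by (simp add: ennreal_mult ac_simps abs_minus_commute)
  qed
  also have "\<dots> = (\<integral>\<^sup>+h. (\<integral>\<^sup>+x. ennreal (\<bar>u' (x + h) - u' x\<bar> powr p) * indicator \<Omega> (x + h) * indicator \<Omega> x * ennreal (?w h) \<partial>lborel) \<partial>lborel)"
    by (rule lborel_pair.Fubini') measurable
  also have "\<dots> = (\<integral>\<^sup>+h. increment_pow \<Omega> p u' h * ennreal (?w h) \<partial>lborel)"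
    unfolding increment_pow_def by (subst nn_integral_multc) auto
  finally show ?thesis .
qed

section \<open>Radial integrals\<close>

context
  fixes f :: "'a::euclidean_space \<Rightarrow> ennreal" and p :: real
  assumes f_borel [measurable]: "f \<in> borel_measurable borel"
    and hom: "\<And>t h. t > 0 \<Longrightarrow> f (t *\<^sub>R h) = ennreal (t powr p) * f h"
begin

lemma homogeneous_integral_ball:
  assumes "r > 0"
  shows "(\<integral>\<^sup>+h. f h * indicator {h. norm h \<le> r} h \<partial>lborel)
    = ennreal (r powr (real DIM('a) + p)) * (\<integral>\<^sup>+h. f h * indicator {h. norm h \<le> 1} h \<partial>lborel)"
proof -
  have "(\<integral>\<^sup>+h. f h * indicator {h. norm h \<le> r} h \<partial>lborel)
     = ennreal (\<bar>r\<bar> ^ DIM('a)) * (\<integral>\<^sup>+h. f (r *\<^sub>R h) * indicator {h. norm h \<le> r} (r *\<^sub>R h) \<partial>lborel)"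
    using assms by (intro nn_integral_lborel_affine) auto
  also have "(\<integral>\<^sup>+h. f (r *\<^sub>R h) * indicator {h. norm h \<le> r} (r *\<^sub>R h) \<partial>lborel)
     = (\<integral>\<^sup>+h. ennreal (r powr p) * (f h * indicator {h. norm h \<le> 1} h) \<partial>lborel)"
    using assms by (intro nn_integral_cong) (simp add: hom indicator_def mult.assoc)
  also have "\<dots> = ennreal (r powr p) * (\<integral>\<^sup>+h. f h * indicator {h. norm h \<le> 1} h \<partial>lborel)"
    by (simp add: nn_integral_cmult)
  finally show ?thesis
    using assms by (simp add: powr_add powr_realpow ennreal_mult mult.assoc)
qed

text \<open>Write exp(-|h|^2) as the integral of exp(-t) over t \<ge> |h|^2. The ball of radius sqrt
  t contributes t^((d+p)/2) by homogeneity, and a Gamma integral remains. Conversely this computes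
  unit ball integrals from Gaussian moments.\<close>

lemma homogeneous_integral_gaussian:
  assumes "p \<ge> 0"
  shows "(\<integral>\<^sup>+h. f h * ennreal (exp (- (norm h)\<^sup>2)) \<partial>lborel)
    = ennreal (Gamma ((real DIM('a) + p) / 2 + 1)) * (\<integral>\<^sup>+h. f h * indicator {h. norm h \<le> 1} h \<partial>lborel)"
proof -
  let ?M = "\<integral>\<^sup>+h. f h * indicator {h. norm h \<le> 1} h \<partial>lborel"
  have layer: "(\<integral>\<^sup>+t. ennreal (exp (- t)) * indicator {a..} t \<partial>lborel) = ennreal (exp (- a))" for a :: real
  proof (subst nn_integral_FTC_atLeast[where F = "\<lambda>t. - exp (- t)" and T = 0])
    have "((\<lambda>t::real. - exp (- t)) \<longlongrightarrow> - 0) at_top"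
      by (intro tendsto_minus filterlim_compose[OF exp_at_bot] filterlim_uminus_at_bot_at_top)
    then show "((\<lambda>t::real. - exp (- t)) \<longlongrightarrow> 0) at_top"
      by simp
  qed (auto intro!: derivative_eq_intros)
  have "(\<integral>\<^sup>+h. f h * ennreal (exp (- (norm h)\<^sup>2)) \<partial>lborel)
     = (\<integral>\<^sup>+h. (\<integral>\<^sup>+t. f h * (ennreal (exp (- t)) * indicator {(norm h)\<^sup>2..} t) \<partial>lborel) \<partial>lborel)"
    by (simp add: nn_integral_cmult layer)
  also have "\<dots> = (\<integral>\<^sup>+t. (\<integral>\<^sup>+h. f h * (ennreal (exp (- t)) * indicator {(norm h)\<^sup>2..} t) \<partial>lborel) \<partial>lborel)"
    by (rule lborel_pair.Fubini'[symmetric]) (simp add: split_beta' indicator_def)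
  also have "\<dots> = (\<integral>\<^sup>+t. ennreal (indicator {0..} t * t powr ((real DIM('a) + p) / 2 + 1 - 1) / exp t) * ?M \<partial>lborel)"
  proof (rule nn_integral_cong_AE)
    have "(\<integral>\<^sup>+h. f h * (ennreal (exp (- t)) * indicator {(norm h)\<^sup>2..} t) \<partial>lborel)
      = ennreal (indicator {0..} t * t powr ((real DIM('a) + p) / 2 + 1 - 1) / exp t) * ?M" if "t \<noteq> 0" for t
    proof (cases "t > 0")
      case True
      have iff: "(norm h)\<^sup>2 \<le> t \<longleftrightarrow> norm h \<le> sqrt t" for h :: 'a
        using real_sqrt_le_iff[of "(norm h)\<^sup>2" t] by simp
      have "f h * (ennreal (exp (- t)) * indicator {(norm h)\<^sup>2..} t)
         = ennreal (exp (- t)) * (f h * indicator {h. norm h \<le> sqrt t} h)" for h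
      proof -
        have "indicator {(norm h)\<^sup>2..} t = (indicator {h. norm h \<le> sqrt t} h :: ennreal)"
          using iff[of h] unfolding indicator_def by (simp only: mem_Collect_eq atLeast_iff)
        then show ?thesis by (simp only: ac_simps)
      qed
      then have "(\<integral>\<^sup>+h. f h * (ennreal (exp (- t)) * indicator {(norm h)\<^sup>2..} t) \<partial>lborel)
         = (\<integral>\<^sup>+h. ennreal (exp (- t)) * (f h * indicator {h. norm h \<le> sqrt t} h) \<partial>lborel)"
        by simp
      also have "\<dots> = ennreal (exp (- t)) * (ennreal (sqrt t powr (real DIM('a) + p)) * ?M)"
        using True by (simp add: nn_integral_cmult homogeneous_integral_ball[of "sqrt t"])
      also have "\<dots> = ennreal (exp (- t) * sqrt t powr (real DIM('a) + p)) * ?M"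
        by (simp add: ennreal_mult mult.assoc)
      also have "exp (- t) * sqrt t powr (real DIM('a) + p) = indicator {0..} t * t powr ((real DIM('a) + p) / 2 + 1 - 1) / exp t"
      proof -
        have "sqrt t powr (real DIM('a) + p) = (t powr (1 / 2)) powr (real DIM('a) + p)"
          using True by (simp add: powr_half_sqrt)
        also have "\<dots> = t powr ((real DIM('a) + p) / 2 + 1 - 1)"
          unfolding powr_powr by simp
        finally have "sqrt t powr (real DIM('a) + p) = t powr ((real DIM('a) + p) / 2 + 1 - 1)" .
        moreover have "indicator {0..} t = (1::real)"
          using True by (simp add: indicator_def)
        ultimately show ?thesis
          by (simp only: exp_minus divide_inverse mult.commute mult_1_left mult_1_right)
      qed
      finally show ?thesis .
    next
      case False
      then have "indicator {(norm h)\<^sup>2..} t = (0 :: ennreal)" for h :: 'a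
        using that order_trans[OF zero_le_power2[of "norm h"], of t] by (auto simp: indicator_def)
      with False that show ?thesis by simp
    qed
    then show "AE t in lborel. (\<integral>\<^sup>+h. f h * (ennreal (exp (- t)) * indicator {(norm h)\<^sup>2..} t) \<partial>lborel)
      = ennreal (indicator {0..} t * t powr ((real DIM('a) + p) / 2 + 1 - 1) / exp t) * ?M"
      using AE_lborel_singleton[of 0] by (auto elim: eventually_mono)
  qed
  also have "\<dots> = (\<integral>\<^sup>+t. ennreal (indicator {0..} t * t powr ((real DIM('a) + p) / 2 + 1 - 1) / exp t) \<partial>lborel) * ?M"
    by (rule nn_integral_multc) measurable
  also have "\<dots> = ennreal (Gamma ((real DIM('a) + p) / 2 + 1)) * ?M"
    using assms by (subst Gamma_conv_nn_integral_real) (auto intro: add_nonneg_pos)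
  finally show ?thesis .
qed

text \<open>In polar terms the sphere integral of f is (d + p) times its unit ball integral, and the
  radial factor is the integral of r^(a-1) up to R. The layer cake formula replaces polar
  coordinates.\<close>

lemma homogeneous_integral_weight:
  assumes "0 < a" "a < real DIM('a) + p" "0 < R"
  shows "(\<integral>\<^sup>+h. f h * radial_weight (p - a) h * indicator {h. norm h \<le> R} h \<partial>lborel)
    \<le> ennreal (R powr a / a * (real DIM('a) + p)) * (\<integral>\<^sup>+h. f h * indicator {h. norm h \<le> 1} h \<partial>lborel)"
proof -
  let ?M = "\<integral>\<^sup>+h. f h * indicator {h. norm h \<le> 1} h \<partial>lborel"
  define q where "q = real DIM('a) + p - a"
  have "q > 0" using assms by (simp add: q_def)
  have layer: "ennreal (norm h powr (- q)) = ennreal (R powr (- q)) +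
      (\<integral>\<^sup>+r. ennreal (q * r powr (- q - 1)) * indicator {norm h..R} r \<partial>lborel)"
    if "h \<noteq> 0" "norm h \<le> R" for h :: 'a
    using that by (intro powr_layer_cake \<open>q > 0\<close>) auto
  have "(\<integral>\<^sup>+h. f h * ennreal (norm h powr (- q)) * indicator {h. norm h \<le> R} h \<partial>lborel)
     \<le> (\<integral>\<^sup>+h. ennreal (R powr (- q)) * (f h * indicator {h. norm h \<le> R} h) +
       (\<integral>\<^sup>+r. f h * (ennreal (q * r powr (- q - 1)) * indicator {norm h..R} r) \<partial>lborel) \<partial>lborel)"
  proof (intro nn_integral_mono)
    fix h :: 'a
    show "f h * ennreal (norm h powr (- q)) * indicator {h. norm h \<le> R} h
      \<le> ennreal (R powr (- q)) * (f h * indicator {h. norm h \<le> R} h) +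
       (\<integral>\<^sup>+r. f h * (ennreal (q * r powr (- q - 1)) * indicator {norm h..R} r) \<partial>lborel)"
      by (cases "h = 0"; cases "norm h \<le> R")
         (simp_all add: layer nn_integral_cmult distrib_left mult.commute)
  qed
  also have "\<dots> = ennreal (R powr (- q)) * (\<integral>\<^sup>+h. f h * indicator {h. norm h \<le> R} h \<partial>lborel) +
     (\<integral>\<^sup>+h. (\<integral>\<^sup>+r. f h * (ennreal (q * r powr (- q - 1)) * indicator {norm h..R} r) \<partial>lborel) \<partial>lborel)"
    by (subst nn_integral_add) (auto simp: nn_integral_cmult indicator_def[of "{norm _.._}"])
  also have "(\<integral>\<^sup>+h. (\<integral>\<^sup>+r. f h * (ennreal (q * r powr (- q - 1)) * indicator {norm h..R} r) \<partial>lborel) \<partial>lborel)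
     = (\<integral>\<^sup>+r. (\<integral>\<^sup>+h. f h * (ennreal (q * r powr (- q - 1)) * indicator {norm h..R} r) \<partial>lborel) \<partial>lborel)"
    by (rule lborel_pair.Fubini'[symmetric]) (simp add: split_beta' indicator_def)
  also have "\<dots> = (\<integral>\<^sup>+r. ennreal q * (ennreal (r powr (a - 1)) * indicator {0..R} r) * ?M \<partial>lborel)"
  proof (intro nn_integral_cong)
    fix r :: real
    show "(\<integral>\<^sup>+h. f h * (ennreal (q * r powr (- q - 1)) * indicator {norm h..R} r) \<partial>lborel)
      = ennreal q * (ennreal (r powr (a - 1)) * indicator {0..R} r) * ?M"
    proof (cases "0 < r \<and> r \<le> R")
      case True
      then have "(\<integral>\<^sup>+h. f h * (ennreal (q * r powr (- q - 1)) * indicator {norm h..R} r) \<partial>lborel)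
         = (\<integral>\<^sup>+h. ennreal (q * r powr (- q - 1)) * (f h * indicator {h. norm h \<le> r} h) \<partial>lborel)"
        by (intro nn_integral_cong) (simp add: indicator_def mult.commute)
      also have "\<dots> = ennreal (q * r powr (- q - 1)) * (ennreal (r powr (real DIM('a) + p)) * ?M)"
        using True by (simp add: nn_integral_cmult homogeneous_integral_ball[of r])
      also have "\<dots> = ennreal (q * r powr (- q - 1) * r powr (real DIM('a) + p)) * ?M"
        using \<open>q > 0\<close> by (simp add: ennreal_mult mult.assoc)
      also have "q * r powr (- q - 1) * r powr (real DIM('a) + p) = q * r powr (a - 1)"
        by (simp add: q_def mult.assoc flip: powr_add)
      finally show ?thesis
        using True \<open>q > 0\<close> by (simp add: ennreal_mult)
    next
      case False
      then have zero: "f h * (ennreal (q * r powr (- q - 1)) * indicator {norm h..R} r) = 0" for h :: 'a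
        using norm_ge_zero[of h] by (cases "r = 0") (auto simp: indicator_def simp del: norm_ge_zero)
      from False have "ennreal (r powr (a - 1)) * indicator {0..R} r = 0"
        by (cases "r = 0") (auto simp: indicator_def)
      then show ?thesis unfolding zero by simp
    qed
  qed
  also have "\<dots> = ennreal q * ennreal (R powr a / a) * ?M"
    using assms by (simp add: nn_integral_multc nn_integral_cmult nn_integral_powr_Icc0)
  also have "ennreal (R powr (- q)) * (\<integral>\<^sup>+h. f h * indicator {h. norm h \<le> R} h \<partial>lborel) + ennreal q * ennreal (R powr a / a) * ?M
     = ennreal (R powr (- q)) * ennreal (R powr (real DIM('a) + p)) * ?M + ennreal q * ennreal (R powr a / a) * ?M"
    using \<open>R > 0\<close> by (simp add: homogeneous_integral_ball[of R] mult.assoc)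
  also have "\<dots> = ennreal (R powr (- q) * R powr (real DIM('a) + p) + q * (R powr a / a)) * ?M"
    using assms \<open>q > 0\<close> by (simp add: ennreal_mult distrib_right del: times_divide_eq_right)
  also have "R powr (- q) * R powr (real DIM('a) + p) + q * (R powr a / a) = R powr a / a * (real DIM('a) + p)"
    using assms by (simp add: q_def field_simps flip: powr_add)
  finally show ?thesis
    by (simp add: q_def algebra_simps)
qed

end

section \<open>Sphere area and tails of the radial weight\<close>

lemma sphere_area_conv_unit_ball_vol:
  assumes "d > 0"
  shows "sphere_area d = real d * unit_ball_vol (real d)"
proof -
  have *: "Gamma (real d / 2 + 1) = real d / 2 * Gamma (real d / 2)"
    using assms by (intro Gamma_plus1) (auto simp: nonpos_Ints_def)
  show ?thesis
    using assms unfolding sphere_area_def unit_ball_vol_def * by simp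
qed

lemma sphere_area_pos: "d > 0 \<Longrightarrow> sphere_area d > 0"
  by (simp add: sphere_area_conv_unit_ball_vol)

text \<open>The weight is layered over radii r \<ge> |h|, so the inner integrals are volumes of the
  shells between R and r. The resulting function of r has an elementary primitive vanishing at
  infinity.\<close>

lemma nn_integral_norm_powr_tail:
  assumes "0 < \<alpha>" "0 < R"
  shows "(\<integral>\<^sup>+h. radial_weight \<alpha> h * indicator {h::'a::euclidean_space. R < norm h} h \<partial>lborel)
    = ennreal (sphere_area DIM('a) * R powr (- \<alpha>) / \<alpha>)"
proof -
  define d where "d = real DIM('a)"
  define q where "q = d + \<alpha>"
  define V where "V = unit_ball_vol d"
  have pos: "d > 0" "q > 0" "V > 0" using assms by (auto simp: d_def q_def V_def add_pos_pos)
  have "(\<integral>\<^sup>+h. ennreal (norm h powr (- q)) * indicator {h::'a. R < norm h} h \<partial>lborel)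
     = (\<integral>\<^sup>+h. (\<integral>\<^sup>+r. ennreal q * (ennreal (r powr (- q - 1)) * indicator {norm h..} r) * indicator {h::'a. R < norm h} h \<partial>lborel) \<partial>lborel)"
  proof (intro nn_integral_cong)
    fix h :: 'a
    show "ennreal (norm h powr (- q)) * indicator {h::'a. R < norm h} h
      = (\<integral>\<^sup>+r. ennreal q * (ennreal (r powr (- q - 1)) * indicator {norm h..} r) * indicator {h::'a. R < norm h} h \<partial>lborel)"
    proof (cases "R < norm h")
      case True
      then have "0 < norm h" using \<open>R > 0\<close> by linarith
      then show ?thesis
        using True \<open>q > 0\<close> by (simp add: nn_integral_cmult nn_integral_powr_atLeast flip: ennreal_mult)
    qed simp
  qed
  also have "\<dots> = (\<integral>\<^sup>+r. (\<integral>\<^sup>+h. ennreal q * (ennreal (r powr (- q - 1)) * indicator {norm h..} r) * indicator {h::'a. R < norm h} h \<partial>lborel) \<partial>lborel)"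
    by (rule lborel_pair.Fubini'[symmetric]) (simp add: split_beta' indicator_def)
  also have "\<dots> = (\<integral>\<^sup>+r. ennreal (q * V * (r powr (- \<alpha> - 1) - R powr d * r powr (- q - 1))) * indicator {R..} r \<partial>lborel)"
  proof (intro nn_integral_cong)
    fix r :: real
    show "(\<integral>\<^sup>+h. ennreal q * (ennreal (r powr (- q - 1)) * indicator {norm h..} r) * indicator {h::'a. R < norm h} h \<partial>lborel)
       = ennreal (q * V * (r powr (- \<alpha> - 1) - R powr d * r powr (- q - 1))) * indicator {R..} r"
    proof (cases "R \<le> r")
      case True
      have "(\<integral>\<^sup>+h. ennreal q * (ennreal (r powr (- q - 1)) * indicator {norm h..} r) * indicator {h::'a. R < norm h} h \<partial>lborel)
         = (\<integral>\<^sup>+h. ennreal (q * r powr (- q - 1)) * indicator (cball 0 r - cball 0 R) (h::'a) \<partial>lborel)"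
        using \<open>q > 0\<close> by (intro nn_integral_cong) (auto simp: indicator_def ennreal_mult)
      also have "\<dots> = ennreal (q * r powr (- q - 1)) * emeasure lborel (cball 0 r - cball 0 R :: 'a set)"
        by (rule nn_integral_cmult_indicator) measurable
      also have "emeasure lborel (cball 0 r - cball 0 R :: 'a set) = ennreal (V * r powr d) - ennreal (V * R powr d)"
        using True assms by (subst emeasure_Diff) (auto simp: emeasure_cball V_def d_def powr_realpow)
      also have "\<dots> = ennreal (V * r powr d - V * R powr d)"
        using \<open>V > 0\<close> by (simp add: ennreal_minus)
      also have "ennreal (q * r powr (- q - 1)) * ennreal (V * r powr d - V * R powr d)
         = ennreal (q * r powr (- q - 1) * (V * r powr d - V * R powr d))"
        using \<open>q > 0\<close> by (simp add: ennreal_mult')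
      also have "q * r powr (- q - 1) * (V * r powr d - V * R powr d)
         = q * V * (r powr (- q - 1) * r powr d - R powr d * r powr (- q - 1))"
        by (simp add: algebra_simps)
      also have "r powr (- q - 1) * r powr d = r powr (- \<alpha> - 1)"
        by (simp add: q_def flip: powr_add)
      finally show ?thesis using True by simp
    next
      case False
      then have zero: "ennreal q * (ennreal (r powr (- q - 1)) * indicator {norm h..} r) * indicator {h::'a. R < norm h} h = 0" for h :: 'a
        by (auto simp: indicator_def)
      show ?thesis unfolding zero using False by simp
    qed
  qed
  also have "\<dots> = ennreal (0 - q * V * (- (R powr (- \<alpha>)) / \<alpha> + R powr d * R powr (- q) / q))"
  proof (rule nn_integral_FTC_atLeast[where F = "\<lambda>r. q * V * (- (r powr (- \<alpha>)) / \<alpha> + R powr d * r powr (- q) / q)"])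
    show "DERIV (\<lambda>r. q * V * (- (r powr (- \<alpha>)) / \<alpha> + R powr d * r powr (- q) / q)) x :>
        q * V * (x powr (- \<alpha> - 1) - R powr d * x powr (- q - 1))" if "R \<le> x" for x
      using that assms \<open>q > 0\<close> by (auto intro!: derivative_eq_intros)
    show "0 \<le> q * V * (x powr (- \<alpha> - 1) - R powr d * x powr (- q - 1))" if "R \<le> x" for x
    proof -
      have "R powr d * x powr (- q - 1) \<le> x powr d * x powr (- q - 1)"
        using that assms pos by (intro mult_right_mono powr_mono2) auto
      also have "\<dots> = x powr (- \<alpha> - 1)"
        by (simp add: q_def flip: powr_add)
      finally show ?thesis using pos by simp
    qed
    have "((\<lambda>r::real. r powr (- c)) \<longlongrightarrow> 0) at_top" if "c > 0" for c
      using that by (intro tendsto_neg_powr filterlim_ident) auto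
    then have "((\<lambda>r. q * V * (- (r powr (- \<alpha>)) / \<alpha> + R powr d * r powr (- q) / q))
        \<longlongrightarrow> q * V * (- 0 / \<alpha> + R powr d * 0 / q)) at_top"
      using assms pos by (intro tendsto_intros) auto
    then show "((\<lambda>r. q * V * (- (r powr (- \<alpha>)) / \<alpha> + R powr d * r powr (- q) / q)) \<longlongrightarrow> 0) at_top"
      by simp
  qed measurable
  also have "0 - q * V * (- (R powr (- \<alpha>)) / \<alpha> + R powr d * R powr (- q) / q) = d * V * R powr (- \<alpha>) / \<alpha>"
  proof -
    have *: "R powr d * R powr (- q) = R powr (- \<alpha>)"
      by (simp add: q_def flip: powr_add)
    have "0 - q * V * (- x / \<alpha> + x / q) = (q - \<alpha>) * V * x / \<alpha>" for x
      using assms pos by (simp add: field_simps)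
    then show ?thesis
      unfolding * by (simp add: q_def)
  qed
  finally have "(\<integral>\<^sup>+h. ennreal (norm h powr (- q)) * indicator {h::'a. R < norm h} h \<partial>lborel)
    = ennreal (d * V * R powr (- \<alpha>) / \<alpha>)" .
  moreover have "- q = - real DIM('a) - \<alpha>"
    by (simp add: q_def d_def)
  ultimately show ?thesis
    by (simp add: d_def V_def sphere_area_conv_unit_ball_vol)
qed

text \<open>The one-dimensional case of the Gaussian formula: the unit ball integral is 2/(p+1), and
  the functional equation of Gamma removes the shift by 1.\<close>

lemma nn_integral_abs_powr_gaussian:
  assumes "p \<ge> 1"
  shows "(\<integral>\<^sup>+x. ennreal (\<bar>x\<bar> powr p) * ennreal (exp (- x\<^sup>2)) \<partial>lborel) = ennreal (Gamma ((p + 1) / 2))"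
proof -
  have "(\<integral>\<^sup>+x. ennreal (\<bar>x\<bar> powr p) * indicator {x. norm x \<le> 1} x \<partial>lborel)
    = (\<integral>\<^sup>+x. ennreal (\<bar>x\<bar> powr p) * indicator {0..1} x + ennreal (\<bar>x\<bar> powr p) * indicator {-1..<0} x \<partial>lborel)"
    by (intro nn_integral_cong) (auto simp: indicator_def)
  also have "\<dots> = (\<integral>\<^sup>+x. ennreal (\<bar>x\<bar> powr p) * indicator {0..1} x \<partial>lborel) + (\<integral>\<^sup>+x. ennreal (\<bar>x\<bar> powr p) * indicator {-1..<0} x \<partial>lborel)"
    by (intro nn_integral_add) auto
  also have "(\<integral>\<^sup>+x. ennreal (\<bar>x\<bar> powr p) * indicator {-1..<0} x \<partial>lborel) = (\<integral>\<^sup>+x. ennreal (\<bar>x\<bar> powr p) * indicator {0..1} x \<partial>lborel)"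
    by (subst nn_integral_lborel_uminus[symmetric])
       (auto intro!: nn_integral_cong simp: indicator_def)
  also have "(\<integral>\<^sup>+x. ennreal (\<bar>x\<bar> powr p) * indicator {0..1} x \<partial>lborel) = (\<integral>\<^sup>+x. ennreal (x powr (p + 1 - 1)) * indicator {0..1} x \<partial>lborel)"
    by (intro nn_integral_cong) (auto simp: indicator_def)
  also have "\<dots> = ennreal (1 / (p + 1))"
    using assms by (subst nn_integral_powr_Icc0) auto
  also have "ennreal (1 / (p + 1)) + ennreal (1 / (p + 1)) = ennreal (2 / (p + 1))"
    using assms by (simp flip: ennreal_plus)
  finally have M: "(\<integral>\<^sup>+x. ennreal (\<bar>x\<bar> powr p) * indicator {x::real. norm x \<le> 1} x \<partial>lborel) = ennreal (2 / (p + 1))" .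
  have G: "Gamma ((1 + p) / 2 + 1) = (1 + p) / 2 * Gamma ((1 + p) / 2)"
    using assms by (intro Gamma_plus1) (auto elim!: nonpos_Ints_cases)
  have "(\<integral>\<^sup>+x. ennreal (\<bar>x\<bar> powr p) * ennreal (exp (- x\<^sup>2)) \<partial>lborel) = ennreal (Gamma ((1 + p) / 2 + 1)) * ennreal (2 / (p + 1))"
    using homogeneous_integral_gaussian[of "\<lambda>x::real. ennreal (\<bar>x\<bar> powr p)" p] assms
    by (simp add: M[unfolded real_norm_def] abs_mult powr_mult ennreal_mult)
  also have "\<dots> = ennreal (Gamma ((1 + p) / 2 + 1) * (2 / (p + 1)))"
    using assms by (intro ennreal_mult[symmetric]) (auto intro!: less_imp_le[OF Gamma_real_pos] add_nonneg_pos)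
  also have "Gamma ((1 + p) / 2 + 1) * (2 / (p + 1)) = Gamma ((p + 1) / 2)"
    unfolding G using assms by (simp add: add.commute)
  finally show ?thesis .
qed

section \<open>Gaussian moments of linear functionals\<close>

abbreviation gaussian_density :: "real \<Rightarrow> real" where
  "gaussian_density \<equiv> normal_density 0 (sqrt (1 / 2))"

text \<open>Coordinates with variance 1/2 make the density a multiple of exp(-|h|^2), the weight in
  the homogeneous formula.\<close>

definition gaussian_measure :: "'a::euclidean_space measure" where
  "gaussian_measure = density lborel (\<lambda>h. \<Prod>b\<in>Basis. ennreal (gaussian_density (h \<bullet> b)))"

lemma normal_density_sqrt_half: "gaussian_density x = exp (- x\<^sup>2) / sqrt pi"
  by (simp add: normal_density_def real_sqrt_divide power_divide)

lemma nn_integral_normal_density: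
  "\<sigma> > 0 \<Longrightarrow> (\<integral>\<^sup>+x. ennreal (normal_density \<mu> \<sigma> x) \<partial>lborel) = 1"
  by (subst nn_integral_eq_integral) (auto simp: integral_normal_density)

lemma emeasure_gaussian_box:
  assumes [measurable]: "\<And>b. A b \<in> sets borel"
  shows "emeasure gaussian_measure {h::'a::euclidean_space. \<forall>b\<in>Basis. h \<bullet> b \<in> A b}
    = (\<Prod>b\<in>(Basis::'a set). \<integral>\<^sup>+x. ennreal (gaussian_density x) * indicator (A b) x \<partial>lborel)"
proof -
  have "{h::'a. \<forall>b\<in>Basis. h \<bullet> b \<in> A b} = (\<Inter>b\<in>Basis. (\<lambda>h. h \<bullet> b) -` A b \<inter> space borel)"
    by auto
  moreover have "(\<lambda>h::'a. h \<bullet> b) -` A b \<inter> space borel \<in> sets borel" for b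
    by (rule measurable_sets[of _ borel borel]) auto
  then have "(\<Inter>b\<in>Basis. (\<lambda>h::'a. h \<bullet> b) -` A b \<inter> space borel) \<in> sets borel"
    by (intro sets.finite_INT) auto
  ultimately have [measurable]: "{h::'a. \<forall>b\<in>Basis. h \<bullet> b \<in> A b} \<in> sets borel"
    by simp
  have "emeasure gaussian_measure {h::'a. \<forall>b\<in>Basis. h \<bullet> b \<in> A b}
    = (\<integral>\<^sup>+h. (\<Prod>b\<in>Basis. ennreal (gaussian_density (h \<bullet> b))) * indicator {h::'a. \<forall>b\<in>Basis. h \<bullet> b \<in> A b} h \<partial>lborel)"
    unfolding gaussian_measure_def by (intro emeasure_density) auto
  also have "\<dots> = (\<integral>\<^sup>+h. (\<Prod>b\<in>(Basis::'a set). ennreal (gaussian_density (h \<bullet> b)) * indicator (A b) (h \<bullet> b)) \<partial>lborel)"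
  proof (intro nn_integral_cong)
    fix h :: 'a
    show "(\<Prod>b\<in>Basis. ennreal (gaussian_density (h \<bullet> b))) * indicator {h::'a. \<forall>b\<in>Basis. h \<bullet> b \<in> A b} h
      = (\<Prod>b\<in>Basis. ennreal (gaussian_density (h \<bullet> b)) * indicator (A b) (h \<bullet> b))"
    proof (cases "\<forall>b\<in>Basis. h \<bullet> b \<in> A b")
      case False
      then obtain b where "b \<in> Basis" "h \<bullet> b \<notin> A b" by auto
      then have "(\<Prod>b\<in>Basis. ennreal (gaussian_density (h \<bullet> b)) * indicator (A b) (h \<bullet> b)) = 0"
        by (intro prod_zero) (auto intro!: bexI[of _ b])
      with False show ?thesis by simp
    qed (simp add: prod.distrib)
  qed
  also have "\<dots> = (\<Prod>b\<in>(Basis::'a set). \<integral>\<^sup>+x. ennreal (gaussian_density x) * indicator (A b) x \<partial>lborel)"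
    by (rule nn_integral_lborel_prod) auto
  finally show ?thesis .
qed

lemma prob_space_gaussian_measure: "prob_space gaussian_measure"
proof
  show "emeasure gaussian_measure (space gaussian_measure) = 1"
    using emeasure_gaussian_box[of "\<lambda>_. UNIV"]
    by (simp add: gaussian_measure_def nn_integral_normal_density)
qed

lemma distributed_gaussian_coordinate:
  assumes "b \<in> Basis"
  shows "distributed gaussian_measure lborel (\<lambda>h. h \<bullet> b) (gaussian_density)"
  unfolding distributed_def
proof (intro conjI)
  show "distr gaussian_measure lborel (\<lambda>h. h \<bullet> b) = density lborel (\<lambda>x. ennreal (gaussian_density x))"
  proof (rule measure_eqI)
    fix A assume "A \<in> sets (distr gaussian_measure lborel (\<lambda>h. h \<bullet> b))"
    then have [measurable]: "A \<in> sets borel" by simp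
    have "emeasure (distr gaussian_measure lborel (\<lambda>h. h \<bullet> b)) A = emeasure gaussian_measure {h. \<forall>c\<in>Basis. h \<bullet> c \<in> (if c = b then A else UNIV)}"
      using assms by (subst emeasure_distr) (auto simp: gaussian_measure_def intro!: arg_cong2[where f = emeasure])
    also have "\<dots> = (\<Prod>c\<in>Basis. if c = b then \<integral>\<^sup>+x. ennreal (gaussian_density x) * indicator A x \<partial>lborel else 1)"
    proof -
      have "emeasure gaussian_measure {h. \<forall>c\<in>Basis. h \<bullet> c \<in> (if c = b then A else UNIV)}
        = (\<Prod>c\<in>Basis. \<integral>\<^sup>+x. ennreal (gaussian_density x) * indicator (if c = b then A else UNIV) x \<partial>lborel)"
        by (rule emeasure_gaussian_box) auto
      also have "\<dots> = (\<Prod>c\<in>Basis. if c = b then \<integral>\<^sup>+x. ennreal (gaussian_density x) * indicator A x \<partial>lborel else 1)"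
        by (intro prod.cong) (auto simp: nn_integral_normal_density)
      finally show ?thesis .
    qed
    also have "\<dots> = emeasure (density lborel (\<lambda>x. ennreal (gaussian_density x))) A"
      using assms by (simp add: emeasure_density)
    finally show "emeasure (distr gaussian_measure lborel (\<lambda>h. h \<bullet> b)) A = \<dots>" .
  qed simp
qed (auto simp: gaussian_measure_def)

text \<open>The joint law of the coordinates agrees with the product of their laws on boxes, because
  the density factorises.\<close>

lemma indep_vars_gaussian_coordinates:
  "prob_space.indep_vars gaussian_measure (\<lambda>_. borel) (\<lambda>b h. h \<bullet> b) (Basis :: 'a::euclidean_space set)"
proof -
  interpret prob_space "gaussian_measure :: 'a measure" by (rule prob_space_gaussian_measure)
  have meas: "(\<lambda>h. \<lambda>b\<in>Basis. h \<bullet> b) \<in> gaussian_measure \<rightarrow>\<^sub>M (\<Pi>\<^sub>M b\<in>(Basis::'a set). borel :: real measure)"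
    by (auto simp: gaussian_measure_def intro!: measurable_restrict)
  have dens: "distr gaussian_measure borel (\<lambda>h::'a. h \<bullet> b) = density lborel (\<lambda>x. ennreal (gaussian_density x))"
    if "b \<in> Basis" for b
  proof -
    have "distr gaussian_measure borel (\<lambda>h::'a. h \<bullet> b) = distr gaussian_measure lborel (\<lambda>h::'a. h \<bullet> b)"
      by (rule distr_cong) auto
    then show ?thesis
      using distributed_gaussian_coordinate[OF that] by (simp add: distributed_def)
  qed
  interpret P: product_prob_space "\<lambda>b::'a. distr gaussian_measure borel (\<lambda>h::'a. h \<bullet> b)" Basis
    by (intro product_prob_spaceI prob_space_distr) (simp add: gaussian_measure_def)
  show ?thesis
  proof (subst indep_vars_iff_distr_eq_PiM')
    show "distr gaussian_measure (\<Pi>\<^sub>M b\<in>(Basis::'a set). borel) (\<lambda>h. \<lambda>b\<in>Basis. h \<bullet> b)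
      = (\<Pi>\<^sub>M b\<in>Basis. distr gaussian_measure borel (\<lambda>h::'a. h \<bullet> b))"
    proof (rule P.PiM_eqI)
      show "sets (distr gaussian_measure (\<Pi>\<^sub>M b\<in>(Basis::'a set). borel :: real measure) (\<lambda>h. \<lambda>b\<in>Basis. h \<bullet> b))
        = sets (\<Pi>\<^sub>M b\<in>Basis. distr gaussian_measure borel (\<lambda>h::'a. h \<bullet> b))"
        by (simp cong: sets_PiM_cong)
      fix A :: "'a \<Rightarrow> real set"
      assume "\<And>b. b \<in> Basis \<Longrightarrow> A b \<in> sets (distr gaussian_measure borel (\<lambda>h. h \<bullet> b))"
      then have A: "\<And>b. b \<in> Basis \<Longrightarrow> A b \<in> sets borel" by simp
      define B where "B b = (if b \<in> Basis then A b else UNIV)" for b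
      have [measurable]: "B b \<in> sets borel" for b using A by (simp add: B_def)
      have "emeasure (distr gaussian_measure (\<Pi>\<^sub>M b\<in>(Basis::'a set). borel :: real measure) (\<lambda>h. \<lambda>b\<in>Basis. h \<bullet> b)) (Pi\<^sub>E Basis A)
        = emeasure gaussian_measure {h::'a. \<forall>b\<in>Basis. h \<bullet> b \<in> B b}"
        using A by (subst emeasure_distr[OF meas])
          (auto simp: gaussian_measure_def B_def PiE_iff intro!: arg_cong2[where f = emeasure] sets_PiM_I_finite)
      also have "\<dots> = (\<Prod>b\<in>Basis. emeasure (distr gaussian_measure borel (\<lambda>h::'a. h \<bullet> b)) (A b))"
        using A by (subst emeasure_gaussian_box) (auto intro!: prod.cong simp: dens emeasure_density B_def)
      finally show "emeasure (distr gaussian_measure (\<Pi>\<^sub>M b\<in>(Basis::'a set). borel :: real measure) (\<lambda>h. \<lambda>b\<in>Basis. h \<bullet> b)) (Pi\<^sub>E Basis A) = \<dots>" .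
    qed simp
  qed (auto simp: gaussian_measure_def)
qed

text \<open>This takes the place of the rotation invariance of Lebesgue measure.\<close>

lemma distributed_gaussian_inner:
  fixes v :: "'a::euclidean_space"
  assumes "v \<noteq> 0"
  shows "distributed gaussian_measure lborel (\<lambda>h. v \<bullet> h) (normal_density 0 (norm v * sqrt (1 / 2)))"
proof -
  interpret prob_space "gaussian_measure :: 'a measure" by (rule prob_space_gaussian_measure)
  \<comment> \<open>The sum rule for independent normal variables requires positive standard
    deviations, so coordinates with zero coefficient are dropped; v \<noteq> 0 leaves at least
    one.\<close>
  define I where "I = {b\<in>Basis. v \<bullet> b \<noteq> 0}"
  have "I \<noteq> {}" "finite I" "I \<subseteq> Basis"
    using assms euclidean_eq_iff[of v 0] by (auto simp: I_def)
  have zero: "v \<bullet> b = 0" if "b \<in> Basis - I" for b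
    using that by (auto simp: I_def)
  have dist: "distributed gaussian_measure lborel (\<lambda>h. \<Sum>b\<in>I. 0 + (v \<bullet> b) * (h \<bullet> b))
      (normal_density (\<Sum>b\<in>I. 0 + (v \<bullet> b) * 0) (sqrt (\<Sum>b\<in>I. (\<bar>v \<bullet> b\<bar> * sqrt (1 / 2))\<^sup>2)))"
  proof (rule sum_indep_normal)
    show "indep_vars (\<lambda>_. borel) (\<lambda>b h. 0 + (v \<bullet> b) * (h \<bullet> b)) I"
      by (rule indep_vars_compose2[where Y = "\<lambda>b x. 0 + (v \<bullet> b) * x" and N = "\<lambda>_. borel",
            OF indep_vars_subset[OF indep_vars_gaussian_coordinates \<open>I \<subseteq> Basis\<close>]]) simp
    show "distributed gaussian_measure lborel (\<lambda>h. 0 + (v \<bullet> b) * (h \<bullet> b)) (normal_density (0 + (v \<bullet> b) * 0) (\<bar>v \<bullet> b\<bar> * sqrt (1 / 2)))"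
      if "b \<in> I" for b
      using that normal_density_affine[OF distributed_gaussian_coordinate[of b], of "v \<bullet> b" 0]
      by (simp add: I_def)
  qed (use \<open>I \<noteq> {}\<close> \<open>finite I\<close> in \<open>auto simp: I_def\<close>)
  have "(\<lambda>h. \<Sum>b\<in>I. 0 + (v \<bullet> b) * (h \<bullet> b)) = (\<lambda>h. v \<bullet> h)"
  proof
    fix h
    have "(\<Sum>b\<in>I. 0 + (v \<bullet> b) * (h \<bullet> b)) = (\<Sum>b\<in>Basis. (v \<bullet> b) * (h \<bullet> b))"
      using \<open>I \<subseteq> Basis\<close> zero by (intro sum.mono_neutral_cong_left) auto
    then show "(\<Sum>b\<in>I. 0 + (v \<bullet> b) * (h \<bullet> b)) = v \<bullet> h"
      by (subst (3) euclidean_inner) simp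
  qed
  moreover have "(\<Sum>b\<in>I. (\<bar>v \<bullet> b\<bar> * sqrt (1 / 2))\<^sup>2) = (v \<bullet> v) * (sqrt (1 / 2))\<^sup>2"
  proof -
    have "(\<Sum>b\<in>I. (\<bar>v \<bullet> b\<bar> * sqrt (1 / 2))\<^sup>2) = (\<Sum>b\<in>Basis. (v \<bullet> b) * (v \<bullet> b) * (sqrt (1 / 2))\<^sup>2)"
      using \<open>I \<subseteq> Basis\<close> zero
      by (intro sum.mono_neutral_cong_left) (auto simp: power_mult_distrib power2_eq_square[of "v \<bullet> _"])
    then show ?thesis
      by (simp only: sum_distrib_right[symmetric] euclidean_inner[of v v, symmetric])
  qed
  moreover have "sqrt ((v \<bullet> v) * (sqrt (1 / 2))\<^sup>2) = norm v * sqrt (1 / 2)"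
    by (simp only: real_sqrt_mult norm_eq_sqrt_inner real_sqrt_abs) simp
  ultimately show ?thesis
    using dist by (simp only: mult_zero_right add_0_left sum.neutral_const)
qed

text \<open>The functional v.h is normal with standard deviation |v| sqrt(1/2), so its moment is
  |v|^p times the one-dimensional one. The powers of sqrt pi are the two normalisations, in
  dimension d and in dimension 1.\<close>

lemma nn_integral_inner_powr_gaussian:
  fixes v :: "'a::euclidean_space"
  assumes "p \<ge> 1"
  shows "(\<integral>\<^sup>+h. ennreal (\<bar>v \<bullet> h\<bar> powr p) * ennreal (exp (- (norm h)\<^sup>2)) \<partial>lborel)
    = ennreal (norm v powr p * Gamma ((p + 1) / 2) * sqrt pi ^ DIM('a) / sqrt pi)"
proof (cases "v = 0")
  case False
  have exp_prod: "(\<Prod>b\<in>Basis. ennreal (gaussian_density (h \<bullet> b))) = ennreal (exp (- (norm h)\<^sup>2) / sqrt pi ^ DIM('a))" for h :: 'a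
  proof -
    have "(\<Prod>b\<in>(Basis::'a set). gaussian_density (h \<bullet> b)) = exp (- (norm h)\<^sup>2) / sqrt pi ^ DIM('a)"
      unfolding normal_density_sqrt_half prod_dividef exp_sum[symmetric, OF finite_Basis]
      by (simp add: sum_negf power2_norm_eq_inner euclidean_inner[of h h] power2_eq_square[of "h \<bullet> _"])
    then show ?thesis
      by (subst prod_ennreal) auto
  qed
  have "(\<integral>\<^sup>+h. ennreal (\<bar>v \<bullet> h\<bar> powr p) * ennreal (exp (- (norm h)\<^sup>2)) \<partial>lborel)
     = (\<integral>\<^sup>+h. ennreal (sqrt pi ^ DIM('a)) * ((\<Prod>b\<in>Basis. ennreal (gaussian_density (h \<bullet> b))) * ennreal (\<bar>v \<bullet> h\<bar> powr p)) \<partial>lborel)"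
    unfolding exp_prod by (intro nn_integral_cong) (simp flip: ennreal_mult)
  also have "\<dots> = ennreal (sqrt pi ^ DIM('a)) * (\<integral>\<^sup>+h. ennreal (\<bar>v \<bullet> h\<bar> powr p) \<partial>gaussian_measure)"
    unfolding gaussian_measure_def by (simp add: nn_integral_density nn_integral_cmult)
  also have "(\<integral>\<^sup>+h. ennreal (\<bar>v \<bullet> h\<bar> powr p) \<partial>gaussian_measure)
     = (\<integral>\<^sup>+x. ennreal (normal_density 0 (norm v * sqrt (1 / 2)) x) * ennreal (\<bar>x\<bar> powr p) \<partial>lborel)"
    by (rule distributed_nn_integral[symmetric, OF distributed_gaussian_inner[OF False]]) auto
  also have "\<dots> = ennreal (norm v) * (\<integral>\<^sup>+x. ennreal (normal_density 0 (norm v * sqrt (1 / 2)) (norm v * x)) * ennreal (\<bar>norm v * x\<bar> powr p) \<partial>lborel)"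
    using False by (subst nn_integral_lborel_affine[of _ "norm v"]) auto
  also have "(\<integral>\<^sup>+x. ennreal (normal_density 0 (norm v * sqrt (1 / 2)) (norm v * x)) * ennreal (\<bar>norm v * x\<bar> powr p) \<partial>lborel)
     = (\<integral>\<^sup>+x. ennreal (norm v powr p / (norm v * sqrt pi)) * (ennreal (\<bar>x\<bar> powr p) * ennreal (exp (- x\<^sup>2))) \<partial>lborel)"
  proof (intro nn_integral_cong)
    fix x
    have "normal_density 0 (norm v * sqrt (1 / 2)) (norm v * x) * \<bar>norm v * x\<bar> powr p
       = norm v powr p / (norm v * sqrt pi) * (\<bar>x\<bar> powr p * exp (- x\<^sup>2))"
      using False by (simp add: normal_density_def abs_mult powr_mult power_mult_distrib real_sqrt_mult real_sqrt_divide power_divide mult_ac)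
    then show "ennreal (normal_density 0 (norm v * sqrt (1 / 2)) (norm v * x)) * ennreal (\<bar>norm v * x\<bar> powr p)
       = ennreal (norm v powr p / (norm v * sqrt pi)) * (ennreal (\<bar>x\<bar> powr p) * ennreal (exp (- x\<^sup>2)))"
      by (simp flip: ennreal_mult)
  qed
  also have "\<dots> = ennreal (norm v powr p / (norm v * sqrt pi)) * ennreal (Gamma ((p + 1) / 2))"
    using assms by (simp add: nn_integral_cmult nn_integral_abs_powr_gaussian)
  also have "ennreal (sqrt pi ^ DIM('a)) * (ennreal (norm v) * (ennreal (norm v powr p / (norm v * sqrt pi)) * ennreal (Gamma ((p + 1) / 2))))
     = ennreal (sqrt pi ^ DIM('a) * (norm v * (norm v powr p / (norm v * sqrt pi) * Gamma ((p + 1) / 2))))"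
  proof -
    have "Gamma ((p + 1) / 2) \<ge> 0" using assms by (intro less_imp_le[OF Gamma_real_pos]) auto
    then show ?thesis using False by (simp flip: ennreal_mult)
  qed
  also have "sqrt pi ^ DIM('a) * (norm v * (norm v powr p / (norm v * sqrt pi) * Gamma ((p + 1) / 2)))
     = norm v powr p * Gamma ((p + 1) / 2) * sqrt pi ^ DIM('a) / sqrt pi"
    using False by simp
  finally show ?thesis .
qed (use assms in simp)

text \<open>\<open>K_const\<close> is the mean of |\<omega>.e|^p over unit vectors \<omega> for a
  fixed unit vector e, so \<open>K_const\<close> times \<open>sphere_area\<close> is the sphere
  integral. It is obtained here by evaluating the Gaussian integral in two ways and solving for the
  unit ball integral.\<close>

lemma nn_integral_inner_powr_weight:
  fixes v :: "'a::euclidean_space"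
  assumes "p \<ge> 1" "0 < a" "a \<le> p" "0 < R"
  shows "(\<integral>\<^sup>+h. ennreal (\<bar>v \<bullet> h\<bar> powr p) * radial_weight (p - a) h * indicator {h. norm h \<le> R} h \<partial>lborel)
    \<le> ennreal (R powr a / a * (K_const DIM('a) p * sphere_area DIM('a))) * ennreal (norm v powr p)"
proof -
  define d where "d = real DIM('a)"
  have "d > 0" by (simp add: d_def)
  define c where "c = norm v powr p * Gamma ((p + 1) / 2) * sqrt pi ^ DIM('a) / sqrt pi"
  define g where "g = Gamma ((d + p) / 2 + 1)"
  have "c \<ge> 0" unfolding c_def using assms by (simp add: less_imp_le)
  have "g > 0" unfolding g_def using \<open>d > 0\<close> assms by (intro Gamma_real_pos add_nonneg_pos) auto
  have g: "g = (d + p) / 2 * Gamma ((d + p) / 2)"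
    unfolding g_def using \<open>d > 0\<close> assms by (intro Gamma_plus1) (auto elim!: nonpos_Ints_cases)
  let ?M = "\<integral>\<^sup>+h. ennreal (\<bar>v \<bullet> h\<bar> powr p) * indicator {h. norm h \<le> 1} h \<partial>lborel"
  have hom: "ennreal (\<bar>v \<bullet> (t *\<^sub>R h)\<bar> powr p) = ennreal (t powr p) * ennreal (\<bar>v \<bullet> h\<bar> powr p)" if "t > 0" for t h
    using that by (simp add: abs_mult powr_mult ennreal_mult)
  have "ennreal g * ?M = ennreal c"
    using homogeneous_integral_gaussian[of "\<lambda>h. ennreal (\<bar>v \<bullet> h\<bar> powr p)" p, OF _ hom] assms
      nn_integral_inner_powr_gaussian[of p v]
    by (simp add: g_def c_def d_def)
  then have "ennreal (1 / g) * (ennreal g * ?M) = ennreal (1 / g) * ennreal c"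
    by simp
  then have M: "?M = ennreal (c / g)"
    using \<open>g > 0\<close> \<open>c \<ge> 0\<close> by (simp add: mult.assoc[symmetric] flip: ennreal_mult)
  have "(\<integral>\<^sup>+h. ennreal (\<bar>v \<bullet> h\<bar> powr p) * radial_weight (p - a) h * indicator {h. norm h \<le> R} h \<partial>lborel)
    \<le> ennreal (R powr a / a * (d + p)) * ?M"
    unfolding d_def using assms by (intro homogeneous_integral_weight hom) (auto simp: add_pos_nonneg intro: le_less_trans)
  also have "\<dots> = ennreal (R powr a / a * (d + p) * (c / g))"
    unfolding M using assms \<open>g > 0\<close> \<open>d > 0\<close> \<open>c \<ge> 0\<close> by (simp flip: ennreal_mult)
  also have "(d + p) * (c / g) = K_const DIM('a) p * sphere_area DIM('a) * norm v powr p"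
  proof -
    have pow: "sqrt pi ^ DIM('a) = pi powr (d / 2)"
    proof -
      have "sqrt pi ^ DIM('a) = (pi powr (1 / 2)) powr d"
        by (simp add: powr_half_sqrt powr_realpow d_def)
      then show ?thesis unfolding powr_powr by simp
    qed
    \<comment> \<open>Stands for the required identity with the Gamma values, powers of pi and |v|^p
      abstracted to variables; n is d + p and w is Gamma(d/2).\<close>
    have alg: "n * (x * y * P / q / (n / 2 * z)) = w * y / (z * q) * (2 * P / w) * x"
      if "n > 0" "w > 0" for n x y P q z w :: real
      using that by (simp add: field_simps)
    have pos: "d + p > 0" "Gamma (d / 2) > 0"
      using \<open>d > 0\<close> assms by auto
    show ?thesis
      unfolding g c_def K_const_def sphere_area_def d_def[symmetric] pow Gamma_one_half_real
      by (rule alg[OF pos])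
  qed
  then have "R powr a / a * (d + p) * (c / g) = R powr a / a * (K_const DIM('a) p * sphere_area DIM('a)) * norm v powr p"
    by (simp only: mult.assoc)
  finally show ?thesis
    using assms by (subst ennreal_mult''[symmetric]) auto
qed

section \<open>Optimisation\<close>

lemma epowr_0 [simp]: "0 epowr a = 0"
  by (simp add: epowr_def)

lemma epowr_top [simp]: "\<infinity> epowr a = \<infinity>" "\<top> epowr a = \<top>"
  by (simp_all add: epowr_def)

lemma epowr_ennreal: "x \<ge> 0 \<Longrightarrow> ennreal x epowr a = ennreal (x powr a)"
  by (simp add: epowr_def)

lemma epowr_eq_0_iff: "x epowr a = 0 \<longleftrightarrow> x = 0"
  by (cases x) (auto simp: epowr_ennreal)

lemma epowr_mono:
  assumes "x \<le> y" "a \<ge> 0"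
  shows "x epowr a \<le> y epowr a"
proof (cases y)
  case (real b)
  then obtain c where "x = ennreal c" "c \<ge> 0"
    using \<open>x \<le> y\<close> by (cases x) (auto simp: top_unique)
  then show ?thesis
    using assms real by (auto simp: epowr_ennreal intro!: ennreal_leI powr_mono2)
qed simp

lemma rcp_ennreal: "q > 0 \<Longrightarrow> rcp (ennreal q) = 1 / q"
  by (simp add: rcp_def inverse_ennreal divide_inverse)

text \<open>R is the critical point of the left side: m a R^m = k b R^(-k), together with \<theta> =
  k/(m+k), gives R^(m+k) = \<theta> b / ((1-\<theta>) a).\<close>

lemma two_power_sum_minimum:
  fixes a b m k \<theta> :: real
  assumes "a > 0" "b > 0" "m > 0" "k > 0" "\<theta> = k / (m + k)"
  defines "R \<equiv> (\<theta> * b / ((1 - \<theta>) * a)) powr (1 / (m + k))"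
  shows "R > 0" "a * R powr m + b * R powr (- k) =
    a powr \<theta> * b powr (1 - \<theta>) * ((1 / \<theta>) powr \<theta> * (1 / (1 - \<theta>)) powr (1 - \<theta>))"
proof -
  note pos = assms(1-4)
  have \<theta>: "0 < \<theta>" "\<theta> < 1" and m: "m / (m + k) = 1 - \<theta>"
    unfolding assms(5) using pos by (simp_all add: field_simps)
  then show "R > 0" using pos by (simp add: R_def)
  define X where "X = \<theta> * b / ((1 - \<theta>) * a)"
  have "X > 0" using pos \<theta> by (simp add: X_def)
  have Rm: "R powr m = X powr (1 - \<theta>)" and Rk: "R powr (- k) = X powr (- \<theta>)"
  proof -
    have "1 / (m + k) * m = 1 - \<theta>" "1 / (m + k) * (- k) = - \<theta>"
      using m assms(5) by simp_all
    then show "R powr m = X powr (1 - \<theta>)" "R powr (- k) = X powr (- \<theta>)"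
      unfolding R_def X_def[symmetric] powr_powr by simp_all
  qed
  have "X powr (1 - \<theta>) = X * X powr (- \<theta>)"
    using \<open>X > 0\<close> by (simp add: powr_diff powr_minus divide_inverse)
  then have "a * R powr m + b * R powr (- k) = (a * X + b) * X powr (- \<theta>)"
    unfolding Rm Rk by (simp add: algebra_simps)
  also have "a * X + b = b / (1 - \<theta>)"
    using \<theta> pos by (simp add: X_def field_simps)
  also have "X powr (- \<theta>) = (1 - \<theta>) powr \<theta> * a powr \<theta> * ((1 / \<theta>) powr \<theta> / b powr \<theta>)"
  proof -
    have "(x * b / (c * a)) powr (- \<theta>) = c powr \<theta> * a powr \<theta> * ((1 / x) powr \<theta> / b powr \<theta>)"
      if "x > 0" "c > 0" for x c
      using that pos by (simp add: powr_minus powr_mult powr_divide)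
    then show ?thesis using \<theta> by (simp add: X_def)
  qed
  also have "b / (1 - \<theta>) * ((1 - \<theta>) powr \<theta> * a powr \<theta> * ((1 / \<theta>) powr \<theta> / b powr \<theta>))
     = a powr \<theta> * b powr (1 - \<theta>) * ((1 / \<theta>) powr \<theta> * (1 / (1 - \<theta>)) powr (1 - \<theta>))"
    using \<theta> pos by (simp add: powr_diff powr_divide field_simps)
  finally show "a * R powr m + b * R powr (- k) =
    a powr \<theta> * b powr (1 - \<theta>) * ((1 / \<theta>) powr \<theta> * (1 / (1 - \<theta>)) powr (1 - \<theta>))" .
qed

section \<open>Exponents, the constant N and the passage to roots\<close>

locale interpolation_exponents =
  fixes p :: ennreal and \<sigma> \<eta> s \<theta> :: real
  assumes p: "1 \<le> p"
    and \<sigma>: "0 \<le> \<sigma>" "\<sigma> < \<eta>" and \<eta>: "\<eta> < s" and s: "s \<le> 1"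
    and \<theta>_def: "\<theta> = (\<eta> - \<sigma>) / (s - \<sigma>)"
begin

lemma \<theta>: "0 < \<theta>" "\<theta> < 1" "\<eta> = \<theta> * s + (1 - \<theta>) * \<sigma>"
proof -
  show "0 < \<theta>" "\<theta> < 1" using \<sigma> \<eta> by (auto simp: \<theta>_def)
  have "\<theta> * (s - \<sigma>) = \<eta> - \<sigma>" using \<sigma> \<eta> by (simp add: \<theta>_def)
  then show "\<eta> = \<theta> * s + (1 - \<theta>) * \<sigma>" by (simp add: algebra_simps)
qed

lemma one_minus_\<theta>: "(s - \<eta>) / (s - \<sigma>) = 1 - \<theta>"
  using \<sigma> \<eta> by (simp add: \<theta>_def field_simps)

lemma rcp_nonneg: "0 \<le> rcp p"
  by (simp add: rcp_def)

text \<open>Separates the two origins of N: the powers of 2 in the splitting, and the factor left by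
  minimising over R.\<close>

lemma N_const_eq: "N_const p \<sigma> \<eta> s = 2 powr ((1 - \<theta>) * (\<eta> + 1 - \<sigma>)) *
    ((1 / \<theta>) powr \<theta> * (1 / (1 - \<theta>)) powr (1 - \<theta>)) powr rcp p"
proof -
  have "(s - \<sigma>) / (\<eta> - \<sigma>) = 1 / \<theta>" by (simp add: \<theta>_def)
  moreover have "(s - \<sigma>) / (s - \<eta>) = 1 / (1 - \<theta>)" by (simp flip: one_minus_\<theta>)
  ultimately show ?thesis
    unfolding N_const_def one_minus_\<theta> \<theta>_def[symmetric] using \<theta>
    by (simp add: powr_mult powr_powr)
qed

lemma exponent_le_1: "(1 - \<theta>) * (\<eta> + 1 - \<sigma>) \<le> 1"
proof -
  have "\<eta> - \<sigma> = \<theta> * (s - \<sigma>)" using \<sigma> \<eta> by (simp add: \<theta>_def)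
  also have "\<dots> \<le> \<theta> * 1" using \<theta> \<sigma> s by (intro mult_left_mono) auto
  finally have "(1 - \<theta>) * (\<eta> + 1 - \<sigma>) \<le> (1 - \<theta>) * (1 + \<theta>)"
    using \<theta> by (intro mult_left_mono) auto
  also have "\<dots> = 1 - \<theta>\<^sup>2" by (simp add: algebra_simps power2_eq_square)
  finally show ?thesis using zero_le_power2[of \<theta>] by linarith
qed

text \<open>The factor dropped here is at least 1. For p = \<infinity> and \<sigma> = 0 this bound
  absorbs the constant 2^(1-\<theta>).\<close>

lemma N_const_ge_exponent: "2 powr ((1 - \<theta>) * (\<eta> + 1 - \<sigma>)) \<le> N_const p \<sigma> \<eta> s"
proof -
  have "1 \<le> (1 / \<theta>) powr \<theta>" "1 \<le> (1 / (1 - \<theta>)) powr (1 - \<theta>)"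
    using \<theta> by (intro ge_one_powr_ge_zero; simp)+
  then have "1 \<le> (1 / \<theta>) powr \<theta> * (1 / (1 - \<theta>)) powr (1 - \<theta>)"
    using mult_mono[of 1 "(1 / \<theta>) powr \<theta>" 1 "(1 / (1 - \<theta>)) powr (1 - \<theta>)"] by simp
  then have "1 \<le> ((1 / \<theta>) powr \<theta> * (1 / (1 - \<theta>)) powr (1 - \<theta>)) powr rcp p"
    using rcp_nonneg by (rule ge_one_powr_ge_zero)
  then show ?thesis
    unfolding N_const_eq by (simp add: mult_le_cancel_left1)
qed

lemma N_const_ge_1: "1 \<le> N_const p \<sigma> \<eta> s"
proof -
  have "1 \<le> 2 powr ((1 - \<theta>) * (\<eta> + 1 - \<sigma>))"
    using \<theta> \<sigma> by (intro ge_one_powr_ge_zero) auto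
  then show ?thesis using N_const_ge_exponent by linarith
qed

text \<open>Weighted AM-GM with weights \<theta> and 1-\<theta> applied to 1/\<theta> and
  1/(1-\<theta>) bounds the minimisation factor by 2; the exponent of the other power of 2 is at
  most 1 - \<theta>^2.\<close>

lemma N_const_le: "N_const p \<sigma> \<eta> s \<le> 2 powr (1 + rcp p)"
proof -
  have "(1 / \<theta>) powr \<theta> * (1 / (1 - \<theta>)) powr (1 - \<theta>) \<le> \<theta> * (1 / \<theta>) + (1 - \<theta>) * (1 / (1 - \<theta>))"
    using \<theta> by (intro Youngs_inequality_0) auto
  also have "\<dots> = 2" using \<theta> by simp
  finally have "((1 / \<theta>) powr \<theta> * (1 / (1 - \<theta>)) powr (1 - \<theta>)) powr rcp p \<le> 2 powr rcp p"
    using rcp_nonneg \<theta> by (intro powr_mono2) auto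
  moreover have "2 powr ((1 - \<theta>) * (\<eta> + 1 - \<sigma>)) \<le> 2 powr 1"
    using exponent_le_1 by (intro powr_mono) auto
  ultimately show ?thesis
    unfolding N_const_eq powr_add by (intro mult_mono) auto
qed

text \<open>For positive finite A and B, choose the minimising R. The hypotheses on A = 0 and B = 0
  cover a right side of the form 0 * \<infinity> = 0, for which the splitting gives no
  information.\<close>

lemma optimise_splitting:
  fixes E A B :: ennreal
  assumes q: "p = ennreal q" "q \<ge> 1"
    and split: "\<And>R. R > 0 \<Longrightarrow>
      E \<le> ennreal ((2 * R) powr (q * (s - \<eta>))) * A + ennreal (2 powr q * R powr (- (q * (\<eta> - \<sigma>)))) * B"
    and "A = 0 \<Longrightarrow> E = 0" "B = 0 \<Longrightarrow> E = 0"
  shows "E \<le> ennreal (N_const p \<sigma> \<eta> s powr q) * A epowr \<theta> * B epowr (1 - \<theta>)"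
proof -
  have Npos: "N_const p \<sigma> \<eta> s powr q > 0" using N_const_ge_1 by simp
  consider "A = 0 \<or> B = 0" | "A \<noteq> 0" "B \<noteq> 0" "A = \<infinity> \<or> B = \<infinity>" | "A \<noteq> 0" "B \<noteq> 0" "A \<noteq> \<infinity>" "B \<noteq> \<infinity>"
    by blast
  then show ?thesis
  proof cases
    case 1
    then show ?thesis using assms by auto
  next
    case 2
    then have "ennreal (N_const p \<sigma> \<eta> s powr q) * A epowr \<theta> * B epowr (1 - \<theta>) = \<top>"
      using Npos by (auto simp: epowr_eq_0_iff ennreal_mult_eq_top_iff)
    then show ?thesis by simp
  next
    case 3
    then obtain a b where ab: "A = ennreal a" "B = ennreal b" "a > 0" "b > 0"
      by (metis ennreal_cases infinity_ennreal_def less_eq_real_def ennreal_0)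
    define m where "m = q * (s - \<eta>)"
    define k where "k = q * (\<eta> - \<sigma>)"
    have mk: "m > 0" "k > 0" and \<theta>_mk: "\<theta> = k / (m + k)"
      using q \<sigma> \<eta> by (auto simp: m_def k_def \<theta>_def simp flip: distrib_left)
    define R where "R = (\<theta> * (2 powr q * b) / ((1 - \<theta>) * (2 powr m * a))) powr (1 / (m + k))"
    note min = two_power_sum_minimum[of "2 powr m * a" "2 powr q * b" m k \<theta>, folded R_def, OF _ _ mk \<theta>_mk]
    have "R > 0" using min(1) ab by simp
    have "E \<le> ennreal ((2 * R) powr m) * A + ennreal (2 powr q * R powr (- k)) * B"
      using split[OF \<open>R > 0\<close>] by (simp add: m_def k_def)
    also have "\<dots> = ennreal (2 powr m * a * R powr m + 2 powr q * b * R powr (- k))"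
      using ab \<open>R > 0\<close> by (simp add: powr_mult ac_simps flip: ennreal_mult ennreal_plus)
    also have "2 powr m * a * R powr m + 2 powr q * b * R powr (- k) =
      (2 powr m * a) powr \<theta> * (2 powr q * b) powr (1 - \<theta>) * ((1 / \<theta>) powr \<theta> * (1 / (1 - \<theta>)) powr (1 - \<theta>))"
      using min(2) ab by simp
    also have "\<dots> = N_const p \<sigma> \<eta> s powr q * a powr \<theta> * b powr (1 - \<theta>)"
    proof -
      have "rcp p = 1 / q"
        using q by (simp add: rcp_ennreal)
      then have "N_const p \<sigma> \<eta> s powr q = 2 powr ((1 - \<theta>) * (\<eta> + 1 - \<sigma>) * q) *
         ((1 / \<theta>) powr \<theta> * (1 / (1 - \<theta>)) powr (1 - \<theta>))"
        unfolding N_const_eq using q \<theta> by (simp add: powr_mult powr_powr)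
      \<comment> \<open>The minimum contributes 2^(m \<theta>) from the small part and
        2^(q(1-\<theta>)) from the large part; (1-\<theta>)(\<eta>-\<sigma>) = (s-\<eta>)\<theta>
        merges them into the exponent in N.\<close>
      moreover have "(1 - \<theta>) * (\<eta> + 1 - \<sigma>) * q = m * \<theta> + q * (1 - \<theta>)"
      proof -
        have "(1 - \<theta>) * (\<eta> - \<sigma>) = (s - \<eta>) * \<theta>"
          unfolding one_minus_\<theta>[symmetric] by (simp add: \<theta>_def)
        then show ?thesis unfolding m_def by (simp add: algebra_simps)
      qed
      ultimately show ?thesis
        using ab by (simp add: powr_mult powr_powr powr_add)
    qed
    finally show ?thesis
      using ab \<open>q \<ge> 1\<close> by (simp add: epowr_ennreal ennreal_mult)
  qed
qed

text \<open>Transfers one inequality for q-th powers to any family of seminorms that differ by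
  positive weights. The weights enter the constant only through w / (\<open>w\<^sub>s\<close> ^
  \<theta> \<open>w\<^sub>\<sigma>\<close> ^ (1-\<theta>)), the shape of both Upsilon
  constants.\<close>

lemma interpolation_root:
  fixes E A B :: ennreal
  assumes q: "q \<ge> 1" and N: "N > 0"
    and main: "E \<le> ennreal (N powr q) * A epowr \<theta> * B epowr (1 - \<theta>)"
    and w: "w > 0" "w\<^sub>s > 0" "w\<^sub>\<sigma> > 0"
    and M: "N * (w / (w\<^sub>s powr \<theta> * w\<^sub>\<sigma> powr (1 - \<theta>))) powr (1 / q) \<le> M"
  shows "(ennreal w * E) epowr (1 / q) \<le>
    ennreal M * ((ennreal w\<^sub>s * A) epowr (1 / q)) epowr \<theta> * ((ennreal w\<^sub>\<sigma> * B) epowr (1 / q)) epowr (1 - \<theta>)"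
proof -
  have "M > 0" using M N w by (smt (verit) divide_pos_pos mult_pos_pos powr_gt_zero)
  consider "A = 0 \<or> B = 0" | "A \<noteq> 0" "B \<noteq> 0" "A = \<infinity> \<or> B = \<infinity>" | "A \<noteq> 0" "B \<noteq> 0" "A \<noteq> \<infinity>" "B \<noteq> \<infinity>"
    by blast
  then show ?thesis
  proof cases
    case 1
    then show ?thesis using main by auto
  next
    case 2
    then have "ennreal M * ((ennreal w\<^sub>s * A) epowr (1 / q)) epowr \<theta> * ((ennreal w\<^sub>\<sigma> * B) epowr (1 / q)) epowr (1 - \<theta>) = \<top>"
      using \<open>M > 0\<close> w by (auto simp: epowr_eq_0_iff ennreal_mult_eq_top_iff ennreal_mult_top)
    then show ?thesis by simp
  next
    case 3
    then obtain a b where ab: "A = ennreal a" "B = ennreal b" "a > 0" "b > 0"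
      by (metis ennreal_cases infinity_ennreal_def less_eq_real_def ennreal_0)
    have E: "E \<le> ennreal (N powr q * a powr \<theta> * b powr (1 - \<theta>))"
      using main ab by (simp add: epowr_ennreal ennreal_mult)
    have "(ennreal w * E) epowr (1 / q) \<le> (ennreal w * ennreal (N powr q * a powr \<theta> * b powr (1 - \<theta>))) epowr (1 / q)"
      using q by (intro epowr_mono mult_left_mono E) auto
    also have "\<dots> = ennreal ((w * (N powr q * a powr \<theta> * b powr (1 - \<theta>))) powr (1 / q))"
      using w by (simp add: epowr_ennreal flip: ennreal_mult)
    also have "\<dots> \<le> ennreal (M * ((w\<^sub>s * a) powr (1 / q)) powr \<theta> * ((w\<^sub>\<sigma> * b) powr (1 / q)) powr (1 - \<theta>))"
    proof (rule ennreal_leI)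
      have "(w * (N powr q * a powr \<theta> * b powr (1 - \<theta>))) powr (1 / q)
       = N * (w / (w\<^sub>s powr \<theta> * w\<^sub>\<sigma> powr (1 - \<theta>))) powr (1 / q) *
         ((w\<^sub>s * a) powr (1 / q)) powr \<theta> * ((w\<^sub>\<sigma> * b) powr (1 / q)) powr (1 - \<theta>)"
      using w ab q N by (simp add: powr_mult powr_powr powr_divide mult.commute)
      also have "\<dots> \<le> M * ((w\<^sub>s * a) powr (1 / q)) powr \<theta> * ((w\<^sub>\<sigma> * b) powr (1 / q)) powr (1 - \<theta>)"
        using M by (intro mult_right_mono) auto
      finally show "(w * (N powr q * a powr \<theta> * b powr (1 - \<theta>))) powr (1 / q) \<le> \<dots>" .
    qed
    finally have final: "(ennreal w * E) epowr (1 / q) \<le>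
        ennreal (M * ((w\<^sub>s * a) powr (1 / q)) powr \<theta> * ((w\<^sub>\<sigma> * b) powr (1 / q)) powr (1 - \<theta>))" .
    show ?thesis
    proof -
      have "ennreal w\<^sub>s * A = ennreal (w\<^sub>s * a)" "ennreal w\<^sub>\<sigma> * B = ennreal (w\<^sub>\<sigma> * b)"
        using w ab by (simp_all add: ennreal_mult)
      then have "((ennreal w\<^sub>s * A) epowr (1 / q)) epowr \<theta> = ennreal (((w\<^sub>s * a) powr (1 / q)) powr \<theta>)"
        "((ennreal w\<^sub>\<sigma> * B) epowr (1 / q)) epowr (1 - \<theta>) = ennreal (((w\<^sub>\<sigma> * b) powr (1 / q)) powr (1 - \<theta>))"
        using w ab by (simp_all add: epowr_ennreal)
      then show ?thesis
        using final \<open>M > 0\<close> by (simp add: ennreal_mult)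
    qed
  qed
qed

end

section \<open>The splitting for finite exponents\<close>

lemma K_const_pos:
  assumes "d > 0" "p \<ge> 1"
  shows "K_const d p > 0"
  using assms unfolding K_const_def by (intro divide_pos_pos mult_pos_pos Gamma_real_pos) auto

lemma ennreal_mult_assoc: "x \<ge> 0 \<Longrightarrow> ennreal x * (ennreal y * J) = ennreal (x * y) * J"
  by (simp add: ennreal_mult' mult.assoc)

text \<open>The case s = 1 enters only through \<open>gradient_small\<close>, which keeps the
  splitting argument free of weak derivatives.\<close>

locale sobolev_interpolation = interpolation_exponents +
  fixes \<Omega> :: "'a::euclidean_space set" and u u' :: "'a \<Rightarrow> real" and q :: real
  assumes q: "p = ennreal q" "q \<ge> 1"
    and \<Omega>_borel [measurable]: "\<Omega> \<in> sets borel"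
    and cone: "\<And>h. h \<in> translation_cone \<Omega> \<or> - h \<in> translation_cone \<Omega>"
    and u'_borel [measurable]: "u' \<in> borel_measurable borel"
    and ae: "AE x in lborel. u x = u' x"
    and gradient_small: "\<And>a R. 0 < a \<Longrightarrow> a \<le> q \<Longrightarrow> 0 < R \<Longrightarrow>
      (\<integral>\<^sup>+h. increment_pow \<Omega> q u' h * radial_weight (q - a) h * indicator {h. norm h \<le> R} h \<partial>lborel)
      \<le> ennreal (R powr a / a * (K_const DIM('a) q * sphere_area DIM('a))) * grad_pow \<Omega> q u"
begin

abbreviation V :: "'a \<Rightarrow> ennreal" where "V \<equiv> increment_pow \<Omega> q u'"

abbreviation weight :: "real \<Rightarrow> 'a \<Rightarrow> ennreal" where
  "weight t h \<equiv> radial_weight (t * q) h"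

lemma V_measurable [measurable]: "V \<in> borel_measurable borel"
  by measurable

lemma renorm_pow_eq:
  assumes "0 < t" "t < 1"
  shows "renorm_pow \<Omega> t q u = ennreal (t * (1 - t)) * (\<integral>\<^sup>+h. V h * weight t h \<partial>lborel)"
  using assms gagliardo_pow_eq_increment_pow[OF \<Omega>_borel u'_borel ae, of t q] by (simp add: renorm_pow_def)

lemma Lp_pow_eq: "Lp_pow \<Omega> q u = (\<integral>\<^sup>+x. ennreal (\<bar>u' x\<bar> powr q) * indicator \<Omega> x \<partial>lborel)"
  unfolding Lp_pow_def nn_integral_lebesgue_on[OF \<Omega>_borel]
  using ae by (intro nn_integral_cong_AE) (auto elim!: eventually_mono)

text \<open>For s < 1 the bound on small increments is multiplied by \<eta>/q, and the resulting
  \<eta>(1-s) is at most s(1-s). For s = 1 the factor 1-\<eta> cancels the pole of the gradient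
  bound.\<close>

lemma small_part:
  assumes "R > 0"
  shows "ennreal (\<eta> * (1 - \<eta>)) * (\<integral>\<^sup>+h. V h * weight \<eta> h * indicator {h. norm h \<le> R} h \<partial>lborel)
    \<le> ennreal ((2 * R) powr (q * (s - \<eta>))) * renorm_pow \<Omega> s q u"
proof (cases "s = 1")
  case False
  then have "s < 1" using s by simp
  have "0 < \<eta>" "\<eta> < 1" "0 < s" using \<sigma> \<eta> s by auto
  let ?S = "\<integral>\<^sup>+h. V h * weight \<eta> h * indicator {h. norm h \<le> R} h \<partial>lborel"
  let ?J = "\<integral>\<^sup>+h. V h * weight s h \<partial>lborel"
  have e: "q - q * (1 - t) = t * q" for t
    by (simp add: algebra_simps)
  have *: "ennreal (q * (1 - \<eta>)) * ?S \<le> ennreal ((2 * R) powr (q * (1 - \<eta>) - q * (1 - s)) * (q * (1 - s))) * ?J"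
    using small_increments_bound[of V q "q * (1 - s)" "q * (1 - \<eta>)" R, OF V_measurable
        increment_pow_doubling[OF \<Omega>_borel u'_borel cone q(2)]] \<open>s < 1\<close> \<eta> q \<open>R > 0\<close>
    unfolding e by simp
  have "ennreal (\<eta> * (1 - \<eta>)) * ?S = ennreal (\<eta> / q) * (ennreal (q * (1 - \<eta>)) * ?S)"
    using q \<open>0 < \<eta>\<close> \<open>\<eta> < 1\<close> by (simp add: mult.assoc[symmetric] ennreal_mult[symmetric])
  also have "\<dots> \<le> ennreal (\<eta> / q) * (ennreal ((2 * R) powr (q * (1 - \<eta>) - q * (1 - s)) * (q * (1 - s))) * ?J)"
    by (rule mult_left_mono[OF *]) simp
  also have "\<dots> = ennreal ((2 * R) powr (q * (s - \<eta>)) * (\<eta> * (1 - s))) * ?J"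
  proof -
    have eq: "\<eta> / q * ((2 * R) powr (q * (1 - \<eta>) - q * (1 - s)) * (q * (1 - s))) = (2 * R) powr (q * (s - \<eta>)) * (\<eta> * (1 - s))"
      using q by (simp add: algebra_simps)
    have "0 \<le> \<eta> / q" using q \<open>0 < \<eta>\<close> by simp
    then show ?thesis by (simp only: ennreal_mult_assoc eq)
  qed
  also have "\<dots> \<le> ennreal ((2 * R) powr (q * (s - \<eta>)) * (s * (1 - s))) * ?J"
    using \<eta> s by (intro mult_right_mono ennreal_leI mult_left_mono) auto
  also have "\<dots> = ennreal ((2 * R) powr (q * (s - \<eta>))) * renorm_pow \<Omega> s q u"
    using \<open>s < 1\<close> \<open>0 < s\<close> by (simp add: renorm_pow_eq ennreal_mult mult.assoc)
  finally show ?thesis .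
next
  case True
  have "0 < \<eta>" "\<eta> < 1" using \<sigma> \<eta> s by auto
  define c where "c = K_const DIM('a) q * sphere_area DIM('a)"
  have "c > 0" using q by (simp add: c_def K_const_pos sphere_area_pos)
  have e: "q - q * (1 - \<eta>) = \<eta> * q"
    by (simp add: algebra_simps)
  have "(\<integral>\<^sup>+h. V h * weight \<eta> h * indicator {h. norm h \<le> R} h \<partial>lborel)
     \<le> ennreal (R powr (q * (1 - \<eta>)) / (q * (1 - \<eta>)) * c) * grad_pow \<Omega> q u"
    using gradient_small[of "q * (1 - \<eta>)" R] q \<open>0 < \<eta>\<close> \<open>\<eta> < 1\<close> \<open>R > 0\<close>
    unfolding e c_def by simp
  then have "ennreal (\<eta> * (1 - \<eta>)) * (\<integral>\<^sup>+h. V h * weight \<eta> h * indicator {h. norm h \<le> R} h \<partial>lborel)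
     \<le> ennreal (\<eta> * (1 - \<eta>)) * (ennreal (R powr (q * (1 - \<eta>)) / (q * (1 - \<eta>)) * c) * grad_pow \<Omega> q u)"
    by (rule mult_left_mono) simp
  also have "\<dots> = ennreal (\<eta> * (1 - \<eta>) * (R powr (q * (1 - \<eta>)) / (q * (1 - \<eta>)) * c)) * grad_pow \<Omega> q u"
    using q \<open>0 < \<eta>\<close> \<open>\<eta> < 1\<close> \<open>c > 0\<close> by (subst ennreal_mult) (auto simp: mult.assoc)
  also have "\<dots> \<le> ennreal ((2 * R) powr (q * (s - \<eta>)) * (c / q)) * grad_pow \<Omega> q u"
  proof (intro mult_right_mono ennreal_leI)
    have "\<eta> * (1 - \<eta>) * (R powr (q * (1 - \<eta>)) / (q * (1 - \<eta>)) * c) = \<eta> * (R powr (q * (1 - \<eta>)) * (c / q))"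
      using q \<open>\<eta> < 1\<close> by simp
    also have "\<dots> \<le> 1 * ((2 * R) powr (q * (1 - \<eta>)) * (c / q))"
      using q \<open>0 < \<eta>\<close> \<open>\<eta> < 1\<close> \<open>c > 0\<close> \<open>R > 0\<close> by (intro mult_mono powr_mono2) auto
    finally show "\<eta> * (1 - \<eta>) * (R powr (q * (1 - \<eta>)) / (q * (1 - \<eta>)) * c) \<le> (2 * R) powr (q * (s - \<eta>)) * (c / q)"
      using True by simp
  qed simp
  also have "\<dots> = ennreal ((2 * R) powr (q * (s - \<eta>))) * renorm_pow \<Omega> s q u"
    using True q by (simp add: renorm_pow_def c_def ennreal_mult_assoc)
  finally show ?thesis .
qed

text \<open>For \<sigma> > 0 the bound on large increments is multiplied by (1-\<eta>)/q, and
  \<sigma>(1-\<eta>) is at most \<sigma>(1-\<sigma>). For \<sigma> = 0 the explicit tail of the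
  weight has a pole 1/\<eta>, which the factor \<eta> cancels.\<close>

lemma large_part:
  assumes "R > 0"
  shows "ennreal (\<eta> * (1 - \<eta>)) * (\<integral>\<^sup>+h. V h * weight \<eta> h * indicator {h. R < norm h} h \<partial>lborel)
    \<le> ennreal (2 powr q * R powr (- (q * (\<eta> - \<sigma>)))) * renorm_pow \<Omega> \<sigma> q u"
proof (cases "\<sigma> = 0")
  case False
  then have pos: "0 < \<sigma>" "0 < \<eta>" "\<eta> < 1" "\<sigma> < 1" using \<sigma> \<eta> s by auto
  let ?L = "\<integral>\<^sup>+h. V h * weight \<eta> h * indicator {h. R < norm h} h \<partial>lborel"
  let ?J = "\<integral>\<^sup>+h. V h * weight \<sigma> h \<partial>lborel"
  have *: "ennreal (\<eta> * q) * ?L \<le> ennreal (2 powr q * R powr (\<sigma> * q - \<eta> * q) * (\<sigma> * q)) * ?J"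
    using large_increments_bound[of V q "\<sigma> * q" "\<eta> * q" R, OF V_measurable
        increment_pow_dilate[OF \<Omega>_borel u'_borel cone q(2)]] pos q \<sigma> \<open>R > 0\<close>
    by simp
  have "ennreal (\<eta> * (1 - \<eta>)) * ?L = ennreal ((1 - \<eta>) / q) * (ennreal (\<eta> * q) * ?L)"
    using q pos by (subst ennreal_mult_assoc) (simp_all add: mult.commute)
  also have "\<dots> \<le> ennreal ((1 - \<eta>) / q) * (ennreal (2 powr q * R powr (\<sigma> * q - \<eta> * q) * (\<sigma> * q)) * ?J)"
    by (rule mult_left_mono[OF *]) simp
  also have "\<dots> = ennreal (2 powr q * R powr (- (q * (\<eta> - \<sigma>))) * (\<sigma> * (1 - \<eta>))) * ?J"
  proof -
    have eq: "(1 - \<eta>) / q * (2 powr q * R powr (\<sigma> * q - \<eta> * q) * (\<sigma> * q)) = 2 powr q * R powr (- (q * (\<eta> - \<sigma>))) * (\<sigma> * (1 - \<eta>))"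
    proof -
      have "\<sigma> * q - \<eta> * q = - (q * (\<eta> - \<sigma>))" by (simp add: algebra_simps)
      then show ?thesis using q by simp
    qed
    have "0 \<le> (1 - \<eta>) / q" using q pos by simp
    then show ?thesis by (simp only: ennreal_mult_assoc eq)
  qed
  also have "\<dots> \<le> ennreal (2 powr q * R powr (- (q * (\<eta> - \<sigma>))) * (\<sigma> * (1 - \<sigma>))) * ?J"
    using \<sigma> pos by (intro mult_right_mono ennreal_leI mult_left_mono) auto
  also have "\<dots> = ennreal (2 powr q * R powr (- (q * (\<eta> - \<sigma>)))) * renorm_pow \<Omega> \<sigma> q u"
    using pos by (simp add: renorm_pow_eq ennreal_mult mult.assoc)
  finally show ?thesis .
next
  case True
  have pos: "0 < \<eta>" "\<eta> < 1" using \<sigma> \<eta> s by auto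
  define S where "S = sphere_area DIM('a)"
  have "S > 0" by (simp add: S_def sphere_area_pos)
  let ?u = "Lp_pow \<Omega> q u"
  have "(\<integral>\<^sup>+h. V h * weight \<eta> h * indicator {h. R < norm h} h \<partial>lborel)
     \<le> (\<integral>\<^sup>+h. ennreal (2 powr q) * ?u * (weight \<eta> h * indicator {h. R < norm h} h) \<partial>lborel)"
    using increment_pow_le_norm[OF \<Omega>_borel u'_borel q(2)]
    by (intro nn_integral_mono) (auto simp: Lp_pow_eq mult.assoc[symmetric] split: split_indicator intro!: mult_right_mono)
  also have "\<dots> = ennreal (2 powr q) * ?u * ennreal (S * R powr (- (\<eta> * q)) / (\<eta> * q))"
    using nn_integral_norm_powr_tail[where 'a = 'a, of "\<eta> * q" R] pos q \<open>R > 0\<close>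
    by (simp add: nn_integral_cmult S_def)
  finally have "ennreal (\<eta> * (1 - \<eta>)) * (\<integral>\<^sup>+h. V h * weight \<eta> h * indicator {h. R < norm h} h \<partial>lborel)
     \<le> ennreal (\<eta> * (1 - \<eta>)) * \<dots>"
    by (rule mult_left_mono) simp
  also have "\<dots> = ennreal (\<eta> * (1 - \<eta>) * (2 powr q * (S * R powr (- (\<eta> * q)) / (\<eta> * q)))) * ?u"
    using pos q \<open>S > 0\<close> by (simp add: ennreal_mult ac_simps del: times_divide_eq_right times_divide_eq_left)
  also have "\<dots> \<le> ennreal (2 powr q * R powr (- (q * (\<eta> - \<sigma>))) * (2 * S / q)) * ?u"
  proof (intro mult_right_mono ennreal_leI)
    have "\<eta> * (1 - \<eta>) * (2 powr q * (S * R powr (- (\<eta> * q)) / (\<eta> * q))) = (1 - \<eta>) * (2 powr q * R powr (- (q * (\<eta> - \<sigma>))) * (S / q))"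
      using pos True by (simp add: mult.commute)
    also have "\<dots> \<le> 2 * (2 powr q * R powr (- (q * (\<eta> - \<sigma>))) * (S / q))"
      using pos q \<open>S > 0\<close> by (intro mult_right_mono) auto
    finally show "\<eta> * (1 - \<eta>) * (2 powr q * (S * R powr (- (\<eta> * q)) / (\<eta> * q))) \<le> 2 powr q * R powr (- (q * (\<eta> - \<sigma>))) * (2 * S / q)"
      by (simp only: mult_ac times_divide_eq_right times_divide_eq_left)
  qed simp
  also have "\<dots> = ennreal (2 powr q * R powr (- (q * (\<eta> - \<sigma>)))) * renorm_pow \<Omega> \<sigma> q u"
    using True q by (simp add: renorm_pow_def S_def ennreal_mult_assoc)
  finally show ?thesis .
qed

lemma renorm_pow_interpolation:
  "renorm_pow \<Omega> \<eta> q u \<le> ennreal (N_const p \<sigma> \<eta> s powr q) * renorm_pow \<Omega> s q u epowr \<theta> * renorm_pow \<Omega> \<sigma> q u epowr (1 - \<theta>)"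
proof (rule optimise_splitting[OF q])
  have pos: "0 < \<eta>" "\<eta> < 1" using \<sigma> \<eta> s by auto
  then have c: "ennreal (\<eta> * (1 - \<eta>)) \<noteq> 0" by simp
  note E = renorm_pow_eq[OF pos]
  let ?V = "\<lambda>h. V h * weight \<eta> h"
  fix R :: real assume "R > 0"
  have "(\<integral>\<^sup>+h. ?V h \<partial>lborel) = (\<integral>\<^sup>+h. ?V h * indicator {h. norm h \<le> R} h + ?V h * indicator {h. R < norm h} h \<partial>lborel)"
    by (intro nn_integral_cong) (auto split: split_indicator)
  also have "\<dots> = (\<integral>\<^sup>+h. ?V h * indicator {h. norm h \<le> R} h \<partial>lborel) + (\<integral>\<^sup>+h. ?V h * indicator {h. R < norm h} h \<partial>lborel)"
    by (intro nn_integral_add) auto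
  finally have "renorm_pow \<Omega> \<eta> q u = ennreal (\<eta> * (1 - \<eta>)) * (\<integral>\<^sup>+h. ?V h * indicator {h. norm h \<le> R} h \<partial>lborel)
     + ennreal (\<eta> * (1 - \<eta>)) * (\<integral>\<^sup>+h. ?V h * indicator {h. R < norm h} h \<partial>lborel)"
    unfolding E by (simp add: distrib_left)
  then show "renorm_pow \<Omega> \<eta> q u \<le> ennreal ((2 * R) powr (q * (s - \<eta>))) * renorm_pow \<Omega> s q u +
      ennreal (2 powr q * R powr (- (q * (\<eta> - \<sigma>)))) * renorm_pow \<Omega> \<sigma> q u"
    using small_part[OF \<open>R > 0\<close>] large_part[OF \<open>R > 0\<close>] by (auto intro: add_mono)
next
  have pos: "0 < \<eta>" "\<eta> < 1" using \<sigma> \<eta> s by auto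
  then have c: "ennreal (\<eta> * (1 - \<eta>)) \<noteq> 0" by simp
  let ?V = "\<lambda>h. V h * weight \<eta> h"
  have zero: "renorm_pow \<Omega> \<eta> q u = 0" if "AE h in lborel. ?V h = 0"
    using that by (simp add: renorm_pow_eq[OF pos] nn_integral_0_iff_AE)
  {
    \<comment> \<open>The small part vanishes for every radius, even if the seminorm of order
      \<sigma> is infinite, and balls of integer radius exhaust the space.\<close>
    assume "renorm_pow \<Omega> s q u = 0"
    then have "AE h in lborel. ?V h * indicator {h. norm h \<le> real (Suc n)} h = 0" for n
      using small_part[of "real (Suc n)"] c by (simp add: nn_integral_0_iff_AE)
    then have "AE h in lborel. \<forall>n::nat. ?V h * indicator {h. norm h \<le> real (Suc n)} h = 0"
      unfolding AE_all_countable by blast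
    then have "AE h in lborel. ?V h = 0"
    proof eventually_elim
      case (elim h)
      obtain n where "norm h \<le> real n" using real_arch_simple by blast
      then have "norm h \<le> real (Suc n)" by simp
      with spec[OF elim, of n] show ?case by (simp only: indicator_simps mem_Collect_eq mult_1_right)
    qed
    then show "renorm_pow \<Omega> \<eta> q u = 0" by (rule zero)
  next
    \<comment> \<open>Dually, the large part vanishes for every radius. Radii 1/(n+1) exhaust the
      complement of 0, where the weight is 0 anyway.\<close>
    assume "renorm_pow \<Omega> \<sigma> q u = 0"
    then have "AE h in lborel. ?V h * indicator {h. 1 / real (Suc n) < norm h} h = 0" for n
      using large_part[of "1 / real (Suc n)"] c by (simp add: nn_integral_0_iff_AE)
    then have "AE h in lborel. \<forall>n::nat. ?V h * indicator {h. 1 / real (Suc n) < norm h} h = 0"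
      unfolding AE_all_countable by blast
    then have "AE h in lborel. ?V h = 0"
    proof eventually_elim
      case (elim h)
      show ?case
      proof (cases "h = 0")
        case False
        then obtain n where "1 / real (Suc n) < norm h"
          using nat_approx_posE[of "norm h"] by auto
        with spec[OF elim, of n] show ?thesis by (simp only: indicator_simps mem_Collect_eq mult_1_right)
      qed simp
    qed
    then show "renorm_pow \<Omega> \<eta> q u = 0" by (rule zero)
  }
qed

end

section \<open>Test functions\<close>

text \<open>One-variable counterpart of \<open>Ck\<close>. Asking for some derivative function lets
  explicit formulas serve as witnesses in inductions on k.\<close>

primrec smooth1 :: "nat \<Rightarrow> (real \<Rightarrow> real) \<Rightarrow> bool" where
  "smooth1 0 F \<longleftrightarrow> continuous_on UNIV F"
| "smooth1 (Suc k) F \<longleftrightarrow> (\<exists>F'. (\<forall>x. (F has_real_derivative F' x) (at x)) \<and> smooth1 k F')"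

lemma smooth1_SucD: "smooth1 (Suc k) F \<Longrightarrow> smooth1 k F"
proof (induction k arbitrary: F)
  case 0
  then obtain F' where "\<And>x. (F has_real_derivative F' x) (at x)" by auto
  then have "isCont F x" for x by (rule DERIV_isCont)
  then show ?case by (simp add: continuous_at_imp_continuous_on)
next
  case (Suc k)
  then show ?case by (metis smooth1.simps(2))
qed

lemma smooth1_const: "smooth1 k (\<lambda>_. c)"
proof (induction k arbitrary: c)
  case (Suc k)
  then show ?case by (auto intro!: exI[of _ "\<lambda>_. 0"])
qed simp

lemma smooth1_add: "smooth1 k F \<Longrightarrow> smooth1 k G \<Longrightarrow> smooth1 k (\<lambda>x. F x + G x)"
proof (induction k arbitrary: F G)
  case (Suc k)
  then obtain F' G' where "\<And>x. (F has_real_derivative F' x) (at x)" "\<And>x. (G has_real_derivative G' x) (at x)"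
    "smooth1 k F'" "smooth1 k G'" by auto
  then show ?case
    by (auto intro!: exI[of _ "\<lambda>x. F' x + G' x"] DERIV_add Suc.IH)
qed (auto intro: continuous_intros)

lemma smooth1_mult: "smooth1 k F \<Longrightarrow> smooth1 k G \<Longrightarrow> smooth1 k (\<lambda>x. F x * G x)"
proof (induction k arbitrary: F G)
  case (Suc k)
  then obtain F' G' where *: "\<And>x. (F has_real_derivative F' x) (at x)" "\<And>x. (G has_real_derivative G' x) (at x)"
    "smooth1 k F'" "smooth1 k G'" by auto
  have "smooth1 k (\<lambda>x. F' x * G x + G' x * F x)"
    using Suc.prems * by (intro smooth1_add Suc.IH) (auto dest: smooth1_SucD simp del: smooth1.simps)
  then show ?case
    using * by (auto intro!: exI[of _ "\<lambda>x. F' x * G x + G' x * F x"] DERIV_mult)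
qed (auto intro: continuous_intros)

lemma smooth1_affine: "smooth1 k F \<Longrightarrow> smooth1 k (\<lambda>x. F (c * x + d))"
proof (induction k arbitrary: F)
  case 0
  then show ?case
    using continuous_on_compose2[of UNIV F UNIV "\<lambda>x. c * x + d"]
    by (simp add: continuous_intros)
next
  case (Suc k)
  then obtain F' where *: "\<And>x. (F has_real_derivative F' x) (at x)" "smooth1 k F'" by auto
  have deriv: "((\<lambda>x. F (c * x + d)) has_real_derivative F' (c * x + d) * c) (at x)" for x
  proof (rule DERIV_chain2[OF *(1)])
    show "((\<lambda>x. c * x + d) has_real_derivative c) (at x)"
      by (auto intro!: derivative_eq_intros)
  qed
  have smooth: "smooth1 k (\<lambda>x. F' (c * x + d) * c)"
    by (rule smooth1_mult[OF Suc.IH[OF *(2)] smooth1_const])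
  show ?case
    unfolding smooth1.simps by (intro exI[of _ "\<lambda>x. F' (c * x + d) * c"] conjI allI deriv smooth)
qed

section \<open>The flat exponential and bump functions on boxes\<close>

definition flat_exp :: "real \<Rightarrow> real" where
  "flat_exp x = (if x > 0 then exp (- 1 / x) else 0)"

lemma poly_exp_tendsto_0:
  fixes P :: "real poly"
  shows "((\<lambda>y. poly P y * exp (- y)) \<longlongrightarrow> 0) at_top"
proof -
  have "((\<lambda>y. \<Sum>i\<le>degree P. coeff P i * (y ^ i / exp y)) \<longlongrightarrow> (\<Sum>i\<le>degree P. coeff P i * 0)) at_top"
    by (intro tendsto_sum tendsto_mult tendsto_const tendsto_power_div_exp_0)
  then show ?thesis
    by (simp add: poly_altdef sum_distrib_right exp_minus divide_inverse mult.assoc)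
qed

text \<open>Generalising over the polynomial closes the induction: differentiating P(1/x) exp(-1/x)
  gives the same form with polynomial X^2 (P - P').\<close>

lemma smooth1_poly_flat:
  fixes P :: "real poly"
  shows "smooth1 k (\<lambda>x. if x > 0 then poly P (1 / x) * exp (- 1 / x) else 0)"
proof (induction k arbitrary: P)
  have lim: "((\<lambda>x. poly P (1 / x) * exp (- 1 / x)) \<longlongrightarrow> 0) (at_right 0)" for P :: "real poly"
    using filterlim_compose[OF poly_exp_tendsto_0[of P] filterlim_inverse_at_top_right]
    by (simp add: divide_inverse)
  have deriv: "((\<lambda>x. if x > 0 then poly P (1 / x) * exp (- 1 / x) else 0) has_real_derivative
      (if x > 0 then poly ([:0, 0, 1:] * (P - pderiv P)) (1 / x) * exp (- 1 / x) else 0)) (at x)"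
    for P :: "real poly" and x
  proof -
    consider "x > 0" | "x < 0" | "x = 0" by linarith
    then show ?thesis
    proof cases
      case 1
      have "((\<lambda>x. poly P (1 / x) * exp (- 1 / x)) has_real_derivative
         poly ([:0, 0, 1:] * (P - pderiv P)) (1 / x) * exp (- 1 / x)) (at x)"
        using 1 by (auto intro!: derivative_eq_intros DERIV_chain2[OF poly_DERIV] simp: field_simps power2_eq_square)
      then have "((\<lambda>x. if x > 0 then poly P (1 / x) * exp (- 1 / x) else 0) has_real_derivative
         poly ([:0, 0, 1:] * (P - pderiv P)) (1 / x) * exp (- 1 / x)) (at x)"
        by (rule has_field_derivative_transform_within_open[where S = "{0<..}"]) (use 1 in auto)
      then show ?thesis using 1 by simp
    next
      case 2
      have "((\<lambda>x. if x > 0 then poly P (1 / x) * exp (- 1 / x) else 0) has_real_derivative 0) (at x)"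
        using 2 by (intro has_field_derivative_transform_within_open[OF DERIV_const, where S = "{..<0}"]) auto
      then show ?thesis using 2 by simp
    next
      case 3
      have "((\<lambda>y. (if y > 0 then poly P (1 / y) * exp (- 1 / y) else 0) / y) \<longlongrightarrow> 0) (at (0::real))"
      proof (rule filterlim_split_at)
        have "((\<lambda>_. 0) \<longlongrightarrow> (0::real)) (at_left (0::real))" by simp
        then show "((\<lambda>y. (if y > 0 then poly P (1 / y) * exp (- 1 / y) else 0) / y) \<longlongrightarrow> 0) (at_left (0::real))"
          by (rule Lim_transform_eventually) (auto simp: eventually_at_filter)
        \<comment> \<open>To the right of 0 the difference quotient is of the same form with
          polynomial X P, so the limit already established applies.\<close>
        show "((\<lambda>y. (if y > 0 then poly P (1 / y) * exp (- 1 / y) else 0) / y) \<longlongrightarrow> 0) (at_right (0::real))"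
          by (rule Lim_transform_eventually[OF lim[of "[:0, 1:] * P"]]) (auto simp: eventually_at_filter)
      qed
      then show ?thesis using 3 by (simp add: has_field_derivative_iff)
    qed
  qed
  {
    case 0
    show ?case
      using DERIV_isCont[OF deriv[of P]] by (simp add: continuous_at_imp_continuous_on)
  next
    case (Suc k)
    show ?case
      unfolding smooth1.simps
      by (intro exI[of _ "\<lambda>x. if x > 0 then poly ([:0, 0, 1:] * (P - pderiv P)) (1 / x) * exp (- 1 / x) else 0"]
          conjI allI deriv Suc)
  }
qed

lemma smooth1_flat_exp: "smooth1 k flat_exp"
proof -
  have "flat_exp = (\<lambda>x. if x > 0 then poly 1 (1 / x) * exp (- 1 / x) else 0)"
    by (auto simp: flat_exp_def fun_eq_iff)
  then show ?thesis using smooth1_poly_flat[of k 1] by simp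
qed

text \<open>A partial derivative of a product of one-variable functions replaces one factor by its
  derivative, so the product form reproduces itself.\<close>

lemma Ck_prod_smooth1:
  fixes F :: "'a::euclidean_space \<Rightarrow> real \<Rightarrow> real"
  shows "(\<And>b. b \<in> Basis \<Longrightarrow> smooth1 k (F b)) \<Longrightarrow> Ck k (\<lambda>x. \<Prod>b\<in>Basis. F b (x \<bullet> b))"
proof (induction k arbitrary: F)
  case 0
  have "continuous_on UNIV (\<lambda>x::'a. F b (x \<bullet> b))" if "b \<in> Basis" for b
    using 0[OF that] continuous_on_compose2[of UNIV "F b" UNIV "\<lambda>x. x \<bullet> b"]
    by (simp add: continuous_intros)
  then show ?case
    by (simp add: continuous_on_prod)
next
  case (Suc k)
  have "\<forall>b. \<exists>F'. b \<in> Basis \<longrightarrow> (\<forall>x. (F b has_real_derivative F' x) (at x)) \<and> smooth1 k F'"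
    using Suc.prems by (auto simp: Ball_def)
  then obtain F' where F': "\<And>b x. b \<in> Basis \<Longrightarrow> (F b has_real_derivative F' b x) (at x)"
    "\<And>b. b \<in> Basis \<Longrightarrow> smooth1 k (F' b)"
    by metis
  have deriv: "((\<lambda>x. \<Prod>b\<in>Basis. F b (x \<bullet> b)) has_derivative
      (\<lambda>y. \<Sum>b\<in>Basis. (F' b (x \<bullet> b) * (y \<bullet> b)) * (\<Prod>j\<in>Basis - {b}. F j (x \<bullet> j)))) (at x)" for x :: 'a
  proof (rule has_derivative_prod)
    fix b :: 'a assume "b \<in> Basis"
    show "((\<lambda>x. F b (x \<bullet> b)) has_derivative (\<lambda>y. F' b (x \<bullet> b) * (y \<bullet> b))) (at x)"
    proof -
      have "((\<lambda>x. x \<bullet> b) has_derivative (\<lambda>y. y \<bullet> b)) (at x)"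
        by (auto intro!: derivative_eq_intros)
      from has_derivative_compose[OF this F'(1)[OF \<open>b \<in> Basis\<close>, unfolded has_field_derivative_def]]
      show ?thesis by simp
    qed
  qed
  have partial: "partial_deriv c (\<lambda>x. \<Prod>b\<in>Basis. F b (x \<bullet> b)) = (\<lambda>x. \<Prod>b\<in>Basis. (F(c := F' c)) b (x \<bullet> b))"
    if "c \<in> Basis" for c :: 'a
  proof
    fix x :: 'a
    have "partial_deriv c (\<lambda>x. \<Prod>b\<in>Basis. F b (x \<bullet> b)) x
       = (\<Sum>b\<in>Basis. (F' b (x \<bullet> b) * (c \<bullet> b)) * (\<Prod>j\<in>Basis - {b}. F j (x \<bullet> j)))"
      by (simp only: partial_deriv_def frechet_derivative_at[OF deriv[of x], symmetric])
    also have "\<dots> = (\<Sum>b\<in>Basis. if b = c then F' c (x \<bullet> c) * (\<Prod>j\<in>Basis - {c}. F j (x \<bullet> j)) else 0)"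
      using that by (intro sum.cong) (auto simp: inner_Basis)
    also have "\<dots> = F' c (x \<bullet> c) * (\<Prod>j\<in>Basis - {c}. F j (x \<bullet> j))"
      using that by simp
    also have "\<dots> = (\<Prod>b\<in>Basis. (F(c := F' c)) b (x \<bullet> b))"
      using that by (simp add: prod.remove[of Basis c])
    finally show "partial_deriv c (\<lambda>x. \<Prod>b\<in>Basis. F b (x \<bullet> b)) x = \<dots>" .
  qed
  have "Ck k (\<lambda>x. \<Prod>b\<in>Basis. (F(c := F' c)) b (x \<bullet> b))" if "c \<in> Basis" for c
    using that F'(2) smooth1_SucD[OF Suc.prems] by (intro Suc.IH) auto
  then show ?case
    using deriv by (auto simp: partial differentiable_def)
qed

text \<open>The index n changes only the steepness: every bump is supported on the same box, and the
  sequence tends to its indicator. Translates of bumps are again bumps.\<close>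

definition bump :: "nat \<Rightarrow> 'a::euclidean_space \<Rightarrow> 'a \<Rightarrow> 'a \<Rightarrow> real" where
  "bump n a c x = (\<Prod>b\<in>Basis. flat_exp (real (Suc n) * (x \<bullet> b - a \<bullet> b)) * flat_exp (real (Suc n) * (c \<bullet> b - x \<bullet> b)))"

lemma Ck_bump: "Ck k (bump n a c)"
proof -
  have "smooth1 k (\<lambda>y. flat_exp (real (Suc n) * (y - a \<bullet> b)) * flat_exp (real (Suc n) * (c \<bullet> b - y)))" for b
  proof -
    have "real (Suc n) * (y - a \<bullet> b) = real (Suc n) * y + - real (Suc n) * (a \<bullet> b)"
      "real (Suc n) * (c \<bullet> b - y) = - real (Suc n) * y + real (Suc n) * (c \<bullet> b)" for y
      by (simp_all only: right_diff_distrib)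
    then show ?thesis
      by (simp only:) (intro smooth1_mult smooth1_affine smooth1_flat_exp)
  qed
  then show ?thesis
    unfolding bump_def[abs_def] by (rule Ck_prod_smooth1)
qed

lemma bump_nonzero_iff: "bump n a c x \<noteq> 0 \<longleftrightarrow> x \<in> box a c"
  by (auto simp: bump_def flat_exp_def mem_box zero_less_mult_iff)

lemma test_fun_bump:
  assumes "cbox a c \<subseteq> \<Omega>"
  shows "test_fun \<Omega> (bump n a c)"
proof -
  have "closure {x. bump n a c x \<noteq> 0} \<subseteq> cbox a c"
    unfolding bump_nonzero_iff by (intro closure_minimal) (auto intro: box_subset_cbox[THEN subsetD])
  then show ?thesis
    unfolding test_fun_def using assms Ck_bump
    by (meson compact_cbox compact_closure bounded_subset bounded_cbox closure_subset order_trans)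
qed

lemma bump_bounds: "0 \<le> bump n a c x" "bump n a c x \<le> 1"
  unfolding bump_def by (auto intro!: prod_nonneg prod_le_1 mult_le_one simp: flat_exp_def)

lemma bump_tendsto_indicator: "(\<lambda>n. bump n a c x) \<longlonglongrightarrow> indicator (box a c) x"
proof (cases "x \<in> box a c")
  case True
  have lim: "(\<lambda>n. flat_exp (real (Suc n) * d)) \<longlonglongrightarrow> 1" if "d > 0" for d
  proof -
    have "(\<lambda>n. exp (- 1 / d * (1 / real (Suc n)))) \<longlonglongrightarrow> exp (- 1 / d * 0)"
      by (intro tendsto_intros LIMSEQ_Suc[OF lim_1_over_n])
    then show ?thesis
      using that by (simp add: flat_exp_def mult.commute)
  qed
  have "(\<lambda>n. bump n a c x) \<longlonglongrightarrow> (\<Prod>b\<in>(Basis::'a set). 1 * 1)"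
    unfolding bump_def using True by (intro tendsto_prod tendsto_mult lim) (auto simp: mem_box)
  with True show ?thesis by simp
next
  case False
  then have "bump n a c x = 0" for n using bump_nonzero_iff by blast
  with False show ?thesis by simp
qed

lemma bump_measurable [measurable]: "bump n a c \<in> borel_measurable borel"
  using Ck_bump[of 0 n a c] by (auto intro: borel_measurable_continuous_onI)

lemma bump_translate: "bump n a c (x - v) = bump n (a + v) (c + v) x"
  by (simp add: bump_def inner_simps algebra_simps)

lemma partial_deriv_bump_continuous: "b \<in> Basis \<Longrightarrow> continuous_on UNIV (partial_deriv b (bump n a c))"
  using Ck_bump[of "Suc 0" n a c] by simp

lemma bump_differentiable: "bump n a c differentiable (at x)"
  using Ck_bump[of "Suc 0" n a c] by simp

lemma partial_deriv_bump_outside: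
  assumes "x \<notin> cbox a c"
  shows "partial_deriv b (bump n a c) x = 0"
proof -
  have "(bump n a c has_derivative (\<lambda>_. 0)) (at x)"
  proof (rule has_derivative_transform_within_open[where s = "- cbox a c"])
    show "0 = bump n a c y" if "y \<in> - cbox a c" for y
      using that bump_nonzero_iff[of n a c y] box_subset_cbox[of a c] by auto
  qed (use assms in auto)
  then show ?thesis
    unfolding partial_deriv_def by (metis frechet_derivative_at)
qed

lemma partial_deriv_bump_bounded:
  assumes "b \<in> Basis"
  obtains C where "\<And>x. \<bar>partial_deriv b (bump n a c) x\<bar> \<le> C"
proof -
  have "compact (partial_deriv b (bump n a c) ` cbox a c)"
    by (rule compact_continuous_image[OF continuous_on_subset[OF partial_deriv_bump_continuous[OF assms] subset_UNIV]])
      simp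
  then have "bounded (partial_deriv b (bump n a c) ` cbox a c)"
    by (rule compact_imp_bounded)
  then obtain C where "\<forall>x\<in>cbox a c. \<bar>partial_deriv b (bump n a c) x\<bar> \<le> C"
    unfolding bounded_iff by auto
  then have C: "\<bar>partial_deriv b (bump n a c) x\<bar> \<le> C" if "x \<in> cbox a c" for x
    using that by blast
  have "\<bar>partial_deriv b (bump n a c) x\<bar> \<le> max C 0" for x
    using C[of x] partial_deriv_bump_outside[of x a c b n] by (cases "x \<in> cbox a c") auto
  then show ?thesis using that by blast
qed

text \<open>The truncation of \<open>ennreal\<close> at 0 makes f and -f densities of two finite
  measures, the positive and the negative part. They agree on the intersection-stable generator of
  boxes, hence everywhere.\<close>

lemma AE_zero_if_box_integrals_zero:
  fixes f :: "'a::euclidean_space \<Rightarrow> real"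
  assumes int: "integrable lborel f"
    and zero: "\<And>a c. (LINT x|lborel. indicator (box a c) x * f x) = 0"
  shows "AE x in lborel. f x = 0"
proof -
  have [measurable]: "f \<in> borel_measurable borel"
    using borel_measurable_integrable[OF int] by simp
  have fin: "(\<integral>\<^sup>+x. ennreal \<bar>f x\<bar> \<partial>lborel) < \<infinity>"
    using int by (simp add: integrable_iff_bounded)
  have fin': "(\<integral>\<^sup>+x. ennreal (g x) \<partial>lborel) < \<infinity>" if "\<And>x. g x \<le> \<bar>f x\<bar>" for g
    using le_less_trans[OF nn_integral_mono fin, of "\<lambda>x. ennreal (g x)"] that by (auto intro: ennreal_leI)
  have "density lborel (\<lambda>x. ennreal (f x)) = density lborel (\<lambda>x. ennreal (- f x))"
  proof (rule measure_eqI_generator_eq)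
    let ?E = "range (\<lambda>(a, b). box a b::'a set)"
    show "Int_stable ?E"
      by (auto simp: Int_stable_def box_Int_box)
    show "?E \<subseteq> Pow UNIV" "sets (density lborel (\<lambda>x. ennreal (f x))) = sigma_sets UNIV ?E"
      "sets (density lborel (\<lambda>x. ennreal (- f x))) = sigma_sets UNIV ?E"
      by (simp_all add: borel_eq_box)
    let ?A = "\<lambda>n::nat. box (- (real n *\<^sub>R One)) (real n *\<^sub>R One) :: 'a set"
    show "range ?A \<subseteq> ?E" "(\<Union>i. ?A i) = UNIV"
      unfolding UN_box_eq_UNIV by auto
    have le: "(\<integral>\<^sup>+x. ennreal (g x) * indicator A x \<partial>lborel) < \<infinity>" if "\<And>x. g x \<le> \<bar>f x\<bar>" for g A
      using le_less_trans[OF nn_integral_mono fin'[OF that], of "\<lambda>x. ennreal (g x) * indicator A x"]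
      by (auto simp: indicator_def)
    show "emeasure (density lborel (\<lambda>x. ennreal (f x))) (?A i) \<noteq> \<infinity>" for i
      using le[of f] by (subst emeasure_density) (auto simp: less_top)
    fix X assume "X \<in> ?E"
    then obtain a c where X: "X = box a c" by auto
    have "integrable lborel (\<lambda>x. indicator X x * f x)"
      using integrable_mult_indicator[OF _ int, of X] by (simp add: X)
    then have "0 = enn2real (\<integral>\<^sup>+x. ennreal (indicator X x * f x) \<partial>lborel) - enn2real (\<integral>\<^sup>+x. ennreal (- (indicator X x * f x)) \<partial>lborel)"
      using zero[of a c] by (simp add: X real_lebesgue_integral_def)
    moreover have "ennreal (indicator X x * f x) = ennreal (f x) * indicator X x"
      "ennreal (- (indicator X x * f x)) = ennreal (- f x) * indicator X x" for x
      by (auto simp: indicator_def)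
    ultimately have "enn2real (\<integral>\<^sup>+x. ennreal (f x) * indicator X x \<partial>lborel) = enn2real (\<integral>\<^sup>+x. ennreal (- f x) * indicator X x \<partial>lborel)"
      by simp
    then have "(\<integral>\<^sup>+x. ennreal (f x) * indicator X x \<partial>lborel) = (\<integral>\<^sup>+x. ennreal (- f x) * indicator X x \<partial>lborel)"
      using le[of f X] le[of "\<lambda>x. - f x" X] by (metis abs_ge_self abs_minus_cancel ennreal_enn2real infinity_ennreal_def)
    then show "emeasure (density lborel (\<lambda>x. ennreal (f x))) X = emeasure (density lborel (\<lambda>x. ennreal (- f x))) X"
      by (simp add: X emeasure_density)
  qed
  \<comment> \<open>At each point one of f x and -f x is nonpositive and becomes 0, so equality
    forces f x = 0.\<close>
  then have "AE x in lborel. ennreal (f x) = ennreal (- f x)"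
    using fin'[of f, OF abs_ge_self] by (subst (asm) finite_density_unique) auto
  then show ?thesis
  proof eventually_elim
    case (elim x)
    then show ?case by (cases "f x \<ge> 0") (auto simp: ennreal_neg ennreal_eq_0_iff)
  qed
qed

section \<open>Increments and weak gradients\<close>

lemma integral_lborel_shift:
  fixes f :: "'a::euclidean_space \<Rightarrow> real"
  assumes [measurable]: "f \<in> borel_measurable borel"
  shows "(LINT x|lborel. f (x + c)) = (LINT x|lborel. f x)"
    and "integrable lborel (\<lambda>x. f (x + c)) \<longleftrightarrow> integrable lborel f"
proof -
  have *: "lborel = distr lborel borel (\<lambda>x::'a. x + c)"
  proof -
    have "(+) c = (\<lambda>x. x + c)" by (auto simp: add.commute)
    then show ?thesis using lborel_distr_plus[of c] by simp
  qed
  show "(LINT x|lborel. f (x + c)) = (LINT x|lborel. f x)"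
    by (subst (2) *, subst integral_distr) auto
  show "integrable lborel (\<lambda>x. f (x + c)) \<longleftrightarrow> integrable lborel f"
    by (subst (2) *, subst integrable_distr_eq) auto
qed

lemma partial_deriv_shift:
  assumes "f differentiable (at (x - v))"
  shows "partial_deriv b (\<lambda>y. f (y - v)) x = partial_deriv b f (x - v)"
proof -
  have f: "(f has_derivative frechet_derivative f (at (x - v))) (at (x - v))"
    using assms by (simp add: frechet_derivative_works)
  have "((\<lambda>y. y - v) has_derivative (\<lambda>y. y)) (at x)"
    by (auto intro!: derivative_eq_intros)
  from has_derivative_compose[OF this f]
  have "frechet_derivative f (at (x - v)) = frechet_derivative (\<lambda>y. f (y - v)) (at x)"
    by (intro frechet_derivative_at) simp
  then show ?thesis by (simp add: partial_deriv_def)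
qed

lemma frechet_derivative_basis_expansion:
  fixes f :: "'a::euclidean_space \<Rightarrow> real"
  assumes "f differentiable (at x)"
  shows "frechet_derivative f (at x) h = (\<Sum>b\<in>Basis. (h \<bullet> b) * partial_deriv b f x)"
proof -
  interpret linear "frechet_derivative f (at x)"
    using assms by (rule linear_frechet_derivative)
  have "frechet_derivative f (at x) h = frechet_derivative f (at x) (\<Sum>b\<in>Basis. (h \<bullet> b) *\<^sub>R b)"
    by (simp add: euclidean_representation)
  also have "\<dots> = (\<Sum>b\<in>Basis. (h \<bullet> b) * frechet_derivative f (at x) b)"
    by (simp add: sum scaleR)
  finally show ?thesis by (simp add: partial_deriv_def)
qed

text \<open>The weak gradient with Borel versions and \<open>lborel\<close>, which makes Fubini in
  (x, t) available. Integrals extend over the whole space because test functions and their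
  derivatives vanish off \<Omega>.\<close>

locale borel_weak_gradient =
  fixes \<Omega> :: "'a::euclidean_space set" and u :: "'a \<Rightarrow> real" and g :: "'a \<Rightarrow> 'a"
  assumes open_\<Omega>: "open \<Omega>"
    and u_borel [measurable]: "u \<in> borel_measurable borel"
    and g_borel [measurable]: "g \<in> borel_measurable borel"
    and u_loc: "\<And>K. compact K \<Longrightarrow> K \<subseteq> \<Omega> \<Longrightarrow> integrable lborel (\<lambda>x. indicator K x * u x)"
    and g_loc: "\<And>K. compact K \<Longrightarrow> K \<subseteq> \<Omega> \<Longrightarrow> integrable lborel (\<lambda>x. indicator K x *\<^sub>R g x)"
    and weak: "\<And>\<phi> b. test_fun \<Omega> \<phi> \<Longrightarrow> b \<in> Basis \<Longrightarrow>
      (LINT x|lborel. u x * partial_deriv b \<phi> x) = - (LINT x|lborel. (g x \<bullet> b) * \<phi> x)"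
begin

lemma integrable_u_bounded:
  assumes "compact K" "K \<subseteq> \<Omega>" and [measurable]: "f \<in> borel_measurable borel"
    and "\<And>x. \<bar>f x\<bar> \<le> C" "\<And>x. x \<notin> K \<Longrightarrow> f x = 0"
  shows "integrable lborel (\<lambda>x. u x * f x)"
proof (rule Bochner_Integration.integrable_bound)
  show "integrable lborel (\<lambda>x. C * (indicator K x * u x))"
    using u_loc[OF assms(1,2)] by simp
  show "AE x in lborel. norm (u x * f x) \<le> norm (C * (indicator K x * u x))"
  proof (rule AE_I2)
    fix x
    have "\<bar>f x\<bar> * \<bar>u x\<bar> \<le> \<bar>C\<bar> * \<bar>u x\<bar>"
      using assms(4)[of x] by (intro mult_right_mono) auto
    then show "norm (u x * f x) \<le> norm (C * (indicator K x * u x))"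
      using assms(5)[of x] by (cases "x \<in> K") (auto simp: abs_mult mult.commute)
  qed
qed measurable

lemma integrable_g_bounded:
  assumes "compact K" "K \<subseteq> \<Omega>" and [measurable]: "f \<in> borel_measurable borel"
    and "\<And>x. \<bar>f x\<bar> \<le> C" "\<And>x. x \<notin> K \<Longrightarrow> f x = 0"
  shows "integrable lborel (\<lambda>x. (g x \<bullet> v) * f x)"
proof (rule Bochner_Integration.integrable_bound)
  show "integrable lborel (\<lambda>x. (C * norm v) *\<^sub>R (indicator K x *\<^sub>R g x))"
    by (intro integrable_scaleR_right g_loc[OF assms(1,2)])
  show "AE x in lborel. norm ((g x \<bullet> v) * f x) \<le> norm ((C * norm v) *\<^sub>R (indicator K x *\<^sub>R g x))"
  proof (rule AE_I2)
    fix x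
    have "\<bar>g x \<bullet> v\<bar> * \<bar>f x\<bar> \<le> (norm (g x) * norm v) * \<bar>C\<bar>"
      using assms(4)[of x] by (intro mult_mono Cauchy_Schwarz_ineq2) auto
    then show "norm ((g x \<bullet> v) * f x) \<le> norm ((C * norm v) *\<^sub>R (indicator K x *\<^sub>R g x))"
      using assms(5)[of x] by (cases "x \<in> K") (auto simp: abs_mult ac_simps)
  qed
qed measurable

context
  fixes h :: 'a
  assumes h: "h \<in> translation_cone \<Omega>"
begin

text \<open>The compact region that a box covers while moving along h. It stays in \<Omega>, so
  local integrability on it controls all translates at once.\<close>

definition sweep :: "'a \<Rightarrow> 'a \<Rightarrow> 'a set" where
  "sweep a c = (\<lambda>(t, x). x + t *\<^sub>R h) ` ({0..1} \<times> cbox a c)"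

lemma compact_sweep: "compact (sweep a c)"
  unfolding sweep_def
  by (intro compact_continuous_image compact_Times) (auto intro!: continuous_intros simp: case_prod_unfold)

lemma sweep_subset: "cbox a c \<subseteq> \<Omega> \<Longrightarrow> sweep a c \<subseteq> \<Omega>"
  using h unfolding sweep_def translation_cone_def by auto

lemma sweepI: "x - t *\<^sub>R h \<in> cbox a c \<Longrightarrow> 0 \<le> t \<Longrightarrow> t \<le> 1 \<Longrightarrow> x \<in> sweep a c"
  unfolding sweep_def by (force intro!: image_eqI[of _ _ "(t, x - t *\<^sub>R h)"])

lemma sweep_borel [measurable]: "sweep a c \<in> sets borel"
  by (rule borel_compact[OF compact_sweep])

text \<open>For fixed t, shifting x by t h moves the translation from g to f. The product is then
  supported on the sweep and dominated by a multiple of |g| there, uniformly in t.\<close>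

lemma integrable_gradient_segment:
  assumes ac: "cbox a c \<subseteq> \<Omega>" and [measurable]: "f \<in> borel_measurable borel"
    and f: "\<And>x. \<bar>f x\<bar> \<le> C" "\<And>x. x \<notin> cbox a c \<Longrightarrow> f x = 0"
  shows "integrable (lborel \<Otimes>\<^sub>M lborel) (\<lambda>(x, t). f x * (indicator {0..1} t * (g (x + t *\<^sub>R h) \<bullet> h)))"
proof (rule integrableI_bounded)
  let ?C = "\<integral>\<^sup>+x. ennreal (\<bar>C\<bar> * norm h * norm (indicator (sweep a c) x *\<^sub>R g x)) \<partial>lborel"
  have "?C < \<infinity>"
    using g_loc[OF compact_sweep sweep_subset[OF ac]]
    by (simp add: ennreal_mult nn_integral_cmult integrable_iff_bounded ennreal_mult_less_top)
  have "(\<integral>\<^sup>+z. ennreal (norm (case z of (x, t) \<Rightarrow> f x * (indicator {0..1} t * (g (x + t *\<^sub>R h) \<bullet> h)))) \<partial>(lborel \<Otimes>\<^sub>M lborel))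
     = (\<integral>\<^sup>+t. (\<integral>\<^sup>+x. ennreal (norm (f x * (indicator {0..1} t * (g (x + t *\<^sub>R h) \<bullet> h)))) \<partial>lborel) \<partial>lborel)"
    by (subst lborel_pair.nn_integral_snd[symmetric]) auto
  also have "\<dots> \<le> (\<integral>\<^sup>+t. ?C * indicator {0..1} (t::real) \<partial>lborel)"
  proof (intro nn_integral_mono)
    fix t :: real
    show "(\<integral>\<^sup>+x. ennreal (norm (f x * (indicator {0..1} t * (g (x + t *\<^sub>R h) \<bullet> h)))) \<partial>lborel) \<le> ?C * indicator {0..1} t"
    proof (cases "t \<in> {0..1}")
      case True
      have "(\<integral>\<^sup>+x. ennreal (norm (f x * (indicator {0..1} t * (g (x + t *\<^sub>R h) \<bullet> h)))) \<partial>lborel)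
         = (\<integral>\<^sup>+x. ennreal (norm (f (x + t *\<^sub>R h - t *\<^sub>R h) * (g (x + t *\<^sub>R h) \<bullet> h))) \<partial>lborel)"
        using True by simp
      also have "\<dots> = (\<integral>\<^sup>+x. ennreal (norm (f (x - t *\<^sub>R h) * (g x \<bullet> h))) \<partial>lborel)"
        by (rule nn_integral_lborel_shift) measurable
      also have "\<dots> \<le> ?C"
      proof (intro nn_integral_mono ennreal_leI)
        fix x
        have "\<bar>f (x - t *\<^sub>R h)\<bar> * \<bar>g x \<bullet> h\<bar> \<le> \<bar>C\<bar> * (norm (g x) * norm h)"
          using f(1)[of "x - t *\<^sub>R h"] by (intro mult_mono Cauchy_Schwarz_ineq2) auto
        then show "norm (f (x - t *\<^sub>R h) * (g x \<bullet> h)) \<le> \<bar>C\<bar> * norm h * norm (indicator (sweep a c) x *\<^sub>R g x)"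
          using f(2)[of "x - t *\<^sub>R h"] sweepI[of x t a c] True
          by (cases "x - t *\<^sub>R h \<in> cbox a c") (auto simp: abs_mult ac_simps)
      qed
      finally show ?thesis using True by simp
    qed simp
  qed
  also have "\<dots> = ?C"
    by (simp add: nn_integral_cmult)
  finally show "(\<integral>\<^sup>+z. ennreal (norm (case z of (x, t) \<Rightarrow> f x * (indicator {0..1} t * (g (x + t *\<^sub>R h) \<bullet> h)))) \<partial>(lborel \<Otimes>\<^sub>M lborel)) < \<infinity>"
    using \<open>?C < \<infinity>\<close> by (rule le_less_trans)
qed measurable

text \<open>The translation is moved from u to the bump, whose increment is the integral of its
  directional derivative along the segment. The weak gradient is applied to each translated bump,
  and the translation is then moved back onto g.\<close>

lemma bump_increment_identity:
  assumes ac: "cbox a c \<subseteq> \<Omega>"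
  shows "(LINT x|lborel. (u (x + h) - u x) * bump n a c x)
    = (LINT x|lborel. (LINT t|lborel. indicator {0..1} t * (g (x + t *\<^sub>R h) \<bullet> h)) * bump n a c x)"
proof -
  let ?\<phi> = "bump n a c"
  \<comment> \<open>The directional derivative of the bump along h, written in partial derivatives
    since the weak gradient is tested only along basis vectors.\<close>
  define D where "D y = (\<Sum>b\<in>Basis. (h \<bullet> b) * partial_deriv b ?\<phi> y)" for y
  have D_cont: "continuous_on UNIV D"
    unfolding D_def by (intro continuous_on_sum continuous_on_mult continuous_on_const partial_deriv_bump_continuous)
  then have D_meas [measurable]: "D \<in> borel_measurable borel"
    by (rule borel_measurable_continuous_onI)
  have D_out: "D x = 0" if "x \<notin> cbox a c" for x
    unfolding D_def using partial_deriv_bump_outside[OF that] by simp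
  obtain C where C: "\<bar>D x\<bar> \<le> C" for x
  proof -
    have "compact (D ` cbox a c)"
      by (rule compact_continuous_image[OF continuous_on_subset[OF D_cont subset_UNIV]]) simp
    then have "bounded (D ` cbox a c)" by (rule compact_imp_bounded)
    then obtain C where C: "\<forall>x\<in>cbox a c. \<bar>D x\<bar> \<le> C" unfolding bounded_iff by auto
    have "\<bar>D x\<bar> \<le> max C 0" for x
      using C D_out[of x] by (cases "x \<in> cbox a c") auto
    then show ?thesis using that by blast
  qed
  have \<phi>_out: "?\<phi> x = 0" if "x \<notin> cbox a c" for x
    using that bump_nonzero_iff[of n a c x] box_subset_cbox[of a c] by auto
  have \<phi>_bound: "\<bar>?\<phi> x\<bar> \<le> 1" for x
    using bump_bounds[of n a c x] by simp
  note K = compact_sweep[of a c] sweep_subset[OF ac]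
  have shift_out: "x \<notin> sweep a c \<Longrightarrow> 0 \<le> t \<Longrightarrow> t \<le> 1 \<Longrightarrow> x - t *\<^sub>R h \<notin> cbox a c" for x t
    using sweepI by blast

  have FTC: "?\<phi> (x - h) - ?\<phi> x = - (LINT t|lborel. indicator {0..1} t * D (x - t *\<^sub>R h))" for x
  proof -
    have "DERIV (\<lambda>t. ?\<phi> (x - t *\<^sub>R h)) t :> - D (x - t *\<^sub>R h)" for t
    proof -
      have "((\<lambda>t. x - t *\<^sub>R h) has_derivative (\<lambda>s. - (s *\<^sub>R h))) (at t)"
        by (auto intro!: derivative_eq_intros)
      from has_derivative_compose[OF this, of ?\<phi>] bump_differentiable[of n a c "x - t *\<^sub>R h"]
      have "((\<lambda>t. ?\<phi> (x - t *\<^sub>R h)) has_derivative (\<lambda>s. frechet_derivative ?\<phi> (at (x - t *\<^sub>R h)) (- (s *\<^sub>R h)))) (at t)"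
        by (simp add: frechet_derivative_works)
      also have "(\<lambda>s. frechet_derivative ?\<phi> (at (x - t *\<^sub>R h)) (- (s *\<^sub>R h))) = (\<lambda>s. (- D (x - t *\<^sub>R h)) * s)"
        using bump_differentiable[of n a c "x - t *\<^sub>R h"]
        by (auto simp: frechet_derivative_basis_expansion D_def sum_distrib_left sum_negf fun_eq_iff ac_simps)
      finally show ?thesis by (simp only: has_field_derivative_def)
    qed
    moreover have "isCont (\<lambda>t. - D (x - t *\<^sub>R h)) t" for t
    proof -
      have "isCont (\<lambda>t. x - t *\<^sub>R h) t" by (intro continuous_intros)
      moreover have "isCont D y" for y
        using D_cont by (simp add: continuous_on_eq_continuous_at)
      ultimately show ?thesis
        using isCont_o2[of t "\<lambda>t. x - t *\<^sub>R h" D] by (simp add: continuous_minus)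
    qed
    ultimately have "(LINT t|lborel. - D (x - t *\<^sub>R h) * indicator {0..1} t) = ?\<phi> (x - 1 *\<^sub>R h) - ?\<phi> (x - 0 *\<^sub>R h)"
      by (intro integral_FTC_Icc_real) auto
    then show ?thesis by (simp add: mult.commute)
  qed

  have int: "integrable lborel (\<lambda>x. u x * ?\<phi> (x - h))"
  proof (rule integrable_u_bounded[OF K, where C = 1])
    show "?\<phi> (x - h) = 0" if "x \<notin> sweep a c" for x
      using shift_out[OF that, of 1] \<phi>_out by simp
  qed (measurable, rule \<phi>_bound)
  have int': "integrable lborel (\<lambda>x. u x * ?\<phi> x)"
  proof (rule integrable_u_bounded[OF K, where C = 1])
    show "?\<phi> x = 0" if "x \<notin> sweep a c" for x
      using shift_out[OF that, of 0] \<phi>_out by simp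
  qed (measurable, rule \<phi>_bound)
  have "(LINT x|lborel. (u (x + h) - u x) * ?\<phi> x) = (LINT x|lborel. u (x + h) * ?\<phi> (x + h - h)) - (LINT x|lborel. u x * ?\<phi> x)"
    using integral_lborel_shift(2)[of "\<lambda>x. u x * ?\<phi> (x - h)" h] int int'
    by (simp add: left_diff_distrib)
  also have "(LINT x|lborel. u (x + h) * ?\<phi> (x + h - h)) = (LINT x|lborel. u x * ?\<phi> (x - h))"
    by (rule integral_lborel_shift(1)) measurable
  also have "(LINT x|lborel. u x * ?\<phi> (x - h)) - (LINT x|lborel. u x * ?\<phi> x) = (LINT x|lborel. u x * (?\<phi> (x - h) - ?\<phi> x))"
    using int int' by (simp add: right_diff_distrib)
  also have "\<dots> = - (LINT x|lborel. (LINT t|lborel. u x * (indicator {0..1} t * D (x - t *\<^sub>R h))))"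
    unfolding FTC by simp
  also have "(LINT x|lborel. (LINT t|lborel. u x * (indicator {0..1} t * D (x - t *\<^sub>R h))))
    = (LINT t|lborel. (LINT x|lborel. u x * (indicator {0..1} t * D (x - t *\<^sub>R h))))"
  proof (rule lborel_pair.Fubini_integral[symmetric], rule integrableI_bounded)
    have "(\<integral>\<^sup>+z. ennreal (norm (case z of (x, t) \<Rightarrow> u x * (indicator {0..1} t * D (x - t *\<^sub>R h)))) \<partial>(lborel \<Otimes>\<^sub>M lborel))
       \<le> (\<integral>\<^sup>+z. (case z of (x, t) \<Rightarrow> ennreal (\<bar>C\<bar> * norm (indicator (sweep a c) x * u x)) * indicator {0..1} (t :: real)) \<partial>(lborel \<Otimes>\<^sub>M lborel))"
    proof (intro nn_integral_mono)
      fix z :: "'a \<times> real"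
      obtain x t where z: "z = (x, t)" by (cases z)
      have "\<bar>u x\<bar> * \<bar>D (x - t *\<^sub>R h)\<bar> \<le> \<bar>u x\<bar> * \<bar>C\<bar>"
        using C[of "x - t *\<^sub>R h"] by (intro mult_left_mono) auto
      then show "ennreal (norm (case z of (x, t) \<Rightarrow> u x * (indicator {0..1} t * D (x - t *\<^sub>R h))))
          \<le> (case z of (x, t) \<Rightarrow> ennreal (\<bar>C\<bar> * norm (indicator (sweep a c) x * u x)) * indicator {0..1} t)"
        unfolding z using shift_out[of x t] D_out[of "x - t *\<^sub>R h"]
        by (cases "t \<in> {0..1}"; cases "x \<in> sweep a c") (auto simp: abs_mult mult.commute intro!: ennreal_leI)
    qed
    also have "\<dots> = (\<integral>\<^sup>+x. (\<integral>\<^sup>+t. ennreal (\<bar>C\<bar> * norm (indicator (sweep a c) x * u x)) * indicator {0..1} (t::real) \<partial>lborel) \<partial>lborel)"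
      by (subst lborel.nn_integral_fst[symmetric]) (auto simp: case_prod_unfold)
    also have "\<dots> = (\<integral>\<^sup>+x. ennreal \<bar>C\<bar> * ennreal (norm (indicator (sweep a c) x * u x)) \<partial>lborel)"
      by (simp add: nn_integral_cmult ennreal_mult)
    also have "\<dots> < \<infinity>"
      using u_loc[OF K] by (simp add: nn_integral_cmult integrable_iff_bounded ennreal_mult_less_top)
    finally show "(\<integral>\<^sup>+z. ennreal (norm (case z of (x, t) \<Rightarrow> u x * (indicator {0..1} t * D (x - t *\<^sub>R h)))) \<partial>(lborel \<Otimes>\<^sub>M lborel)) < \<infinity>" .
  qed measurable
  also have "\<dots> = (LINT t|lborel. - (LINT x|lborel. ?\<phi> x * (indicator {0..1} t * (g (x + t *\<^sub>R h) \<bullet> h))))"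
  proof (intro Bochner_Integration.integral_cong refl)
    fix t :: real
    show "(LINT x|lborel. u x * (indicator {0..1} t * D (x - t *\<^sub>R h))) = - (LINT x|lborel. ?\<phi> x * (indicator {0..1} t * (g (x + t *\<^sub>R h) \<bullet> h)))"
    proof (cases "t \<in> {0..1}")
      case True
      \<comment> \<open>The translated bump is supported on a translated box, which stays in
        \<Omega> for h in the cone; so it is an admissible test function.\<close>
      let ?\<phi>t = "bump n (a + t *\<^sub>R h) (c + t *\<^sub>R h)"
      have \<phi>t: "?\<phi>t x = ?\<phi> (x - t *\<^sub>R h)" for x
        by (simp add: bump_translate)
      have "cbox (a + t *\<^sub>R h) (c + t *\<^sub>R h) \<subseteq> \<Omega>"
      proof
        fix x assume "x \<in> cbox (a + t *\<^sub>R h) (c + t *\<^sub>R h)"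
        then have "x - t *\<^sub>R h \<in> cbox a c"
          by (auto simp: mem_box inner_simps algebra_simps)
        then show "x \<in> \<Omega>" using sweepI[of x t a c] True K(2) by auto
      qed
      then have test: "test_fun \<Omega> ?\<phi>t" by (rule test_fun_bump)
      have partial: "partial_deriv b ?\<phi>t x = partial_deriv b ?\<phi> (x - t *\<^sub>R h)" for b x
        using partial_deriv_shift[OF bump_differentiable[of n a c "x - t *\<^sub>R h"], of b]
        by (simp add: \<phi>t[abs_def])
      have intb: "integrable lborel (\<lambda>x. u x * partial_deriv b ?\<phi> (x - t *\<^sub>R h))" if b: "b \<in> Basis" for b
      proof -
        obtain B where "\<And>x. \<bar>partial_deriv b ?\<phi> x\<bar> \<le> B"
          using partial_deriv_bump_bounded[OF b] by blast
        moreover have "partial_deriv b ?\<phi> \<in> borel_measurable borel"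
          by (rule borel_measurable_continuous_onI[OF partial_deriv_bump_continuous[OF b]])
        ultimately show ?thesis
          using shift_out[of _ t] True partial_deriv_bump_outside[of _ a c b n]
          by (intro integrable_u_bounded[OF K, of _ B]) auto
      qed
      have intg: "integrable lborel (\<lambda>x. (g x \<bullet> v) * ?\<phi> (x - t *\<^sub>R h))" for v
        using shift_out[of _ t] True \<phi>_out by (intro integrable_g_bounded[OF K _ \<phi>_bound]) auto
      have "(LINT x|lborel. u x * D (x - t *\<^sub>R h)) = (LINT x|lborel. (\<Sum>b\<in>Basis. (h \<bullet> b) * (u x * partial_deriv b ?\<phi> (x - t *\<^sub>R h))))"
        by (simp add: D_def sum_distrib_left ac_simps)
      also have "\<dots> = (\<Sum>b\<in>Basis. (h \<bullet> b) * (LINT x|lborel. u x * partial_deriv b ?\<phi>t x))"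
        using intb by (simp add: partial Bochner_Integration.integral_sum)
      also have "\<dots> = - (\<Sum>b\<in>Basis. (h \<bullet> b) * (LINT x|lborel. (g x \<bullet> b) * ?\<phi>t x))"
        by (simp add: weak[OF test] sum_negf)
      also have "(\<Sum>b\<in>Basis. (h \<bullet> b) * (LINT x|lborel. (g x \<bullet> b) * ?\<phi>t x)) = (LINT x|lborel. (\<Sum>b\<in>Basis. (h \<bullet> b) * ((g x \<bullet> b) * ?\<phi> (x - t *\<^sub>R h))))"
        using intg by (simp add: \<phi>t Bochner_Integration.integral_sum)
      also have "\<dots> = (LINT x|lborel. (g x \<bullet> h) * ?\<phi> (x - t *\<^sub>R h))"
        by (simp add: euclidean_inner[of "g _" h] sum_distrib_left ac_simps)
      also have "\<dots> = (LINT x|lborel. (g (x + t *\<^sub>R h) \<bullet> h) * ?\<phi> (x + t *\<^sub>R h - t *\<^sub>R h))"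
        by (rule integral_lborel_shift(1)[symmetric]) measurable
      finally show ?thesis using True by (simp add: mult.commute)
    qed simp
  qed
  also have "\<dots> = - (LINT t|lborel. (LINT x|lborel. ?\<phi> x * (indicator {0..1} t * (g (x + t *\<^sub>R h) \<bullet> h))))"
    by simp
  also have "(LINT t|lborel. (LINT x|lborel. ?\<phi> x * (indicator {0..1} t * (g (x + t *\<^sub>R h) \<bullet> h))))
     = (LINT x|lborel. (LINT t|lborel. ?\<phi> x * (indicator {0..1} t * (g (x + t *\<^sub>R h) \<bullet> h))))"
    by (rule lborel_pair.Fubini_integral, rule integrable_gradient_segment[OF ac _ \<phi>_bound \<phi>_out]) simp
  finally show ?thesis by (simp add: mult.commute)
qed

text \<open>Bumps tend to box indicators, so the difference w of both sides has zero integral over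
  every box whose closed box lies in \<Omega>, hence vanishes almost everywhere in \<Omega>. The
  exceptional null set depends on h.\<close>

lemma increment_eq_gradient_integral:
  "AE x in lborel. x \<in> \<Omega> \<longrightarrow> u (x + h) - u x = (LINT t|lborel. indicator {0..1} t * (g (x + t *\<^sub>R h) \<bullet> h))"
proof -
  define w where "w x = (u (x + h) - u x) - (LINT t|lborel. indicator {0..1} t * (g (x + t *\<^sub>R h) \<bullet> h))" for x
  have [measurable]: "w \<in> borel_measurable borel"
    unfolding w_def by measurable
  have intG: "integrable lborel (\<lambda>x. f x * (LINT t|lborel. indicator {0..1} t * (g (x + t *\<^sub>R h) \<bullet> h)))"
    and intU: "integrable lborel (\<lambda>x. f x * (u (x + h) - u x))"
    if "cbox a c \<subseteq> \<Omega>" and [measurable]: "f \<in> borel_measurable borel"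
      and "\<And>x. \<bar>f x\<bar> \<le> 1" "\<And>x. x \<notin> cbox a c \<Longrightarrow> f x = 0" for f a c
  proof -
    show "integrable lborel (\<lambda>x. f x * (LINT t|lborel. indicator {0..1} t * (g (x + t *\<^sub>R h) \<bullet> h)))"
      using lborel_pair.integrable_fst'[OF integrable_gradient_segment[OF that]] by simp
    have "integrable lborel (\<lambda>x. u x * f (x - h))"
      using sweepI[of _ 1 a c] that(3)
      by (intro integrable_u_bounded[OF compact_sweep[of a c] sweep_subset[OF that(1)], where C = 1] that(4)) auto
    moreover have "integrable lborel (\<lambda>x. u x * f x)"
      using sweepI[of _ 0 a c] that(3)
      by (intro integrable_u_bounded[OF compact_sweep[of a c] sweep_subset[OF that(1)], where C = 1] that(4)) auto
    ultimately have "integrable lborel (\<lambda>x. u (x + h) * f (x + h - h) - u x * f x)"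
      using integral_lborel_shift(2)[of "\<lambda>x. u x * f (x - h)" h] by (intro Bochner_Integration.integrable_diff) auto
    then show "integrable lborel (\<lambda>x. f x * (u (x + h) - u x))"
      by (simp add: algebra_simps)
  qed
  have int_w: "integrable lborel (\<lambda>x. f x * w x)"
    if "cbox a c \<subseteq> \<Omega>" "f \<in> borel_measurable borel" "\<And>x. \<bar>f x\<bar> \<le> 1" "\<And>x. x \<notin> cbox a c \<Longrightarrow> f x = 0" for f a c
    using Bochner_Integration.integrable_diff[OF intU[OF that] intG[OF that]] by (simp add: w_def right_diff_distrib)
  have box_zero: "(LINT x|lborel. indicator (box a c) x * w x) = 0" if ac: "cbox a c \<subseteq> \<Omega>" for a c
  proof -
    have out: "bump n a c x = 0" "indicator (box a c) x = (0::real)" if "x \<notin> cbox a c" for n x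
      using that bump_nonzero_iff[of n a c x] box_subset_cbox[of a c] by auto
    have "(LINT x|lborel. bump n a c x * w x) = 0" for n
    proof -
      have "\<bar>bump n a c x\<bar> \<le> 1" for x using bump_bounds[of n a c x] by simp
      note I = intU[OF ac bump_measurable this out(1)] intG[OF ac bump_measurable this out(1)]
      then show ?thesis
        using bump_increment_identity[OF ac, of n] by (simp add: w_def right_diff_distrib mult.commute)
    qed
    moreover have "(\<lambda>n. LINT x|lborel. bump n a c x * w x) \<longlonglongrightarrow> (LINT x|lborel. indicator (box a c) x * w x)"
    proof (rule integral_dominated_convergence)
      show "integrable lborel (\<lambda>x. \<bar>indicator (cbox a c) x * w x\<bar>)"
        by (intro integrable_abs int_w[OF ac]) (auto simp: indicator_def)
      show "AE x in lborel. (\<lambda>n. bump n a c x * w x) \<longlonglongrightarrow> indicator (box a c) x * w x"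
        by (intro AE_I2 tendsto_mult bump_tendsto_indicator tendsto_const)
      show "AE x in lborel. norm (bump n a c x * w x) \<le> \<bar>indicator (cbox a c) x * w x\<bar>" for n
      proof (rule AE_I2)
        fix x
        show "norm (bump n a c x * w x) \<le> \<bar>indicator (cbox a c) x * w x\<bar>"
          using out(1)[of x n] bump_bounds[of n a c x] mult_right_mono[of "bump n a c x" 1 "\<bar>w x\<bar>"]
          by (cases "x \<in> cbox a c") (auto simp: abs_mult)
      qed
    qed measurable
    ultimately show ?thesis
      by (simp add: LIMSEQ_const_iff)
  qed
  have cbox_AE: "AE x in lborel. x \<in> cbox a c \<longrightarrow> w x = 0" if ac: "cbox a c \<subseteq> \<Omega>" for a c
  proof -
    have "AE x in lborel. indicator (box a c) x * w x = 0"
    proof (rule AE_zero_if_box_integrals_zero)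
      show "integrable lborel (\<lambda>x. indicator (box a c) x * w x)"
        using box_subset_cbox[of a c] by (intro int_w[OF ac]) (auto simp: indicator_def)
      fix a' c'
      obtain a'' c'' where I: "box a' c' \<inter> box a c = box a'' c''"
        by (auto simp: box_Int_box)
      have eq: "(LINT x|lborel. indicator (box a' c') x * (indicator (box a c) x * w x)) = (LINT x|lborel. indicator (box a'' c'') x * w x)"
        unfolding I[symmetric] by (simp add: indicator_inter_arith mult.assoc)
      show "(LINT x|lborel. indicator (box a' c') x * (indicator (box a c) x * w x)) = 0"
      \<comment> \<open>For a nonempty box the closed box is its closure and so stays inside
        \<open>cbox a c\<close>; an empty box has integral 0.\<close>
      proof (cases "box a'' c'' = {}")
        case False
        then have "cbox a'' c'' = closure (box a'' c'')" by (simp add: closure_box)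
        also have "\<dots> \<subseteq> cbox a c"
          using I box_subset_cbox[of a c] by (intro closure_minimal) auto
        finally show ?thesis unfolding eq using ac by (intro box_zero) auto
      qed (simp add: eq)
    qed
    moreover have "AE x in lborel. x \<notin> cbox a c - box a c"
      by (rule AE_not_in[OF null_sets_cbox_Diff_box])
    ultimately show ?thesis
      by eventually_elim auto
  qed
  \<comment> \<open>Countably many closed boxes cover \<Omega>, so the null sets can be
    united.\<close>
  obtain \<D> where \<D>: "countable \<D>" "\<D> \<subseteq> Pow \<Omega>" "\<And>X. X \<in> \<D> \<Longrightarrow> \<exists>a b. X = cbox a b" "\<Union>\<D> = \<Omega>"
    using open_countable_Union_open_cbox[OF open_\<Omega>] by metis
  have "AE x in lborel. \<forall>X\<in>\<D>. x \<in> X \<longrightarrow> w x = 0"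
    using \<D> cbox_AE by (subst AE_ball_countable) (auto, metis Pow_iff subsetD)
  then show ?thesis
    by eventually_elim (use \<D>(4) in \<open>auto simp: w_def\<close>)
qed

end

end

text \<open>Integrate the tangent inequality for the q-th power at m, the mean of |f|, and cancel
  the finite term (q-1) m^q. No integrability of the q-th power of |f| is assumed.\<close>

lemma jensen_powr_unit_interval:
  fixes f :: "real \<Rightarrow> real"
  assumes [measurable]: "f \<in> borel_measurable borel" and "q \<ge> 1"
  shows "ennreal (\<bar>LINT t|lborel. indicator {0..1} t * f t\<bar> powr q)
    \<le> (\<integral>\<^sup>+t. ennreal (\<bar>f t\<bar> powr q) * indicator {0..1} t \<partial>lborel)"
proof -
  define m where "m = (LINT t|lborel. indicator {0..1} t * \<bar>f t\<bar>)"
  have le: "\<bar>LINT t|lborel. indicator {0..1} t * f t\<bar> \<le> m"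
    using integral_norm_bound[of lborel "\<lambda>t. indicator {0..1} t * f t"] by (simp add: m_def abs_mult)
  show ?thesis
  \<comment> \<open>If |f| is not integrable on the interval, m is 0 by the default value of the
    Bochner integral, and then so is the left side.\<close>
  proof (cases "integrable lborel (\<lambda>t. indicator {0..1} t * \<bar>f t\<bar>) \<and> m > 0")
    case False
    then have "m \<le> 0"
      using not_integrable_integral_eq[of lborel "\<lambda>t. indicator {0..1} t * \<bar>f t\<bar>"] by (auto simp: m_def)
    then have "\<bar>LINT t|lborel. indicator {0..1} t * f t\<bar> = 0" using le by linarith
    then show ?thesis using \<open>q \<ge> 1\<close> by simp
  next
    case True
    then have "m > 0" by simp
    have young: "q * m powr (q - 1) * x \<le> x powr q + (q - 1) * m powr q" if "x \<ge> 0" for x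
    proof (cases "x > 0")
      case True
      have "(m powr q) powr (1 - 1 / q) * (x powr q) powr (1 / q) \<le> (1 - 1 / q) * m powr q + 1 / q * x powr q"
        using \<open>q \<ge> 1\<close> \<open>m > 0\<close> True by (intro Youngs_inequality_0) auto
      moreover have "(m powr q) powr (1 - 1 / q) = m powr (q - 1)" "(x powr q) powr (1 / q) = x"
        using \<open>q \<ge> 1\<close> that by (simp_all add: powr_powr right_diff_distrib)
      ultimately have "q * (m powr (q - 1) * x) \<le> q * ((1 - 1 / q) * m powr q + 1 / q * x powr q)"
        using \<open>q \<ge> 1\<close> by (intro mult_left_mono) auto
      then show ?thesis using \<open>q \<ge> 1\<close> by (simp add: algebra_simps)
    qed (use \<open>x \<ge> 0\<close> \<open>q \<ge> 1\<close> in simp)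
    let ?N = "\<integral>\<^sup>+t. ennreal (\<bar>f t\<bar> powr q) * indicator {0..1} t \<partial>lborel"
    have m: "(\<integral>\<^sup>+t. ennreal (indicator {0..1} t * \<bar>f t\<bar>) \<partial>lborel) = ennreal m"
      unfolding m_def using True by (intro nn_integral_eq_integral) auto
    have "ennreal (m powr q) + ennreal ((q - 1) * m powr q) = ennreal (q * m powr (q - 1)) * ennreal m"
    proof -
      have "m powr q + (q - 1) * m powr q = q * m powr (q - 1) * m"
        using \<open>m > 0\<close> by (simp add: powr_diff algebra_simps)
      then show ?thesis
        using \<open>q \<ge> 1\<close> \<open>m > 0\<close> by (simp flip: ennreal_mult ennreal_plus)
    qed
    also have "\<dots> = (\<integral>\<^sup>+t. ennreal (q * m powr (q - 1)) * ennreal (indicator {0..1} t * \<bar>f t\<bar>) \<partial>lborel)"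
      by (simp add: nn_integral_cmult m)
    also have "\<dots> \<le> (\<integral>\<^sup>+t. ennreal (\<bar>f t\<bar> powr q) * indicator {0..1} t + ennreal ((q - 1) * m powr q) * indicator {0..1} t \<partial>lborel)"
    proof (intro nn_integral_mono)
      fix t
      show "ennreal (q * m powr (q - 1)) * ennreal (indicator {0..1} t * \<bar>f t\<bar>)
        \<le> ennreal (\<bar>f t\<bar> powr q) * indicator {0..1} t + ennreal ((q - 1) * m powr q) * indicator {0..1} t"
        using young[of "\<bar>f t\<bar>"] \<open>q \<ge> 1\<close>
        by (auto simp: indicator_def simp flip: ennreal_mult ennreal_plus intro!: ennreal_leI)
    qed
    also have "\<dots> = ?N + ennreal ((q - 1) * m powr q)"
      by (subst nn_integral_add) (auto simp: nn_integral_cmult)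
    finally have "ennreal (m powr q) \<le> ?N"
      by (simp add: ennreal_add_left_cancel_le add.commute[of _ "ennreal ((q - 1) * m powr q)"])
    moreover have "\<bar>LINT t|lborel. indicator {0..1} t * f t\<bar> powr q \<le> m powr q"
      using le \<open>q \<ge> 1\<close> by (intro powr_mono2) auto
    ultimately show ?thesis
      by (meson ennreal_leI order_trans)
  qed
qed

context borel_weak_gradient
begin

lemma \<Omega>_borel [measurable]: "\<Omega> \<in> sets borel"
  using open_\<Omega> by simp

text \<open>Jensen in t, then Fubini; for each t the translate of \<Omega> by t h lies in \<Omega>,
  so shifting back only enlarges the integral.\<close>

lemma increment_pow_le_gradient:
  assumes h: "h \<in> translation_cone \<Omega>" and "q \<ge> 1"
  shows "increment_pow \<Omega> q u h \<le> (\<integral>\<^sup>+x. ennreal (\<bar>g x \<bullet> h\<bar> powr q) * indicator \<Omega> x \<partial>lborel)"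
proof -
  have "increment_pow \<Omega> q u h = (\<integral>\<^sup>+x. ennreal (\<bar>u (x + h) - u x\<bar> powr q) * indicator \<Omega> x \<partial>lborel)"
    by (rule increment_pow_cone[OF \<Omega>_borel u_borel h])
  also have "\<dots> \<le> (\<integral>\<^sup>+x. (\<integral>\<^sup>+t. ennreal (\<bar>g (x + t *\<^sub>R h) \<bullet> h\<bar> powr q) * indicator {0..1} t * indicator \<Omega> x \<partial>lborel) \<partial>lborel)"
  proof (rule nn_integral_mono_AE)
    show "AE x in lborel. ennreal (\<bar>u (x + h) - u x\<bar> powr q) * indicator \<Omega> x
       \<le> (\<integral>\<^sup>+t. ennreal (\<bar>g (x + t *\<^sub>R h) \<bullet> h\<bar> powr q) * indicator {0..1} t * indicator \<Omega> x \<partial>lborel)"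
      using increment_eq_gradient_integral[OF h]
    proof eventually_elim
      case (elim x)
      show ?case
      proof (cases "x \<in> \<Omega>")
        case True
        have "(\<lambda>t. g (x + t *\<^sub>R h) \<bullet> h) \<in> borel_measurable borel" by measurable
        from jensen_powr_unit_interval[OF this \<open>q \<ge> 1\<close>] show ?thesis
          using True elim by simp
      qed simp
    qed
  qed
  also have "\<dots> = (\<integral>\<^sup>+t. (\<integral>\<^sup>+x. ennreal (\<bar>g (x + t *\<^sub>R h) \<bullet> h\<bar> powr q) * indicator {0..1} t * indicator \<Omega> x \<partial>lborel) \<partial>lborel)"
    by (rule lborel_pair.Fubini'[symmetric]) measurable
  also have "\<dots> \<le> (\<integral>\<^sup>+t. (\<integral>\<^sup>+x. ennreal (\<bar>g x \<bullet> h\<bar> powr q) * indicator \<Omega> x \<partial>lborel) * indicator {0..1} (t::real) \<partial>lborel)"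
  proof (intro nn_integral_mono)
    fix t :: real
    show "(\<integral>\<^sup>+x. ennreal (\<bar>g (x + t *\<^sub>R h) \<bullet> h\<bar> powr q) * indicator {0..1} t * indicator \<Omega> x \<partial>lborel)
      \<le> (\<integral>\<^sup>+x. ennreal (\<bar>g x \<bullet> h\<bar> powr q) * indicator \<Omega> x \<partial>lborel) * indicator {0..1} t"
    proof (cases "t \<in> {0..1}")
      case True
      then have "x + t *\<^sub>R h \<in> \<Omega>" if "x \<in> \<Omega>" for x
        using h that by (auto simp: translation_cone_def)
      then have "(\<integral>\<^sup>+x. ennreal (\<bar>g (x + t *\<^sub>R h) \<bullet> h\<bar> powr q) * indicator {0..1} t * indicator \<Omega> x \<partial>lborel)
         \<le> (\<integral>\<^sup>+x. ennreal (\<bar>g (x + t *\<^sub>R h) \<bullet> h\<bar> powr q) * indicator \<Omega> (x + t *\<^sub>R h) \<partial>lborel)"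
        by (intro nn_integral_mono) (auto simp: indicator_def)
      also have "\<dots> = (\<integral>\<^sup>+x. ennreal (\<bar>g x \<bullet> h\<bar> powr q) * indicator \<Omega> x \<partial>lborel)"
        by (rule nn_integral_lborel_shift) measurable
      finally show ?thesis using True by simp
    qed simp
  qed
  also have "\<dots> = (\<integral>\<^sup>+x. ennreal (\<bar>g x \<bullet> h\<bar> powr q) * indicator \<Omega> x \<partial>lborel)"
    by (simp add: nn_integral_cmult)
  finally show ?thesis .
qed

text \<open>With the integrals exchanged, the h-integral at fixed x is a radial integral of
  |g(x).h|^q, which yields \<open>K_const\<close> times \<open>sphere_area\<close> and the norm of
  g(x).\<close>

lemma small_increments_gradient_bound:
  assumes cone: "\<And>h. h \<in> translation_cone \<Omega> \<or> - h \<in> translation_cone \<Omega>"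
    and q: "q \<ge> 1" and "0 < a" "a \<le> q" "0 < R"
  shows "(\<integral>\<^sup>+h. increment_pow \<Omega> q u h * radial_weight (q - a) h * indicator {h. norm h \<le> R} h \<partial>lborel)
    \<le> ennreal (R powr a / a * (K_const DIM('a) q * sphere_area DIM('a))) * (\<integral>\<^sup>+x. ennreal (norm (g x) powr q) * indicator \<Omega> x \<partial>lborel)"
proof -
  let ?w = "\<lambda>h::'a. radial_weight (q - a) h * indicator {h. norm h \<le> R} h"
  have le: "increment_pow \<Omega> q u h \<le> (\<integral>\<^sup>+x. ennreal (\<bar>g x \<bullet> h\<bar> powr q) * indicator \<Omega> x \<partial>lborel)" for h
    using cone[of h]
  proof
    assume "- h \<in> translation_cone \<Omega>"
    from increment_pow_le_gradient[OF this q] show ?thesis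
      by (simp add: increment_pow_uminus[OF \<Omega>_borel u_borel])
  qed (rule increment_pow_le_gradient[OF _ q])
  have "(\<integral>\<^sup>+h. increment_pow \<Omega> q u h * radial_weight (q - a) h * indicator {h. norm h \<le> R} h \<partial>lborel)
    \<le> (\<integral>\<^sup>+h. (\<integral>\<^sup>+x. ennreal (\<bar>g x \<bullet> h\<bar> powr q) * indicator \<Omega> x * ?w h \<partial>lborel) \<partial>lborel)"
  proof (intro nn_integral_mono)
    fix h :: 'a
    have "(\<integral>\<^sup>+x. ennreal (\<bar>g x \<bullet> h\<bar> powr q) * indicator \<Omega> x * ?w h \<partial>lborel)
       = (\<integral>\<^sup>+x. ennreal (\<bar>g x \<bullet> h\<bar> powr q) * indicator \<Omega> x \<partial>lborel) * ?w h"
      by (rule nn_integral_multc) measurable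
    then show "increment_pow \<Omega> q u h * radial_weight (q - a) h * indicator {h. norm h \<le> R} h
       \<le> (\<integral>\<^sup>+x. ennreal (\<bar>g x \<bullet> h\<bar> powr q) * indicator \<Omega> x * ?w h \<partial>lborel)"
      using mult_right_mono[OF le[of h], of "?w h"] by (simp only: mult.assoc) simp
  qed
  also have "\<dots> = (\<integral>\<^sup>+x. (\<integral>\<^sup>+h. ennreal (\<bar>g x \<bullet> h\<bar> powr q) * indicator \<Omega> x * ?w h \<partial>lborel) \<partial>lborel)"
    by (rule lborel_pair.Fubini') measurable
  also have "\<dots> = (\<integral>\<^sup>+x. indicator \<Omega> x * (\<integral>\<^sup>+h. ennreal (\<bar>g x \<bullet> h\<bar> powr q) * radial_weight (q - a) h * indicator {h. norm h \<le> R} h \<partial>lborel) \<partial>lborel)"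
    by (intro nn_integral_cong, subst nn_integral_cmult[symmetric]) (auto intro!: nn_integral_cong simp: ac_simps)
  also have "\<dots> \<le> (\<integral>\<^sup>+x. indicator \<Omega> x * (ennreal (R powr a / a * (K_const DIM('a) q * sphere_area DIM('a))) * ennreal (norm (g x) powr q)) \<partial>lborel)"
    using assms by (intro nn_integral_mono mult_left_mono nn_integral_inner_powr_weight) auto
  also have "\<dots> = ennreal (R powr a / a * (K_const DIM('a) q * sphere_area DIM('a))) * (\<integral>\<^sup>+x. ennreal (norm (g x) powr q) * indicator \<Omega> x \<partial>lborel)"
    by (subst nn_integral_cmult[symmetric]) (auto intro!: nn_integral_cong simp: ac_simps)
  finally show ?thesis .
qed

end

section \<open>Borel representatives of weak gradients\<close>

lemma test_fun_partial_deriv: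
  assumes "test_fun \<Omega> \<phi>" "b \<in> Basis"
  shows "\<phi> \<in> borel_measurable borel" "partial_deriv b \<phi> \<in> borel_measurable borel"
    and "x \<notin> \<Omega> \<Longrightarrow> \<phi> x = 0" "x \<notin> \<Omega> \<Longrightarrow> partial_deriv b \<phi> x = 0"
proof -
  have "Ck 0 \<phi>" "Ck (Suc 0) \<phi>" using assms(1) by (auto simp: test_fun_def)
  then show "\<phi> \<in> borel_measurable borel" "partial_deriv b \<phi> \<in> borel_measurable borel"
    using assms(2) by (auto intro: borel_measurable_continuous_onI)
  define S where "S = closure {x. \<phi> x \<noteq> 0}"
  have S: "S \<subseteq> \<Omega>" "closed S" "\<And>y. y \<notin> S \<Longrightarrow> \<phi> y = 0"
    using assms(1) closure_subset[of "{x. \<phi> x \<noteq> 0}"] by (auto simp: test_fun_def S_def)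
  then show "x \<notin> \<Omega> \<Longrightarrow> \<phi> x = 0" by auto
  assume "x \<notin> \<Omega>"
  have "(\<phi> has_derivative (\<lambda>_. 0)) (at x)"
  proof (rule has_derivative_transform_within_open[where s = "- S"])
    show "0 = \<phi> y" if "y \<in> - S" for y using that S(3) by auto
  qed (use S \<open>x \<notin> \<Omega>\<close> in auto)
  then show "partial_deriv b \<phi> x = 0"
    unfolding partial_deriv_def by (metis frechet_derivative_at)
qed

text \<open>The values of g off \<Omega> are arbitrary, so a Borel version is taken of g times the
  indicator of \<Omega>, coordinate by coordinate.\<close>

lemma weak_gradient_borel_representative:
  fixes \<Omega> :: "'a::euclidean_space set" and u u' :: "'a \<Rightarrow> real"
  assumes "open \<Omega>" and wg: "weak_gradient \<Omega> u g"
    and u: "u \<in> borel_measurable lebesgue"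
    and u' [measurable]: "u' \<in> borel_measurable borel" and ae: "AE x in lborel. u x = u' x"
  obtains g' where "borel_weak_gradient \<Omega> u' g'" "AE x in lborel. x \<in> \<Omega> \<longrightarrow> g x = g' x"
proof -
  have [measurable]: "\<Omega> \<in> sets borel" using \<open>open \<Omega>\<close> by simp
  have loc: "\<And>K. compact K \<Longrightarrow> K \<subseteq> \<Omega> \<Longrightarrow> integrable lebesgue (\<lambda>x. indicator K x *\<^sub>R u x)"
    "\<And>K. compact K \<Longrightarrow> K \<subseteq> \<Omega> \<Longrightarrow> integrable lebesgue (\<lambda>x. indicator K x *\<^sub>R g x)"
    using wg by (auto simp: weak_gradient_def loc_integrable_def set_integrable_def)
  \<comment> \<open>Local integrability gives measurability only on compact subsets; a compact
    exhaustion transfers it to \<Omega> as a pointwise limit.\<close>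
  obtain C :: "nat \<Rightarrow> 'a set" where C: "\<And>n. compact (C n)" "\<And>n. C n \<subseteq> \<Omega>" "\<And>n. C n \<subseteq> interior (C (Suc n))" "\<Union>(range C) = \<Omega>"
    using open_Union_compact_subsets[OF \<open>open \<Omega>\<close>] by metis
  have "mono C"
    using C(3) interior_subset by (intro incseq_SucI) blast
  have lim: "(\<lambda>n. indicator (C n) x *\<^sub>R g x) \<longlonglongrightarrow> indicator \<Omega> x *\<^sub>R g x" for x
  proof (intro tendsto_scaleR tendsto_const)
    show "(\<lambda>n. indicator (C n) x :: real) \<longlonglongrightarrow> indicator \<Omega> x"
      using LIMSEQ_indicator_incseq[OF \<open>mono C\<close>, of x] C(4) by simp
  qed
  have g_meas: "(\<lambda>x. indicator \<Omega> x *\<^sub>R g x) \<in> borel_measurable lebesgue"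
    using lim by (rule borel_measurable_LIMSEQ_metric[rotated]) (rule borel_measurable_integrable[OF loc(2)[OF C(1,2)]])
  have "\<forall>b. \<exists>f\<in>borel_measurable lborel. AE x in lborel. (indicator \<Omega> x *\<^sub>R g x) \<bullet> b = f x"
    by (intro allI completion_ex_borel_measurable_real borel_measurable_inner g_meas) auto
  then obtain f where f: "\<And>b. f b \<in> borel_measurable lborel" "\<And>b. AE x in lborel. (indicator \<Omega> x *\<^sub>R g x) \<bullet> b = f b x"
    by metis
  define g' where "g' x = (\<Sum>b\<in>Basis. f b x *\<^sub>R b)" for x
  have [measurable]: "g' \<in> borel_measurable borel"
    unfolding g'_def using f(1) by simp
  have "AE x in lborel. \<forall>b\<in>Basis. (indicator \<Omega> x *\<^sub>R g x) \<bullet> b = f b x"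
    using f(2) by (intro AE_finite_allI) auto
  then have g'_ae: "AE x in lborel. indicator \<Omega> x *\<^sub>R g x = g' x"
  proof eventually_elim
    case (elim x)
    then show ?case
      unfolding g'_def by (subst euclidean_representation[symmetric]) (auto intro: sum.cong)
  qed
  then have ae_g: "AE x in lborel. x \<in> \<Omega> \<longrightarrow> g x = g' x"
    by eventually_elim auto
  have [measurable]: "u \<in> borel_measurable lebesgue" by fact
  have "borel_weak_gradient \<Omega> u' g'"
  proof
    show "open \<Omega>" "u' \<in> borel_measurable borel" "g' \<in> borel_measurable borel" by fact+
    fix K assume K: "compact K" "K \<subseteq> \<Omega>"
    have [measurable]: "K \<in> sets borel" using K by (simp add: borel_compact)
    have "integrable lebesgue (\<lambda>x. indicator K x * u' x)"
    proof (rule integrable_cong_AE_imp[OF loc(1)[OF K]])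
      show "AE x in lebesgue. indicator K x *\<^sub>R u x = indicator K x * u' x"
        using AE_completion[OF ae] by eventually_elim auto
    qed (simp add: measurable_completion)
    then show "integrable lborel (\<lambda>x. indicator K x * u' x)"
      by (subst (asm) integrable_completion) auto
    have "integrable lebesgue (\<lambda>x. indicator K x *\<^sub>R g' x)"
    proof (rule integrable_cong_AE_imp[OF loc(2)[OF K]])
      show "AE x in lebesgue. indicator K x *\<^sub>R g x = indicator K x *\<^sub>R g' x"
        using AE_completion[OF ae_g] by eventually_elim (use K in \<open>auto simp: indicator_def\<close>)
    qed (simp add: measurable_completion)
    then show "integrable lborel (\<lambda>x. indicator K x *\<^sub>R g' x)"
      by (subst (asm) integrable_completion) auto
  next
    fix \<phi> and b :: 'a assume \<phi>: "test_fun \<Omega> \<phi>" "b \<in> Basis"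
    note t [measurable] = test_fun_partial_deriv(1,2)[OF \<phi>] and out = test_fun_partial_deriv(3,4)[OF \<phi>]
    have "(LINT x|lebesgue_on \<Omega>. u x * partial_deriv b \<phi> x) = (LINT x|lebesgue. indicator \<Omega> x *\<^sub>R (u x * partial_deriv b \<phi> x))"
      by (rule integral_restrict_space) simp
    also have "\<dots> = (LINT x|lebesgue. u' x * partial_deriv b \<phi> x)"
    proof (rule Bochner_Integration.integral_cong_AE)
      show "AE x in lebesgue. indicator \<Omega> x *\<^sub>R (u x * partial_deriv b \<phi> x) = u' x * partial_deriv b \<phi> x"
        using AE_completion[OF ae] by eventually_elim (auto simp: indicator_def out)
      have "partial_deriv b \<phi> \<in> borel_measurable lebesgue" "indicator \<Omega> \<in> borel_measurable lebesgue"
        by (auto intro: measurable_completion)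
      then show "(\<lambda>x. indicator \<Omega> x *\<^sub>R (u x * partial_deriv b \<phi> x)) \<in> borel_measurable lebesgue"
        using u by measurable
      show "(\<lambda>x. u' x * partial_deriv b \<phi> x) \<in> borel_measurable lebesgue"
        by (rule measurable_completion) measurable
    qed
    also have "\<dots> = (LINT x|lborel. u' x * partial_deriv b \<phi> x)"
      by (rule integral_completion) measurable
    finally have 1: "(LINT x|lebesgue_on \<Omega>. u x * partial_deriv b \<phi> x) = (LINT x|lborel. u' x * partial_deriv b \<phi> x)" .
    have "(LINT x|lebesgue_on \<Omega>. (g x \<bullet> b) * \<phi> x) = (LINT x|lebesgue. indicator \<Omega> x *\<^sub>R ((g x \<bullet> b) * \<phi> x))"
      by (rule integral_restrict_space) simp
    also have "\<dots> = (LINT x|lebesgue. ((indicator \<Omega> x *\<^sub>R g x) \<bullet> b) * \<phi> x)"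
      by (simp add: mult.assoc)
    also have "\<dots> = (LINT x|lebesgue. (g' x \<bullet> b) * \<phi> x)"
    proof (rule Bochner_Integration.integral_cong_AE)
      show "AE x in lebesgue. ((indicator \<Omega> x *\<^sub>R g x) \<bullet> b) * \<phi> x = (g' x \<bullet> b) * \<phi> x"
        using AE_completion[OF g'_ae] by eventually_elim simp
      have "\<phi> \<in> borel_measurable lebesgue" by (auto intro: measurable_completion)
      then show "(\<lambda>x. ((indicator \<Omega> x *\<^sub>R g x) \<bullet> b) * \<phi> x) \<in> borel_measurable lebesgue"
        using g_meas by measurable
      show "(\<lambda>x. (g' x \<bullet> b) * \<phi> x) \<in> borel_measurable lebesgue"
        by (rule measurable_completion) measurable
    qed
    also have "\<dots> = (LINT x|lborel. (g' x \<bullet> b) * \<phi> x)"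
      by (rule integral_completion) measurable
    finally have 2: "(LINT x|lebesgue_on \<Omega>. (g x \<bullet> b) * \<phi> x) = (LINT x|lborel. (g' x \<bullet> b) * \<phi> x)" .
    show "(LINT x|lborel. u' x * partial_deriv b \<phi> x) = - (LINT x|lborel. (g' x \<bullet> b) * \<phi> x)"
      using wg \<phi> 1 2 by (simp add: weak_gradient_def)
  qed
  then show ?thesis using ae_g that by blast
qed

text \<open>Passes from each weak gradient to the infimum. Without any weak gradient the infimum
  over the empty set is \<infinity>, and c > 0 makes the bound trivial.\<close>

lemma small_increments_grad_pow_bound:
  fixes \<Omega> :: "'a::euclidean_space set" and u u' :: "'a \<Rightarrow> real"
  assumes "open \<Omega>" and cone: "\<And>h. h \<in> translation_cone \<Omega> \<or> - h \<in> translation_cone \<Omega>"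
    and u: "u \<in> borel_measurable lebesgue" "u' \<in> borel_measurable borel" "AE x in lborel. u x = u' x"
    and q: "q \<ge> 1" and a: "0 < a" "a \<le> q" "0 < R"
  shows "(\<integral>\<^sup>+h. increment_pow \<Omega> q u' h * radial_weight (q - a) h * indicator {h. norm h \<le> R} h \<partial>lborel)
    \<le> ennreal (R powr a / a * (K_const DIM('a) q * sphere_area DIM('a))) * grad_pow \<Omega> q u"
    (is "?I \<le> ennreal ?c * _")
proof -
  have "?c > 0"
    using q a by (simp add: K_const_pos sphere_area_pos)
  have "?I \<le> ennreal ?c * Lp_pow \<Omega> q g" if wg: "weak_gradient \<Omega> u g" for g
  proof -
    obtain g' where g': "borel_weak_gradient \<Omega> u' g'" "AE x in lborel. x \<in> \<Omega> \<longrightarrow> g x = g' x"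
      using weak_gradient_borel_representative[OF \<open>open \<Omega>\<close> wg u] by blast
    have "Lp_pow \<Omega> q g = (\<integral>\<^sup>+x. ennreal (norm (g' x) powr q) * indicator \<Omega> x \<partial>lborel)"
      unfolding Lp_pow_def using \<open>open \<Omega>\<close> g'(2)
      by (subst nn_integral_lebesgue_on) (auto intro!: nn_integral_cong_AE elim!: eventually_mono simp: indicator_def)
    then show ?thesis
      using borel_weak_gradient.small_increments_gradient_bound[OF g'(1) cone q a] by simp
  qed
  \<comment> \<open>Dividing by the positive constant avoids commuting it with the infimum.\<close>
  then have "?I / ennreal ?c \<le> Lp_pow \<Omega> q g" if "weak_gradient \<Omega> u g" for g
    using that \<open>?c > 0\<close> by (intro divide_le_posI_ennreal) (auto simp: mult.commute)
  then have "?I / ennreal ?c \<le> grad_pow \<Omega> q u"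
    unfolding grad_pow_def by (intro INF_greatest) auto
  then have "ennreal ?c * (?I / ennreal ?c) \<le> ennreal ?c * grad_pow \<Omega> q u"
    by (rule mult_left_mono) simp
  moreover have "ennreal ?c * (?I / ennreal ?c) = ?I"
    unfolding ennreal_times_divide mult.commute[of "ennreal ?c"]
    using \<open>?c > 0\<close> by (intro mult_divide_eq_ennreal) auto
  ultimately show ?thesis by simp
qed

section \<open>The case of infinite exponent\<close>

lemma AE_lebesgue_on_iff:
  assumes "\<Omega> \<in> sets borel"
  shows "(AE x in lebesgue_on \<Omega>. P x) \<longleftrightarrow> (AE x in lborel. x \<in> \<Omega> \<longrightarrow> P x)"
  using assms by (subst AE_restrict_space_iff) (auto simp: AE_completion_iff)

lemma AE_open_ex:
  assumes "open S" "S \<noteq> {}" "AE x in lborel. P x"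
  obtains x :: "'a::euclidean_space" where "x \<in> S" "P x"
proof (rule ccontr)
  assume "\<not> thesis"
  then have "\<forall>x\<in>S. \<not> P x" using that by blast
  then have "AE x\<in>S in lebesgue. x \<in> {}"
    using assms(3) by (subst AE_completion_iff) (auto elim!: eventually_mono)
  moreover obtain x where "x \<in> S" using assms(2) by blast
  ultimately show False
    using mem_closed_if_AE_lebesgue_open[OF \<open>open S\<close> closed_empty] by blast
qed

text \<open>
  For \<open>t = 0\<close> the bound on the diagonal is \<open>0\<close>, since \<open>0 powr 0 = 0\<close>; this is harmless.
\<close>

definition ae_holder :: "'a::euclidean_space set \<Rightarrow> real \<Rightarrow> real \<Rightarrow> ('a \<Rightarrow> real) \<Rightarrow> bool" where
  "ae_holder \<Omega> t C u \<longleftrightarrow> (\<exists>X. (AE x in lborel. x \<in> \<Omega> \<longrightarrow> x \<in> X) \<and>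
     (\<forall>x\<in>X. \<forall>y\<in>X. \<bar>u x - u y\<bar> \<le> C * norm (x - y) powr t))"

text \<open>For t \<le> 1 the power |x - y|^t is again a metric, and u is C-Lipschitz for it on X,
  so it extends with the same C. This turns a bound off a null set into the representative that
  \<open>Winf_seminorm\<close> asks for.\<close>

lemma holder_extension:
  fixes u :: "'a::real_normed_vector \<Rightarrow> real"
  assumes "0 < t" "t \<le> 1" "C \<ge> 0"
    and u: "\<And>x y. x \<in> X \<Longrightarrow> y \<in> X \<Longrightarrow> \<bar>u x - u y\<bar> \<le> C * norm (x - y) powr t"
  obtains v where "\<And>x. x \<in> X \<Longrightarrow> v x = u x" "\<And>x y. \<bar>v x - v y\<bar> \<le> C * norm (x - y) powr t"
proof (cases "X = {}")
  case True
  then show ?thesis using that[of "\<lambda>_. 0"] \<open>C \<ge> 0\<close> by simp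
next
  case False
  have tri: "norm (x - z) powr t \<le> norm (x - y) powr t + norm (y - z) powr t" for x y z :: 'a
  proof -
    have "norm (x - z) powr t \<le> (norm (x - y) + norm (y - z)) powr t"
      using \<open>0 < t\<close> norm_triangle_ineq[of "x - y" "y - z"] by (intro powr_mono2) auto
    also have "\<dots> \<le> norm (x - y) powr t + norm (y - z) powr t"
    proof -
      let ?a = "norm (x - y)" and ?b = "norm (y - z)"
      show ?thesis
      proof (cases "?a + ?b = 0")
        case False
        then have pos: "?a + ?b > 0" by (metis add_nonneg_nonneg less_eq_real_def norm_ge_zero)
        \<comment> \<open>Applied to the shares a/(a+b) and b/(a+b), which sum to 1, this gives
          subadditivity.\<close>
        have *: "r \<le> r powr t" if "0 \<le> r" "r \<le> 1" for r :: real
          using that powr_mono'[of t 1 r] \<open>t \<le> 1\<close> by simp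
        have "(?a + ?b) powr t * (?a / (?a + ?b) + ?b / (?a + ?b))
           \<le> (?a + ?b) powr t * ((?a / (?a + ?b)) powr t + (?b / (?a + ?b)) powr t)"
          using pos by (intro mult_left_mono add_mono *) auto
        also have "\<dots> = ?a powr t + ?b powr t"
          using pos by (simp add: powr_divide distrib_left)
        finally show ?thesis using pos by (simp flip: add_divide_distrib)
      qed (simp add: add_nonneg_eq_0_iff)
    qed
    finally show ?thesis .
  qed
  \<comment> \<open>McShane's extension\<close>
  define v where "v x = (INF z\<in>X. u z + C * norm (x - z) powr t)" for x
  have bdd: "bdd_below ((\<lambda>z. u z + C * norm (x - z) powr t) ` X)" for x
  proof -
    obtain z0 where "z0 \<in> X" using False by blast
    have "u z0 - C * norm (x - z0) powr t \<le> u z + C * norm (x - z) powr t" if "z \<in> X" for z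
    proof -
      have "u z0 - u z \<le> C * norm (z0 - z) powr t"
        using u[OF \<open>z0 \<in> X\<close> that] by linarith
      also have "\<dots> \<le> C * (norm (z0 - x) powr t + norm (x - z) powr t)"
        using tri[of z0 z x] \<open>C \<ge> 0\<close> by (intro mult_left_mono) auto
      finally show ?thesis
        by (simp add: algebra_simps norm_minus_commute)
    qed
    then show ?thesis by (intro bdd_belowI2)
  qed
  have le: "v x - v y \<le> C * norm (x - y) powr t" for x y
  proof -
    have "v x - C * norm (x - y) powr t \<le> u z + C * norm (y - z) powr t" if "z \<in> X" for z
    proof -
      have "v x \<le> u z + C * norm (x - z) powr t"
        unfolding v_def by (rule cINF_lower[OF bdd that])
      also have "C * norm (x - z) powr t \<le> C * (norm (x - y) powr t + norm (y - z) powr t)"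
        using tri[of x z y] \<open>C \<ge> 0\<close> by (intro mult_left_mono) auto
      finally show ?thesis by (simp add: algebra_simps)
    qed
    then have "v x - C * norm (x - y) powr t \<le> v y"
      unfolding v_def[of y] using False by (intro cINF_greatest)
    then show ?thesis by simp
  qed
  show ?thesis
  proof (rule that)
    fix x assume "x \<in> X"
    have "v x \<le> u x + C * norm (x - x) powr t"
      unfolding v_def by (rule cINF_lower[OF bdd \<open>x \<in> X\<close>])
    moreover have "u x \<le> v x"
      unfolding v_def
    proof (rule cINF_greatest[OF False])
      fix z assume "z \<in> X"
      show "u x \<le> u z + C * norm (x - z) powr t" using u[OF \<open>x \<in> X\<close> \<open>z \<in> X\<close>] by linarith
    qed
    ultimately show "v x = u x" by simp
  next
    fix x y
    show "\<bar>v x - v y\<bar> \<le> C * norm (x - y) powr t"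
      using le[of x y] le[of y x] by (simp add: abs_le_iff norm_minus_commute)
  qed
qed

lemma Winf_seminorm_le_if_ae_holder:
  assumes "\<Omega> \<in> sets borel" "0 < t" "t < 1" "C \<ge> 0" "ae_holder \<Omega> t C u"
  shows "Winf_seminorm \<Omega> t u \<le> ennreal C"
proof -
  obtain X where X: "AE x in lborel. x \<in> \<Omega> \<longrightarrow> x \<in> X"
    "\<And>x y. x \<in> X \<Longrightarrow> y \<in> X \<Longrightarrow> \<bar>u x - u y\<bar> \<le> C * norm (x - y) powr t"
    using assms(5) unfolding ae_holder_def by blast
  obtain v where v: "\<And>x. x \<in> X \<Longrightarrow> v x = u x" "\<And>x y. \<bar>v x - v y\<bar> \<le> C * norm (x - y) powr t"
    using holder_extension[of t C X u] assms X(2) by (metis less_imp_le)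
  have ae: "AE x in lebesgue_on \<Omega>. v x = u x"
    unfolding AE_lebesgue_on_iff[OF assms(1)] using X(1) v(1) by (auto elim!: eventually_mono)
  have "(SUP (x, y)\<in>{(x, y). x \<in> \<Omega> \<and> y \<in> \<Omega> \<and> x \<noteq> y}. ennreal (\<bar>v x - v y\<bar> / norm (x - y) powr t)) \<le> ennreal C"
    using v(2) by (intro SUP_least) (auto simp: divide_le_eq intro!: ennreal_leI)
  moreover have "Winf_seminorm \<Omega> t u \<le> (SUP (x, y)\<in>{(x, y). x \<in> \<Omega> \<and> y \<in> \<Omega> \<and> x \<noteq> y}. ennreal (\<bar>v x - v y\<bar> / norm (x - y) powr t))"
    using assms ae by (auto simp: Winf_seminorm_def intro!: INF_lower)
  ultimately show ?thesis by (rule order_trans[rotated])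
qed

text \<open>The strict inequality selects a representative v below C, as an infimum need not be
  attained; u inherits the bound where it equals v.\<close>

lemma ae_holder_if_Winf_seminorm_less:
  assumes "\<Omega> \<in> sets borel" "0 < t" "t < 1" "C > 0" "Winf_seminorm \<Omega> t u < ennreal C"
  shows "ae_holder \<Omega> t C u"
proof -
  have "(INF v\<in>{v. AE x in lebesgue_on \<Omega>. v x = u x}.
      SUP (x, y)\<in>{(x, y). x \<in> \<Omega> \<and> y \<in> \<Omega> \<and> x \<noteq> y}. ennreal (\<bar>v x - v y\<bar> / norm (x - y) powr t)) < ennreal C"
    using assms by (simp add: Winf_seminorm_def)
  then obtain v where v: "AE x in lebesgue_on \<Omega>. v x = u x"
    "(SUP (x, y)\<in>{(x, y). x \<in> \<Omega> \<and> y \<in> \<Omega> \<and> x \<noteq> y}. ennreal (\<bar>v x - v y\<bar> / norm (x - y) powr t)) < ennreal C"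
    unfolding INF_less_iff by blast
  have "\<bar>v x - v y\<bar> \<le> C * norm (x - y) powr t" if "x \<in> \<Omega>" "y \<in> \<Omega>" for x y
  proof (cases "x = y")
    case False
    have "ennreal (\<bar>v x - v y\<bar> / norm (x - y) powr t) \<le> ennreal C"
      using SUP_upper[of "(x, y)" "{(x, y). x \<in> \<Omega> \<and> y \<in> \<Omega> \<and> x \<noteq> y}" "\<lambda>(x, y). ennreal (\<bar>v x - v y\<bar> / norm (x - y) powr t)"]
        v(2) that False by (simp add: order.trans[OF _ less_imp_le])
    then have "\<bar>v x - v y\<bar> / norm (x - y) powr t \<le> C"
      using \<open>C > 0\<close> by (simp add: ennreal_le_iff)
    then show ?thesis using False by (simp add: divide_le_eq)
  qed simp
  then have "\<bar>u x - u y\<bar> \<le> C * norm (x - y) powr t"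
    if "x \<in> {x\<in>\<Omega>. v x = u x}" "y \<in> {x\<in>\<Omega>. v x = u x}" for x y
    using that by (metis (mono_tags, lifting) mem_Collect_eq)
  then show ?thesis
    using v(1) unfolding ae_holder_def AE_lebesgue_on_iff[OF assms(1)]
    by (intro exI[of _ "{x\<in>\<Omega>. v x = u x}"]) (auto elim!: eventually_mono)
qed

lemma ae_holder_cong_AE:
  assumes "ae_holder \<Omega> t C u'" "AE x in lborel. u x = u' x"
  shows "ae_holder \<Omega> t C u"
proof -
  obtain X where "AE x in lborel. x \<in> \<Omega> \<longrightarrow> x \<in> X" "\<forall>x\<in>X. \<forall>y\<in>X. \<bar>u' x - u' y\<bar> \<le> C * norm (x - y) powr t"
    using assms(1) unfolding ae_holder_def by blast
  then show ?thesis
    using assms(2) unfolding ae_holder_def by (intro exI[of _ "{x\<in>X. u x = u' x}"]) auto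
qed

text \<open>
  The third condition ensures that one of any two points of \<open>\<Omega>\<close> has increments in \<open>H\<close> that are also
  increments in \<open>H\<close> from the other point, so both can be compared with a common third point nearby.
\<close>

definition increment_cone :: "'a::euclidean_space set \<Rightarrow> 'a set \<Rightarrow> bool" where
  "increment_cone \<Omega> H \<longleftrightarrow> open H \<and> H \<subseteq> translation_cone \<Omega> \<and>
     (\<forall>d. (\<forall>k\<in>H. k + d \<in> H) \<or> (\<forall>k\<in>H. k - d \<in> H)) \<and> (\<forall>\<epsilon>>0. H \<inter> ball 0 \<epsilon> \<noteq> {})"

text \<open>By Fubini, for almost every x the segment from x to x + h meets the null set where |g| >
  C only in a null set of parameters t.\<close>

lemma (in borel_weak_gradient) increment_le_gradient_sup:
  assumes h: "h \<in> translation_cone \<Omega>" and bound: "AE x in lborel. x \<in> \<Omega> \<longrightarrow> norm (g x) \<le> C"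
  shows "AE x in lborel. x \<in> \<Omega> \<longrightarrow> \<bar>u (x + h) - u x\<bar> \<le> C * norm h"
proof -
  define B where "B = {x\<in>\<Omega>. C < norm (g x)}"
  have [measurable]: "B \<in> sets borel" unfolding B_def by measurable
  have "AE x in lborel. x \<notin> B"
    using bound by eventually_elim (auto simp: B_def)
  then have B0: "(\<integral>\<^sup>+x. indicator B x \<partial>lborel) = 0"
    by (subst nn_integral_0_iff_AE) (auto elim!: eventually_mono simp: indicator_def)
  have "(\<integral>\<^sup>+x. (\<integral>\<^sup>+t. indicator {0..1} t * indicator B (x + t *\<^sub>R h) \<partial>lborel) \<partial>lborel)
     = (\<integral>\<^sup>+t. (\<integral>\<^sup>+x. indicator {0..1} t * indicator B (x + t *\<^sub>R h) \<partial>lborel) \<partial>lborel)"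
    by (rule lborel_pair.Fubini'[symmetric]) measurable
  also have "\<dots> = (\<integral>\<^sup>+t. 0 \<partial>(lborel :: real measure))"
  proof (intro nn_integral_cong)
    fix t :: real
    have "(\<integral>\<^sup>+x. indicator B (x + t *\<^sub>R h) \<partial>lborel) = (\<integral>\<^sup>+x. indicator B x \<partial>lborel)"
      by (rule nn_integral_lborel_shift) measurable
    then show "(\<integral>\<^sup>+x. indicator {0..1} t * indicator B (x + t *\<^sub>R h) \<partial>lborel) = 0"
      by (simp add: nn_integral_cmult B0)
  qed
  finally have "(\<integral>\<^sup>+x. (\<integral>\<^sup>+t. indicator {0..1} t * indicator B (x + t *\<^sub>R h) \<partial>lborel) \<partial>lborel) = 0"
    by simp
  then have "AE x in lborel. (\<integral>\<^sup>+t. indicator {0..1} t * indicator B (x + t *\<^sub>R h) \<partial>lborel) = 0"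
    by (subst (asm) nn_integral_0_iff_AE) auto
  then show ?thesis
    using increment_eq_gradient_integral[OF h]
  proof eventually_elim
    case (elim x)
    show ?case
    proof
      assume "x \<in> \<Omega>"
      let ?f = "\<lambda>t. indicator {0..1} t * (g (x + t *\<^sub>R h) \<bullet> h)"
      have "AE t in lborel. indicator {0..1} t * indicator B (x + t *\<^sub>R h) = (0 :: ennreal)"
        using elim(1) by (subst (asm) nn_integral_0_iff_AE) auto
      then have le: "AE t in lborel. norm (?f t) \<le> indicator {0..1} t * (C * norm h)"
      proof eventually_elim
        case (elim t)
        show ?case
        proof (cases "t \<in> {0..1}")
          case True
          then have "x + t *\<^sub>R h \<in> \<Omega>" using h \<open>x \<in> \<Omega>\<close> by (auto simp: translation_cone_def)
          then have "norm (g (x + t *\<^sub>R h)) \<le> C"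
            using elim True by (auto simp: B_def indicator_def split: if_splits)
          then have "\<bar>g (x + t *\<^sub>R h) \<bullet> h\<bar> \<le> C * norm h"
            by (meson Cauchy_Schwarz_ineq2 mult_right_mono norm_ge_zero order_trans)
          then show ?thesis using True by simp
        qed simp
      qed
      have int: "integrable lborel (\<lambda>t::real. indicator {0..1} t * (C * norm h))" for C :: real
        by (intro integrable_mult_left integrable_real_indicator) auto
      have "integrable lborel ?f"
        by (rule Bochner_Integration.integrable_bound[OF int[of C]]) (use le in \<open>auto elim!: eventually_mono\<close>)
      then have "(LINT t|lborel. norm (?f t)) \<le> (LINT t|lborel. indicator {0..1} (t::real) * (C * norm h))"
        by (intro integral_mono_AE int le) auto
      then have "norm (LINT t|lborel. ?f t) \<le> (LINT t|lborel. indicator {0..1} (t::real) * (C * norm h))"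
        using integral_norm_bound[of lborel ?f] by linarith
      then show "\<bar>u (x + h) - u x\<bar> \<le> C * norm h"
        using elim(2) \<open>x \<in> \<Omega>\<close> by simp
    qed
  qed
qed

text \<open>For each h the increment bound fails on a null set of x depending on h. Fubini exchanges
  the quantifiers: for almost every x it holds for almost every h in H. Two such points are then
  compared through a common nearby third point.\<close>

lemma (in borel_weak_gradient) ae_lipschitz_if_gradient_bounded:
  assumes H: "increment_cone \<Omega> H" and bound: "AE x in lborel. x \<in> \<Omega> \<longrightarrow> norm (g x) \<le> C" and "C \<ge> 0"
  shows "ae_holder \<Omega> 1 C u"
proof -
  have H': "open H" "H \<subseteq> translation_cone \<Omega>" "\<And>d. (\<forall>k\<in>H. k + d \<in> H) \<or> (\<forall>k\<in>H. k - d \<in> H)"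
    "\<And>\<epsilon>. \<epsilon> > 0 \<Longrightarrow> H \<inter> ball 0 \<epsilon> \<noteq> {}"
    using H by (auto simp: increment_cone_def)
  have [measurable]: "H \<in> sets borel" using H'(1) by simp
  have "AE h in lborel. AE x in lborel. x \<in> \<Omega> \<and> h \<in> H \<longrightarrow> \<bar>u (x + h) - u x\<bar> \<le> C * norm h"
  proof (rule AE_I2)
    fix h
    show "AE x in lborel. x \<in> \<Omega> \<and> h \<in> H \<longrightarrow> \<bar>u (x + h) - u x\<bar> \<le> C * norm h"
    proof (cases "h \<in> H")
      case True
      then have "h \<in> translation_cone \<Omega>" using H'(2) by blast
      from increment_le_gradient_sup[OF this bound] show ?thesis
        by (auto elim!: eventually_mono)
    qed simp
  qed
  then have ae: "AE x in lborel. AE h in lborel. x \<in> \<Omega> \<and> h \<in> H \<longrightarrow> \<bar>u (x + h) - u x\<bar> \<le> C * norm h"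
    by (subst (asm) lborel_pair.AE_commute) measurable
  define X where "X = {x\<in>\<Omega>. AE h in lborel. h \<in> H \<longrightarrow> \<bar>u (x + h) - u x\<bar> \<le> C * norm h}"
  have one_sided: "\<bar>u y - u x\<bar> \<le> C * norm (y - x)"
    if "x \<in> X" "y \<in> X" and d: "\<forall>k\<in>H. k + (y - x) \<in> H" for x y
  proof (rule field_le_epsilon)
    fix \<epsilon> :: real assume "\<epsilon> > 0"
    define \<delta> where "\<delta> = \<epsilon> / (2 * (C + 1))"
    have "\<delta> > 0" using \<open>\<epsilon> > 0\<close> \<open>C \<ge> 0\<close> by (simp add: \<delta>_def)
    have "AE h in lborel. h \<in> H \<longrightarrow> \<bar>u (x + h) - u x\<bar> \<le> C * norm h" using that by (simp add: X_def)
    \<comment> \<open>Translating the exceptional set of x by y - x lets the increments from x and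
      from y be written with the same k.\<close>
    then have "AE h in distr lborel borel ((+) (y - x)). h \<in> H \<longrightarrow> \<bar>u (x + h) - u x\<bar> \<le> C * norm h"
      by (subst lborel_distr_plus)
    then have "AE k in lborel. (y - x) + k \<in> H \<longrightarrow> \<bar>u (x + ((y - x) + k)) - u x\<bar> \<le> C * norm ((y - x) + k)"
      by (subst (asm) AE_distr_iff) auto
    moreover have "AE k in lborel. k \<in> H \<longrightarrow> \<bar>u (y + k) - u y\<bar> \<le> C * norm k" using that by (simp add: X_def)
    ultimately have "AE k in lborel. k \<in> H \<longrightarrow> \<bar>u (y + k) - u x\<bar> \<le> C * norm ((y - x) + k) \<and> \<bar>u (y + k) - u y\<bar> \<le> C * norm k"
      by eventually_elim (use d in \<open>auto simp: algebra_simps\<close>)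
    moreover have "open (H \<inter> ball 0 \<delta>)" using H'(1) by auto
    \<comment> \<open>The third point is y + k: both conditions hold for almost every k in H, and
      the nonempty open set of small k in H is not null.\<close>
    ultimately obtain k where "k \<in> H \<inter> ball 0 \<delta>"
      "k \<in> H \<longrightarrow> \<bar>u (y + k) - u x\<bar> \<le> C * norm ((y - x) + k) \<and> \<bar>u (y + k) - u y\<bar> \<le> C * norm k"
      using AE_open_ex[OF _ H'(4)[OF \<open>\<delta> > 0\<close>]] by blast
    then have k: "k \<in> H \<inter> ball 0 \<delta>" "\<bar>u (y + k) - u x\<bar> \<le> C * norm ((y - x) + k)" "\<bar>u (y + k) - u y\<bar> \<le> C * norm k"
      by auto
    have "\<bar>u y - u x\<bar> \<le> C * norm ((y - x) + k) + C * norm k" using k by linarith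
    also have "\<dots> \<le> C * (norm (y - x) + norm k) + C * norm k"
      using \<open>C \<ge> 0\<close> by (intro add_right_mono mult_left_mono norm_triangle_ineq) auto
    also have "\<dots> \<le> C * norm (y - x) + 2 * C * \<delta>"
      using k(1) \<open>C \<ge> 0\<close> by (simp add: distrib_left mult_left_mono)
    also have "2 * C * \<delta> \<le> \<epsilon>"
      using \<open>\<epsilon> > 0\<close> \<open>C \<ge> 0\<close> by (simp add: \<delta>_def field_simps)
    finally show "\<bar>u y - u x\<bar> \<le> C * norm (y - x) + \<epsilon>" by simp
  qed
  have "\<bar>u x - u y\<bar> \<le> C * norm (x - y) powr 1" if "x \<in> X" "y \<in> X" for x y
    using H'(3)[of "y - x"]
  proof
    assume "\<forall>k\<in>H. k + (y - x) \<in> H"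
    from one_sided[OF that this] show ?thesis by (simp add: norm_minus_commute abs_minus_commute)
  next
    assume "\<forall>k\<in>H. k - (y - x) \<in> H"
    then have "\<forall>k\<in>H. k + (x - y) \<in> H" by (simp add: algebra_simps)
    from one_sided[OF that(2,1) this] show ?thesis by simp
  qed
  moreover have "AE x in lborel. x \<in> \<Omega> \<longrightarrow> x \<in> X"
    using ae by eventually_elim (auto simp: X_def)
  ultimately show ?thesis unfolding ae_holder_def by blast
qed

lemma ae_holder_if_grad_inf_less:
  assumes "open \<Omega>" and H: "increment_cone \<Omega> H"
    and u: "u \<in> borel_measurable lebesgue" and "C > 0" "grad_inf \<Omega> u < ennreal C"
  shows "ae_holder \<Omega> 1 C u"
proof -
  have [measurable]: "\<Omega> \<in> sets borel" using \<open>open \<Omega>\<close> by simp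
  obtain g where wg: "weak_gradient \<Omega> u g" and "Linf_norm \<Omega> g < ennreal C"
    using assms(5) unfolding grad_inf_def INF_less_iff by blast
  then have "AE x in lebesgue_on \<Omega>. ennreal (norm (g x)) \<le> ennreal C"
    using esssup_AE[of "\<lambda>x. ennreal (norm (g x))" "lebesgue_on \<Omega>"]
    unfolding Linf_norm_def by (auto elim!: eventually_mono)
  then have g: "AE x in lborel. x \<in> \<Omega> \<longrightarrow> norm (g x) \<le> C"
    using \<open>C > 0\<close> by (simp add: AE_lebesgue_on_iff ennreal_le_iff)
  obtain u' where u': "u' \<in> borel_measurable lborel" "AE x in lborel. u x = u' x"
    using completion_ex_borel_measurable_real[OF u] by blast
  then obtain g' where g': "borel_weak_gradient \<Omega> u' g'" "AE x in lborel. x \<in> \<Omega> \<longrightarrow> g x = g' x"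
    using weak_gradient_borel_representative[OF \<open>open \<Omega>\<close> wg u] by auto
  have "AE x in lborel. x \<in> \<Omega> \<longrightarrow> norm (g' x) \<le> C"
    using g g'(2) by eventually_elim auto
  then have "ae_holder \<Omega> 1 C u'"
    using borel_weak_gradient.ae_lipschitz_if_gradient_bounded[OF g'(1) H] \<open>C > 0\<close> by simp
  then show ?thesis using u'(2) by (rule ae_holder_cong_AE)
qed

section \<open>Interpolation of Hoelder seminorms\<close>

lemma powr_interpolation:
  fixes x a b r :: real
  assumes "0 \<le> x" "0 \<le> r" "0 \<le> a" "0 \<le> b" "0 < \<theta>" "\<theta> < 1"
    and "x \<le> a * r powr s" "x \<le> b * r powr \<sigma>" "r = 0 \<Longrightarrow> x = 0"
  shows "x \<le> a powr \<theta> * b powr (1 - \<theta>) * r powr (\<theta> * s + (1 - \<theta>) * \<sigma>)"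
proof (cases "x = 0 \<or> r = 0")
  case False
  then have "x > 0" "r > 0" using assms by auto
  have "x = x powr \<theta> * x powr (1 - \<theta>)" using \<open>x > 0\<close> by (simp flip: powr_add)
  also have "\<dots> \<le> (a * r powr s) powr \<theta> * (b * r powr \<sigma>) powr (1 - \<theta>)"
    using assms by (intro mult_mono powr_mono2) auto
  also have "\<dots> = a powr \<theta> * b powr (1 - \<theta>) * r powr (\<theta> * s + (1 - \<theta>) * \<sigma>)"
    using assms by (simp add: powr_mult powr_powr powr_add ac_simps)
  finally show ?thesis .
qed (use assms in auto)

text \<open>On a common set of full measure the increment of u is interpolated geometrically between
  its two bounds, and the resulting Hoelder bound is extended to a representative.\<close>

lemma (in interpolation_exponents) Winf_seminorm_interpolation:
  fixes \<Omega> :: "'a::euclidean_space set"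
  assumes "open \<Omega>" and H: "increment_cone \<Omega> H" and u: "u \<in> borel_measurable lebesgue"
  shows "Winf_seminorm \<Omega> \<eta> u \<le> ennreal (N_const p \<sigma> \<eta> s) * Winf_seminorm \<Omega> s u epowr \<theta> * Winf_seminorm \<Omega> \<sigma> u epowr (1 - \<theta>)"
proof -
  let ?A = "Winf_seminorm \<Omega> s u" and ?B = "Winf_seminorm \<Omega> \<sigma> u" and ?E = "Winf_seminorm \<Omega> \<eta> u"
  let ?N = "N_const p \<sigma> \<eta> s"
  have \<Omega> [measurable]: "\<Omega> \<in> sets borel" using \<open>open \<Omega>\<close> by simp
  have \<eta>01: "0 < \<eta>" "\<eta> < 1" using \<sigma> \<eta> s by auto
  have holder_s: "ae_holder \<Omega> s a u" if "?A < ennreal a" "a > 0" for a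
  proof (cases "s = 1")
    case True
    then show ?thesis
      using ae_holder_if_grad_inf_less[OF \<open>open \<Omega>\<close> H u] that by (simp add: Winf_seminorm_def)
  next
    case False
    then show ?thesis
      using ae_holder_if_Winf_seminorm_less[OF \<Omega>, of s a u] that \<eta> s \<eta>01 by simp
  qed
  \<comment> \<open>For \<sigma> = 0 the oscillation is at most twice the supremum; the 2 becomes
    2^(1-\<theta>) and is absorbed by N.\<close>
  have holder_\<sigma>: "ae_holder \<Omega> \<sigma> ((if \<sigma> = 0 then 2 else 1) * b) u" if "?B < ennreal b" "b > 0" for b
  proof (cases "\<sigma> = 0")
    case True
    then have le: "esssup (lebesgue_on \<Omega>) (\<lambda>x. ennreal (norm (u x))) \<le> ennreal b"
      using that by (simp add: Winf_seminorm_def Linf_norm_def)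
    have "AE x in lebesgue_on \<Omega>. ennreal (norm (u x)) \<le> ennreal b"
      using esssup_AE[of "\<lambda>x. ennreal (norm (u x))" "lebesgue_on \<Omega>"]
    proof eventually_elim
      case (elim x)
      then show ?case using le by (rule order_trans)
    qed
    then have "AE x in lborel. x \<in> \<Omega> \<longrightarrow> \<bar>u x\<bar> \<le> b"
      using \<open>b > 0\<close> by (simp add: AE_lebesgue_on_iff ennreal_le_iff)
    moreover have "\<bar>u x - u y\<bar> \<le> 2 * b * norm (x - y) powr 0" if "\<bar>u x\<bar> \<le> b" "\<bar>u y\<bar> \<le> b" for x y
      using that by (cases "x = y") auto
    ultimately show ?thesis
      unfolding ae_holder_def using True
      by (intro exI[of _ "{x. \<bar>u x\<bar> \<le> b}"]) simp
  next
    case False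
    then show ?thesis
      using ae_holder_if_Winf_seminorm_less[OF \<Omega>, of \<sigma> b u] that \<sigma> \<eta>01 by simp
  qed
  have main: "?E \<le> ennreal (?N * a powr \<theta> * b powr (1 - \<theta>))"
    if ab: "?A < ennreal a" "a > 0" "?B < ennreal b" "b > 0" for a b
  proof -
    let ?c = "if \<sigma> = 0 then 2 else 1 :: real"
    obtain X where X: "AE x in lborel. x \<in> \<Omega> \<longrightarrow> x \<in> X"
      "\<And>x y. x \<in> X \<Longrightarrow> y \<in> X \<Longrightarrow> \<bar>u x - u y\<bar> \<le> a * norm (x - y) powr s"
      using holder_s[OF ab(1,2)] unfolding ae_holder_def by blast
    obtain Y where Y: "AE x in lborel. x \<in> \<Omega> \<longrightarrow> x \<in> Y"
      "\<And>x y. x \<in> Y \<Longrightarrow> y \<in> Y \<Longrightarrow> \<bar>u x - u y\<bar> \<le> (?c * b) * norm (x - y) powr \<sigma>"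
      using holder_\<sigma>[OF ab(3,4)] unfolding ae_holder_def by blast
    have "\<bar>u x - u y\<bar> \<le> a powr \<theta> * (?c * b) powr (1 - \<theta>) * norm (x - y) powr \<eta>" if "x \<in> X \<inter> Y" "y \<in> X \<inter> Y" for x y
      unfolding \<theta>(3) using that ab \<theta> X(2) Y(2) by (intro powr_interpolation) auto
    then have "ae_holder \<Omega> \<eta> (a powr \<theta> * (?c * b) powr (1 - \<theta>)) u"
      unfolding ae_holder_def using X(1) Y(1) by (intro exI[of _ "X \<inter> Y"]) auto
    then have "?E \<le> ennreal (a powr \<theta> * (?c * b) powr (1 - \<theta>))"
      by (intro Winf_seminorm_le_if_ae_holder \<Omega> \<eta>01) auto
    also have "a powr \<theta> * (?c * b) powr (1 - \<theta>) = ?c powr (1 - \<theta>) * a powr \<theta> * b powr (1 - \<theta>)"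
      using ab by (simp add: powr_mult)
    also have "?c powr (1 - \<theta>) \<le> ?N"
    proof (cases "\<sigma> = 0")
      case True
      have "(1 - \<theta>) * 1 \<le> (1 - \<theta>) * (\<eta> + 1 - \<sigma>)"
        using \<theta> \<sigma> by (intro mult_left_mono) auto
      then have "2 powr (1 - \<theta>) \<le> 2 powr ((1 - \<theta>) * (\<eta> + 1 - \<sigma>))"
        by (intro powr_mono) auto
      then have "2 powr (1 - \<theta>) \<le> ?N" using N_const_ge_exponent by linarith
      moreover have "?c powr (1 - \<theta>) = 2 powr (1 - \<theta>)" using True by simp
      ultimately show ?thesis by linarith
    qed (use N_const_ge_1 in simp)
    then have "ennreal (?c powr (1 - \<theta>) * a powr \<theta> * b powr (1 - \<theta>)) \<le> ennreal (?N * a powr \<theta> * b powr (1 - \<theta>))"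
      by (intro ennreal_leI mult_right_mono) auto
    finally show ?thesis .
  qed
  \<comment> \<open>With constants c/(n+1) for every n, u is constant on a set of full measure in
    \<Omega>.\<close>
  have zero: "?E = 0" if const: "\<And>n. ae_holder \<Omega> t (c / real (Suc n)) u" for t c
  proof -
    obtain X where X: "\<And>n. AE x in lborel. x \<in> \<Omega> \<longrightarrow> x \<in> X n"
      "\<And>n x y. x \<in> X n \<Longrightarrow> y \<in> X n \<Longrightarrow> \<bar>u x - u y\<bar> \<le> c / real (Suc n) * norm (x - y) powr t"
      using const unfolding ae_holder_def by metis
    have eq: "u x = u y" if xy: "\<And>n. x \<in> X n" "\<And>n. y \<in> X n" for x y
    proof -
      have "(\<lambda>n. c * norm (x - y) powr t * (1 / real (Suc n))) \<longlonglongrightarrow> c * norm (x - y) powr t * 0"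
        by (intro tendsto_intros LIMSEQ_Suc[OF lim_1_over_n])
      then have "\<bar>u x - u y\<bar> \<le> 0"
        using X(2)[OF xy] by (intro LIMSEQ_le_const[where X = "\<lambda>n. c * norm (x - y) powr t * (1 / real (Suc n))"]) auto
      then show ?thesis by simp
    qed
    have "AE x in lborel. \<forall>n. x \<in> \<Omega> \<longrightarrow> x \<in> X n"
      unfolding AE_all_countable using X(1) by blast
    then have "ae_holder \<Omega> \<eta> 0 u"
      unfolding ae_holder_def using eq
      by (intro exI[of _ "{x. \<forall>n. x \<in> X n}"]) (auto elim!: eventually_mono)
    then show ?thesis
      using Winf_seminorm_le_if_ae_holder[OF \<Omega> \<eta>01, of 0 u] by simp
  qed
  have small: "0 < ennreal (1 / real (Suc n))" for n by simp
  \<comment> \<open>A zero next to a finite value falls under the last case, where a limit handles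
    it; a zero next to \<infinity> requires that u be almost everywhere constant.\<close>
  consider "?A = 0" "?B = \<infinity>" | "?A = \<infinity>" "?B = 0" | "?A \<noteq> 0" "?B \<noteq> 0" "?A = \<infinity> \<or> ?B = \<infinity>" | "?A \<noteq> \<infinity>" "?B \<noteq> \<infinity>"
    by (cases "?A = 0"; cases "?B = 0") auto
  then show ?thesis
  proof cases
    case 1
    then have "ae_holder \<Omega> s (1 / real (Suc n)) u" for n
      using small[of n] by (intro holder_s) simp_all
    then show ?thesis using zero[of s 1] by simp
  next
    case 2
    then have "ae_holder \<Omega> \<sigma> ((if \<sigma> = 0 then 2 else 1) * (1 / real (Suc n))) u" for n
      using small[of n] by (intro holder_\<sigma>) simp_all
    then show ?thesis using zero[of \<sigma> "if \<sigma> = 0 then 2 else 1"] by simp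
  next
    case 3
    then have "ennreal ?N * ?A epowr \<theta> * ?B epowr (1 - \<theta>) = \<top>"
      using N_const_ge_1 by (auto simp: epowr_eq_0_iff ennreal_mult_eq_top_iff)
    then show ?thesis by simp
  next
    case 4
    then obtain a b where ab: "?A = ennreal a" "a \<ge> 0" "?B = ennreal b" "b \<ge> 0"
      by (metis ennreal_cases infinity_ennreal_def)
    \<comment> \<open>The Hoelder bounds require constants strictly above the seminorms, hence the
      additions of 1/(n+1), removed by continuity.\<close>
    have "?E \<le> ennreal (?N * (a + 1 / real (Suc n)) powr \<theta> * (b + 1 / real (Suc n)) powr (1 - \<theta>))" for n
    proof (rule main)
      show "?A < ennreal (a + 1 / real (Suc n))" "?B < ennreal (b + 1 / real (Suc n))"
        unfolding ab using ab by (simp_all add: ennreal_less_iff)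
    qed (use ab in \<open>auto intro: add_nonneg_pos\<close>)
    moreover have "(\<lambda>n. ennreal (?N * (a + 1 / real (Suc n)) powr \<theta> * (b + 1 / real (Suc n)) powr (1 - \<theta>)))
        \<longlonglongrightarrow> ennreal (?N * (a + 0) powr \<theta> * (b + 0) powr (1 - \<theta>))"
      using ab \<theta> by (intro tendsto_ennrealI tendsto_mult tendsto_const tendsto_powr2 tendsto_add LIMSEQ_Suc[OF lim_1_over_n]) auto
    ultimately have "?E \<le> ennreal (?N * (a + 0) powr \<theta> * (b + 0) powr (1 - \<theta>))"
      by (intro LIMSEQ_le_const) auto
    then show ?thesis
      using ab N_const_ge_1 by (simp add: epowr_ennreal ennreal_mult)
  qed
qed

section \<open>The constants\<close>

text \<open>Numerator and denominator change sign together at 1/2.\<close>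

lemma cos_ratio_pos:
  assumes "0 < t" "t < 1"
  shows "cos_ratio t > 0"
proof -
  consider "t < 1/2" | "t = 1/2" | "t > 1/2" by linarith
  then show ?thesis
  proof cases
    case 1
    then have "cos (t * pi) > 0"
      using assms by (intro cos_gt_zero) auto
    then show ?thesis using 1 by (simp add: cos_ratio_def)
  next
    case 3
    have "cos ((1 - t) * pi) > 0"
      using 3 assms by (intro cos_gt_zero) auto
    moreover have "cos ((1 - t) * pi) = - cos (t * pi)"
      by (simp add: left_diff_distrib cos_diff)
    ultimately have "cos (t * pi) < 0" by simp
    then show ?thesis using 3 by (simp add: cos_ratio_def divide_neg_neg)
  qed (simp add: cos_ratio_def)
qed

lemma C_const_pos:
  assumes "d > 0" "p > 0" "0 < t" "t < 1"
  shows "C_const d p t > 0"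
  using assms cos_ratio_pos[of t] unfolding C_const_def
  by (intro divide_pos_pos mult_pos_pos Gamma_real_pos) (auto intro: add_pos_pos)

lemma Ct_const_pos:
  assumes "d > 0" "p \<ge> 1" "0 < t" "t < 1"
  shows "Ct_const d p t > 0"
  using assms by (auto simp: Ct_const_def intro!: C_const_pos)

lemma B_const_pos:
  assumes "d > 0" "p \<ge> 1" "0 \<le> t" "t \<le> 1"
  shows "B_const d p t > 0"
  using assms unfolding B_const_def
  by (auto intro!: divide_pos_pos mult_pos_pos sphere_area_pos K_const_pos Ct_const_pos)

text \<open>Unifies the endpoint normalisations with t(1-t), so all three seminorm powers differ by
  positive factors depending only on d, p and t.\<close>

definition renorm_factor :: "nat \<Rightarrow> real \<Rightarrow> real \<Rightarrow> real" where
  "renorm_factor d p t = (if t = 0 then 2 * sphere_area d / p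
     else if t = 1 then K_const d p * (sphere_area d / p) else t * (1 - t))"

lemma renorm_factor_pos:
  assumes "d > 0" "p \<ge> 1" "0 \<le> t" "t \<le> 1"
  shows "renorm_factor d p t > 0"
  using assms unfolding renorm_factor_def
  by (auto intro!: divide_pos_pos mult_pos_pos sphere_area_pos K_const_pos)

lemma renorm_pow_conv_gagliardo_pow:
  fixes u :: "'a::euclidean_space \<Rightarrow> real"
  shows "renorm_pow \<Omega> t p u = ennreal (renorm_factor DIM('a) p t) * gagliardo_pow \<Omega> t p u"
  by (simp add: renorm_pow_def renorm_factor_def gagliardo_pow_def)

lemma gagliardo_pow_conv_renorm_pow:
  fixes u :: "'a::euclidean_space \<Rightarrow> real"
  assumes "p \<ge> 1" "0 \<le> t" "t \<le> 1"
  shows "gagliardo_pow \<Omega> t p u = ennreal (1 / renorm_factor DIM('a) p t) * renorm_pow \<Omega> t p u"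
  using renorm_factor_pos[of "DIM('a)" p t] assms
  by (simp add: renorm_pow_conv_gagliardo_pow ennreal_mult_assoc)

lemma star_pow_conv_renorm_pow:
  fixes u :: "'a::euclidean_space \<Rightarrow> real"
  assumes "p \<ge> 1" "0 \<le> t" "t \<le> 1"
  shows "star_pow \<Omega> t p u = ennreal (B_const DIM('a) p t) * renorm_pow \<Omega> t p u"
proof -
  have d: "DIM('a) > 0" by simp
  have B: "B_const DIM('a) p t \<ge> 0"
    using B_const_pos[OF d assms] by simp
  have "B_const DIM('a) p t * renorm_factor DIM('a) p t =
     (if t = 0 \<or> t = 1 then 1 else Ct_const DIM('a) p t / 2)"
    using assms sphere_area_pos[OF d] K_const_pos[OF d assms(1)]
    by (auto simp: B_const_def renorm_factor_def field_simps)
  then show ?thesis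
    unfolding renorm_pow_conv_gagliardo_pow ennreal_mult_assoc[OF B]
    by (simp add: star_pow_def gagliardo_pow_def)
qed

section \<open>The Upsilon constants and the three families of seminorms\<close>

context interpolation_exponents
begin

lemma exponents_range: "0 < \<eta>" "\<eta> < 1" "0 \<le> s" "0 \<le> \<sigma>" "\<sigma> \<le> 1"
  using \<sigma> \<eta> s by auto

lemma kappa_ge_1: "1 \<le> kappa d p"
  using rcp_nonneg by (simp add: kappa_def ge_one_powr_ge_zero)

lemma kappa_le: "kappa d p \<le> 2 powr rcp p"
  using rcp_nonneg by (simp add: kappa_def ge_one_powr_ge_zero)

text \<open>Brings Upsilon into the form delivered by the weighted root inequality with weight
  1/\<open>renorm_factor\<close>. Its four cases are the endpoint values of that factor; for
  \<sigma> = 0 and s = 1 the two powers of the sphere area over q combine to exponent 1.\<close>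

lemma Upsilon_finite:
  assumes q: "p = ennreal q" "q \<ge> 1" and "d > 0"
  shows "Upsilon d p \<sigma> \<eta> s = kappa d p * N_const p \<sigma> \<eta> s *
    ((1 / renorm_factor d q \<eta>) / ((1 / renorm_factor d q s) powr \<theta> * (1 / renorm_factor d q \<sigma>) powr (1 - \<theta>))) powr (1 / q)"
proof -
  define F where "F = (if \<sigma> \<noteq> 0 \<and> s \<noteq> 1 then
             ((s * (1 - s)) powr \<theta> * (\<sigma> * (1 - \<sigma>)) powr (1 - \<theta>)) powr rcp p
           else if \<sigma> \<noteq> 0 \<and> s = 1 then
             ((K_const d q * (sphere_area d / q)) powr \<theta> * (\<sigma> * (1 - \<sigma>)) powr (1 - \<theta>)) powr rcp p
           else if \<sigma> = 0 \<and> s \<noteq> 1 then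
             ((s * (1 - s)) powr \<theta> * (2 * sphere_area d / q) powr (1 - \<theta>)) powr rcp p
           else
             (sphere_area d / q * K_const d q powr \<theta> * 2 powr (1 - \<theta>)) powr rcp p)"
  have U: "Upsilon d p \<sigma> \<eta> s = kappa d p * N_const p \<sigma> \<eta> s / (\<eta> * (1 - \<eta>)) powr rcp p * F"
    using q unfolding Upsilon_def F_def \<theta>_def[symmetric] by (simp add: Let_def)
  have rcp: "rcp p = 1 / q" using q by (simp add: rcp_ennreal)
  note S = sphere_area_pos[OF \<open>d > 0\<close>] and K = K_const_pos[OF \<open>d > 0\<close> q(2)]
  have F: "F = (renorm_factor d q s powr \<theta> * renorm_factor d q \<sigma> powr (1 - \<theta>)) powr (1 / q)"
  proof (cases "\<sigma> = 0 \<and> s = 1")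
    case True
    have "(sphere_area d / q) powr \<theta> * (sphere_area d / q) powr (1 - \<theta>) = sphere_area d / q"
      using S q by (simp flip: powr_add)
    then have "sphere_area d / q * K_const d q powr \<theta> * 2 powr (1 - \<theta>)
       = (K_const d q * (sphere_area d / q)) powr \<theta> * (2 * (sphere_area d / q)) powr (1 - \<theta>)"
    proof -
      have "x = y * z \<Longrightarrow> x * k * w = k * y * (w * z)" for x y z k w :: real
        by (simp add: ac_simps)
      from this[OF \<open>_ * _ = sphere_area d / q\<close>[symmetric]] show ?thesis
        using S K q by (simp only: powr_mult)
    qed
    then show ?thesis
      using True by (simp add: F_def rcp renorm_factor_def)
  qed (use \<sigma> \<eta> s in \<open>auto simp: F_def rcp renorm_factor_def\<close>)
  have r\<eta>: "renorm_factor d q \<eta> = \<eta> * (1 - \<eta>)"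
    using exponents_range by (simp add: renorm_factor_def)
  have pos: "renorm_factor d q s > 0" "renorm_factor d q \<sigma> > 0" "\<eta> * (1 - \<eta>) > 0"
    using renorm_factor_pos[OF \<open>d > 0\<close> q(2)] exponents_range s by auto
  have "(1 / (\<eta> * (1 - \<eta>))) / ((1 / renorm_factor d q s) powr \<theta> * (1 / renorm_factor d q \<sigma>) powr (1 - \<theta>))
     = (renorm_factor d q s powr \<theta> * renorm_factor d q \<sigma> powr (1 - \<theta>)) / (\<eta> * (1 - \<eta>))"
    using pos by (simp add: powr_divide)
  then show ?thesis
    unfolding U F r\<eta> rcp using pos by (simp add: powr_divide)
qed

lemma Upsilon_star_finite:
  assumes q: "p = ennreal q" "q \<ge> 1"
  shows "Upsilon_star d p \<sigma> \<eta> s = kappa d p * N_const p \<sigma> \<eta> s *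
    (B_const d q \<eta> / (B_const d q s powr \<theta> * B_const d q \<sigma> powr (1 - \<theta>))) powr (1 / q)"
  using q unfolding Upsilon_star_def \<theta>_def[symmetric] by (simp add: Let_def rcp_ennreal)

text \<open>If the infimum is 0 or the supremum \<infinity>, the quotient in \<open>ennreal\<close>
  is \<infinity>. Otherwise the weighted geometric mean in the denominator is at least the infimum,
  and \<open>kappa\<close> and N supply the powers of 2.\<close>

lemma Upsilon_star_le:
  assumes q: "p = ennreal q" "q \<ge> 1" and "d > 0"
  shows "ennreal (Upsilon_star d p \<sigma> \<eta> s) \<le> ennreal (2 powr (1 + 2 * rcp p)) * (B_max d q / B_min d q)"
proof -
  define M where "M = enn2real (B_min d q)"
  have Bpos: "B_const d q t > 0" if "0 \<le> t" "t \<le> 1" for t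
    using B_const_pos[OF \<open>d > 0\<close> q(2) that] .
  have min_le: "B_min d q \<le> ennreal (B_const d q t)" if "0 \<le> t" "t \<le> 1" for t
    unfolding B_min_def using that by (intro INF_lower) auto
  have max_ge: "ennreal (B_const d q t) \<le> B_max d q" if "0 \<le> t" "t \<le> 1" for t
    unfolding B_max_def using that by (intro SUP_upper) auto
  have "B_min d q < \<top>"
    using min_le[of 0] by (auto simp: less_top[symmetric] top_unique)
  then have M: "B_min d q = ennreal M" "M \<ge> 0"
    by (auto simp: M_def)
  have M_le: "M \<le> B_const d q t" if "0 \<le> t" "t \<le> 1" for t
    using min_le[OF that] M Bpos[OF that] by (simp add: ennreal_le_iff)
  show ?thesis
  proof (cases "M = 0 \<or> B_max d q = \<top>")
    case True
    have "B_max d q \<noteq> 0" using max_ge[of 0] Bpos[of 0] by auto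
    then have "B_max d q / B_min d q = \<top>"
      using True M by (auto simp: ennreal_divide_eq_top_iff)
    then show ?thesis by (simp add: ennreal_mult_top)
  next
    case False
    then have "M > 0" using M by simp
    obtain L where L: "B_max d q = ennreal L" "L \<ge> 0" using False by (cases "B_max d q") auto
    have le_L: "B_const d q t \<le> L" if "0 \<le> t" "t \<le> 1" for t
      using max_ge[OF that] L by (simp add: ennreal_le_iff)
    have "M = M powr \<theta> * M powr (1 - \<theta>)" using \<open>M > 0\<close> by (simp flip: powr_add)
    also have "\<dots> \<le> B_const d q s powr \<theta> * B_const d q \<sigma> powr (1 - \<theta>)"
      using M_le \<open>M > 0\<close> exponents_range s \<theta> by (intro mult_mono powr_mono2) auto
    finally have "B_const d q \<eta> / (B_const d q s powr \<theta> * B_const d q \<sigma> powr (1 - \<theta>)) \<le> L / M"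
      using le_L[of \<eta>] Bpos[of \<eta>] exponents_range \<open>M > 0\<close> by (intro frac_le) auto
    then have "(B_const d q \<eta> / (B_const d q s powr \<theta> * B_const d q \<sigma> powr (1 - \<theta>))) powr (1 / q) \<le> (L / M) powr (1 / q)"
      using q Bpos[of \<eta>] exponents_range by (intro powr_mono2) auto
    \<comment> \<open>This allows the exponent 1/q to be raised to 1.\<close>
    also have "1 \<le> L / M"
      using M_le[of 0] le_L[of 0] \<open>M > 0\<close> by (simp add: le_divide_eq)
    then have "(L / M) powr (1 / q) \<le> (L / M) powr 1"
      using q by (intro powr_mono) auto
    also have "(L / M) powr 1 = L / M"
      using L \<open>M > 0\<close> by simp
    finally have "Upsilon_star d p \<sigma> \<eta> s \<le> (2 powr rcp p * 2 powr (1 + rcp p)) * (L / M)"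
      unfolding Upsilon_star_finite[OF q]
      using kappa_le kappa_ge_1[of d] N_const_le N_const_ge_1 by (intro mult_mono) auto
    also have "2 powr rcp p * 2 powr (1 + rcp p) = 2 powr (1 + 2 * rcp p)"
      by (simp add: add.commute flip: powr_add)
    finally have "ennreal (Upsilon_star d p \<sigma> \<eta> s) \<le> ennreal (2 powr (1 + 2 * rcp p)) * ennreal (L / M)"
      using L \<open>M > 0\<close> by (simp add: ennreal_leI flip: ennreal_mult)
    then show ?thesis
      using M L \<open>M > 0\<close> by (simp add: divide_ennreal)
  qed
qed

text \<open>The three inequalities are one, taken with weights 1, 1/\<open>renorm_factor\<close> and
  \<open>B_const\<close> relative to the renormalized powers. The parameter c lets the constants for
  the whole space and the half space share a statement.\<close>

lemma seminorm_interpolation: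
  fixes \<Omega> :: "'a::euclidean_space set"
  assumes "open \<Omega>" and cone: "\<And>h. h \<in> translation_cone \<Omega> \<or> - h \<in> translation_cone \<Omega>"
    and H: "increment_cone \<Omega> H" and u: "u \<in> borel_measurable lebesgue" and c: "1 \<le> c"
  shows "renorm \<Omega> \<eta> p u \<le> ennreal (c * kappa DIM('a) p * N_const p \<sigma> \<eta> s)
      * renorm \<Omega> s p u epowr \<theta> * renorm \<Omega> \<sigma> p u epowr (1 - \<theta>)" (is ?I)
    and "gagliardo \<Omega> \<eta> p u \<le> ennreal (c * Upsilon DIM('a) p \<sigma> \<eta> s)
      * gagliardo \<Omega> s p u epowr \<theta> * gagliardo \<Omega> \<sigma> p u epowr (1 - \<theta>)" (is ?II)
    and "star_seminorm \<Omega> \<eta> p u \<le> ennreal (c * Upsilon_star DIM('a) p \<sigma> \<eta> s)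
      * star_seminorm \<Omega> s p u epowr \<theta> * star_seminorm \<Omega> \<sigma> p u epowr (1 - \<theta>)" (is ?III)
proof -
  note N = N_const_ge_1
  have "?I \<and> ?II \<and> ?III"
  proof (cases "p = \<infinity>")
    case True
    let ?W = "\<lambda>t. Winf_seminorm \<Omega> t u"
    have "?W \<eta> \<le> ennreal x * ?W s epowr \<theta> * ?W \<sigma> epowr (1 - \<theta>)" if "N_const p \<sigma> \<eta> s \<le> x" for x
    proof -
      have "?W \<eta> \<le> ennreal (N_const p \<sigma> \<eta> s) * ?W s epowr \<theta> * ?W \<sigma> epowr (1 - \<theta>)"
        by (rule Winf_seminorm_interpolation[OF \<open>open \<Omega>\<close> H u])
      also have "\<dots> \<le> ennreal x * ?W s epowr \<theta> * ?W \<sigma> epowr (1 - \<theta>)"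
        using that by (intro mult_right_mono ennreal_leI) auto
      finally show ?thesis .
    qed
    moreover have "N_const p \<sigma> \<eta> s \<le> c * kappa DIM('a) p * N_const p \<sigma> \<eta> s"
      using N c kappa_ge_1[of "DIM('a)"] mult_mono[of 1 c 1 "kappa DIM('a) p"] by (simp add: mult_le_cancel_right1)
    moreover have "N_const p \<sigma> \<eta> s \<le> c * N_const p \<sigma> \<eta> s"
      using N c by (simp add: mult_le_cancel_right1)
    ultimately show ?thesis
      using True by (simp add: renorm_def gagliardo_def star_seminorm_def Upsilon_def Upsilon_star_def)
  next
    case False
    then obtain q where q: "p = ennreal q" "q \<ge> 1"
      using p by (cases p) auto
    obtain u' where u': "u' \<in> borel_measurable lborel" "AE x in lborel. u x = u' x"
      using completion_ex_borel_measurable_real[OF u] by blast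
    interpret sobolev_interpolation p \<sigma> \<eta> s \<theta> \<Omega> u u' q
    proof unfold_locales
      show "\<Omega> \<in> sets borel" using \<open>open \<Omega>\<close> by simp
      show "u' \<in> borel_measurable borel" using u'(1) by simp
      from small_increments_grad_pow_bound[OF \<open>open \<Omega>\<close> cone u this u'(2) q(2)]
      show "(\<integral>\<^sup>+h. increment_pow \<Omega> q u' h * radial_weight (q - a) h * indicator {h. norm h \<le> R} h \<partial>lborel)
        \<le> ennreal (R powr a / a * (K_const DIM('a) q * sphere_area DIM('a))) * grad_pow \<Omega> q u"
        if "0 < a" "a \<le> q" "0 < R" for a R
        using that .
    qed (fact q cone u'(2))+
    have q': "enn2real p = q" "rcp p = 1 / q" using q by (simp_all add: rcp_ennreal)
    have weighted: "(ennreal (w \<eta>) * renorm_pow \<Omega> \<eta> q u) epowr (1 / q) \<le>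
        ennreal (c * (kappa DIM('a) p * N_const p \<sigma> \<eta> s * (w \<eta> / (w s powr \<theta> * w \<sigma> powr (1 - \<theta>))) powr (1 / q)))
        * ((ennreal (w s) * renorm_pow \<Omega> s q u) epowr (1 / q)) epowr \<theta>
        * ((ennreal (w \<sigma>) * renorm_pow \<Omega> \<sigma> q u) epowr (1 / q)) epowr (1 - \<theta>)"
      if w: "\<And>t. 0 \<le> t \<Longrightarrow> t \<le> 1 \<Longrightarrow> w t > 0" for w
    proof (rule interpolation_root[OF q(2) _ renorm_pow_interpolation])
      show "N_const p \<sigma> \<eta> s > 0" using N by simp
      show "w \<eta> > 0" "w s > 0" "w \<sigma> > 0" using w exponents_range s by auto
      let ?r = "(w \<eta> / (w s powr \<theta> * w \<sigma> powr (1 - \<theta>))) powr (1 / q)"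
      have "1 \<le> c * kappa DIM('a) p"
        using c kappa_ge_1[of "DIM('a)"] mult_mono[of 1 c 1 "kappa DIM('a) p"] by simp
      then have "1 * (N_const p \<sigma> \<eta> s * ?r) \<le> c * kappa DIM('a) p * (N_const p \<sigma> \<eta> s * ?r)"
        using N by (intro mult_right_mono) auto
      then show "N_const p \<sigma> \<eta> s * ?r \<le> c * (kappa DIM('a) p * N_const p \<sigma> \<eta> s * ?r)"
        by (simp add: ac_simps)
    qed
    have d: "DIM('a) > 0" by simp
    have I: ?I
      using weighted[of "\<lambda>_. 1"] False by (simp add: renorm_def q' mult.assoc)
    have II: ?II
      using weighted[of "\<lambda>t. 1 / renorm_factor DIM('a) q t"] renorm_factor_pos[OF d q(2)] False exponents_range s q(2)
      by (simp add: gagliardo_def q' Upsilon_finite[OF q d] gagliardo_pow_conv_renorm_pow)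
    have III: ?III
      using weighted[of "B_const DIM('a) q"] B_const_pos[OF d q(2)] False exponents_range s q(2)
      by (simp add: star_seminorm_def q' Upsilon_star_finite[OF q] star_pow_conv_renorm_pow)
    from I II III show ?thesis by blast
  qed
  then show ?I ?II ?III by blast+
qed

end

section \<open>The whole space and the half space\<close>

lemma translation_cone_UNIV: "h \<in> translation_cone UNIV"
  by (simp add: translation_cone_def)

lemma increment_cone_UNIV: "increment_cone UNIV UNIV"
  by (auto simp: increment_cone_def translation_cone_UNIV)

lemma open_half_space: "open (half_space e)"
  unfolding half_space_def by (intro open_Collect_less continuous_intros)

lemma translation_cone_half_space: "0 \<le> h \<bullet> e \<Longrightarrow> h \<in> translation_cone (half_space e)"
  by (auto simp: translation_cone_def half_space_def inner_simps add_pos_nonneg)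

lemma increment_cone_half_space:
  assumes "e \<noteq> 0"
  shows "increment_cone (half_space e) (half_space e)"
  unfolding increment_cone_def
proof (intro conjI allI impI)
  show "half_space e \<subseteq> translation_cone (half_space e)"
  proof
    fix h assume "h \<in> half_space e"
    then have "0 \<le> h \<bullet> e" by (simp add: half_space_def)
    then show "h \<in> translation_cone (half_space e)" by (rule translation_cone_half_space)
  qed
  show "(\<forall>k\<in>half_space e. k + d \<in> half_space e) \<or> (\<forall>k\<in>half_space e. k - d \<in> half_space e)" for d
    \<comment> \<open>The sign of d.e decides which of the two points has the larger set of
      admissible increments.\<close>
    by (cases "d \<bullet> e \<ge> 0") (auto simp: half_space_def inner_simps)
  fix \<epsilon> :: real assume "\<epsilon> > 0"
  then have "(\<epsilon> / (2 * norm e)) *\<^sub>R e \<in> half_space e \<inter> ball 0 \<epsilon>"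
    using assms by (auto simp: half_space_def intro!: mult_pos_pos divide_pos_pos)
  then show "half_space e \<inter> ball 0 \<epsilon> \<noteq> {}" by blast
qed (rule open_half_space)

theorem theorem1p1:
  fixes u :: "'a::euclidean_space \<Rightarrow> real" and p :: ennreal and \<sigma> \<eta> s \<theta> :: real and e :: 'a
  assumes "1 \<le> p"
    and "u \<in> Lp_space UNIV p"
    and "0 \<le> \<sigma>" and "\<sigma> < \<eta>" and "\<eta> < s" and "s \<le> 1"
    and "\<theta> = (\<eta> - \<sigma>) / (s - \<sigma>)"
    and "e \<in> Basis"
  shows "0 < \<theta> \<and> \<theta> < 1 \<and> \<eta> = \<theta> * s + (1 - \<theta>) * \<sigma>
    \<and> 1 \<le> N_const p \<sigma> \<eta> s \<and> N_const p \<sigma> \<eta> s \<le> 2 powr (1 + rcp p)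

    \<and> renorm UNIV \<eta> p u
        \<le> ennreal (kappa DIM('a) p * N_const p \<sigma> \<eta> s)
           * renorm UNIV s p u epowr \<theta> * renorm UNIV \<sigma> p u epowr (1 - \<theta>)
    \<and> renorm (half_space e) \<eta> p u
        \<le> ennreal (4 powr rcp p * kappa DIM('a) p * N_const p \<sigma> \<eta> s)
           * renorm (half_space e) s p u epowr \<theta> * renorm (half_space e) \<sigma> p u epowr (1 - \<theta>)

    \<and> gagliardo UNIV \<eta> p u
        \<le> ennreal (Upsilon DIM('a) p \<sigma> \<eta> s)
           * gagliardo UNIV s p u epowr \<theta> * gagliardo UNIV \<sigma> p u epowr (1 - \<theta>)
    \<and> gagliardo (half_space e) \<eta> p u
        \<le> ennreal (4 powr rcp p * Upsilon DIM('a) p \<sigma> \<eta> s)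
           * gagliardo (half_space e) s p u epowr \<theta> * gagliardo (half_space e) \<sigma> p u epowr (1 - \<theta>)

    \<and> star_seminorm UNIV \<eta> p u
        \<le> ennreal (Upsilon_star DIM('a) p \<sigma> \<eta> s)
           * star_seminorm UNIV s p u epowr \<theta> * star_seminorm UNIV \<sigma> p u epowr (1 - \<theta>)
    \<and> star_seminorm (half_space e) \<eta> p u
        \<le> ennreal (4 powr rcp p * Upsilon_star DIM('a) p \<sigma> \<eta> s)
           * star_seminorm (half_space e) s p u epowr \<theta>
           * star_seminorm (half_space e) \<sigma> p u epowr (1 - \<theta>)
    \<and> (p < \<infinity> \<longrightarrow>
        ennreal (Upsilon_star DIM('a) p \<sigma> \<eta> s)
          \<le> ennreal (2 powr (1 + 2 * rcp p))
             * (B_max DIM('a) (enn2real p) / B_min DIM('a) (enn2real p)))"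
proof -
  interpret interpolation_exponents p \<sigma> \<eta> s \<theta>
    using assms by unfold_locales
  have u: "u \<in> borel_measurable lebesgue"
    using assms(2) by (simp add: Lp_space_def lebesgue_on_UNIV_eq)
  have "e \<noteq> 0" using \<open>e \<in> Basis\<close> by auto
  \<comment> \<open>The recession cone contains every h with h.e \<ge> 0, so it and its negative
    cover all directions; this replaces an extension of u across the boundary.\<close>
  have cone: "h \<in> translation_cone (half_space e) \<or> - h \<in> translation_cone (half_space e)" for h
    using translation_cone_half_space[of h e] translation_cone_half_space[of "- h" e] by (cases "0 \<le> h \<bullet> e") auto
  have c: "1 \<le> 4 powr rcp p"
    using rcp_nonneg by (simp add: ge_one_powr_ge_zero)
  have "ennreal (Upsilon_star DIM('a) p \<sigma> \<eta> s) \<le> ennreal (2 powr (1 + 2 * rcp p))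
      * (B_max DIM('a) (enn2real p) / B_min DIM('a) (enn2real p))" if "p < \<infinity>"
  proof -
    obtain q where "p = ennreal q" "q \<ge> 1"
      using assms(1) \<open>p < \<infinity>\<close> by (cases p) auto
    then show ?thesis using Upsilon_star_le[of q "DIM('a)"] by simp
  qed
  then show ?thesis
    using \<theta> N_const_ge_1 N_const_le
      seminorm_interpolation[OF open_UNIV disjI1[OF translation_cone_UNIV] increment_cone_UNIV u order_refl]
      seminorm_interpolation[OF open_half_space cone increment_cone_half_space[OF \<open>e \<noteq> 0\<close>] u c]
    by (simp add: mult.assoc)
qed

end
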